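(* For every real $z>1$, \[ \lim_{x\to\infty } \frac{\#\{p\leq x \text{ prime}: n_2(p) > z\, n_1(p) \}}{\pi(x) } = \sum_{m= 1 }^\infty 2^{-n(m,z)}, \] where $n(m,z)$ is the largest integer $n$ for which $p_n \leq z\, p_m$.
   Context: For a prime $p$, $n_k(p)$ denotes the $k$-th smallest prime that is a quadratic non-residue modulo $p$. $p_n$ denotes the $n$-th smallest prime ($p_1=2$), and $\pi(x)$ denotes the number of primes $\le x$. *)

theory Defs
  imports "HOL-Analysis.Analysis" "HOL-Number_Theory.Number_Theory" "HOL-Library.Infinite_Set"
begin

definition nonres_primes :: "nat \<Rightarrow> nat set" where
  "nonres_primes p = {q. prime q \<and> Legendre (int q) (int p) = -1}"

definition nres :: "nat \<Rightarrow> nat \<Rightarrow> nat" where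
  "nres k p = enumerate (nonres_primes p) (k - 1)"

definition nth_prime :: "nat \<Rightarrow> nat" where
  "nth_prime n = enumerate {p. prime p} (n - 1)"

definition prime_pi :: "real \<Rightarrow> nat" where
  "prime_pi x = card {p::nat. prime p \<and> real p \<le> x}"

definition nmz :: "nat \<Rightarrow> real \<Rightarrow> nat" where
  "nmz m z = Max {n. n \<ge> 1 \<and> real (nth_prime n) \<le> z * real (nth_prime m)}"

end

theory Submission
  imports Defs "HOL-Complex_Analysis.Complex_Analysis" "HOL-Computational_Algebra.Squarefree"
    "HOL-Real_Asymp.Real_Asymp"
begin

text \<open>
  If \<open>n\<^sub>1(p) = p\<^sub>m\<close>, then \<open>n\<^sub>2(p) > z n\<^sub>1(p)\<close> says that, among the first \<open>n(m,z)\<close> primes, exactly \<open>p\<^sub>m\<close>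
  is a non-residue modulo \<open>p\<close>. Expanding the indicator of such a sign pattern into products of
  Legendre symbols, its density is \<open>2\<^bsup>-n(m,z)\<^esup>\<close> as soon as
  \<open>\<Sum>\<^bsub>p \<le> x\<^esub> \<psi>(p) = o(\<pi>(x))\<close> for the nontrivial real characters \<open>\<psi>\<close> which quadratic
  reciprocity attaches to these products. The primes \<open>p\<close> modulo which the first \<open>M\<close> primes are all
  residues have density \<open>2\<^bsup>-M\<^esup>\<close>, so the sum over \<open>m\<close> may be taken termwise.

  The estimate for \<open>\<psi>\<close> is of the depth of the prime number theorem. Newman's contour argument,
  applied to \<open>1/L(s,\<psi>)\<close>, shows that \<open>\<Sum> \<psi>(n)\<mu>(n)/n\<close> converges, whence
  \<open>\<Sum>\<^bsub>n \<le> x\<^esub> \<psi>(n)\<mu>(n) = o(x)\<close>; the hyperbola method transfers this to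
  \<open>\<Sum>\<^bsub>n \<le> x\<^esub> \<psi>(n)\<Lambda>(n)\<close>, and Chebyshev's bounds to the sum over primes. Newman's argument needs that
  \<open>L(s,\<psi>)\<close> has no zero on the line \<open>Re s = 1\<close>, which follows from \<open>3 + 4 cos \<theta> + cos 2\<theta> \<ge> 0\<close> off the
  real axis and from Monsky's Lambert series argument at \<open>s = 1\<close>.
\<close>

section \<open>Newman's contour\<close>

text \<open>Newman's theorem is applied to \<open>1 / L\<close> and not to \<open>L' / L\<close>
  because the coefficients \<open>\<psi> n * moebius n\<close> are bounded by 1 outright, as
  Newman's hypothesis demands, whereas those of \<open>L' / L\<close> are not bounded. The price is
  the hyperbola step back to \<open>mangoldt\<close>. Only real characters arise, since the
  indicator of a sign pattern is a polynomial in Legendre symbols. Realness is also what makes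
  \<open>s = 1\<close> a separate case: the square of \<open>\<psi>\<close> is principal, its
  L-function has a pole at 1, and for t = 0 this pole enters the inequality at 1 + 2it as well. The
  inequality then reads 4 - 4k >= 0 for the order k of the zero and no longer excludes k = 1.
  Finitely many primes p always misbehave: p = 2 has no non-residues, so \<open>nres\<close> takes a
  default value there, and a symbol is 0 when p is one of the primes q of the pattern. Such p
  contribute a bounded amount, which vanishes against \<open>prime_count x\<close>.\<close>

text \<open>Each path carries half a turn around 0, so the closed path has winding number 1 and
  Cauchy's formula applies. The two halves stay separate because the same right half circle is later
  closed in two ways, by a rectangle for \<open>f\<close> and by the left half circle for an entire
  function.\<close>

lemma Cauchy_formula_two_paths:
  assumes W: "convex W" "open W" "f holomorphic_on W" "0 \<in> W"
    and p: "valid_path p" "path_image p \<subseteq> W - {0}" "((\<lambda>z. 1 / z) has_contour_integral pi * \<i>) p"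
    and q: "valid_path q" "path_image q \<subseteq> W - {0}" "((\<lambda>z. 1 / z) has_contour_integral pi * \<i>) q"
    and pq: "pathfinish p = pathstart q" "pathfinish q = pathstart p"
  shows "\<exists>I J. ((\<lambda>z. f z / z) has_contour_integral I) p \<and> ((\<lambda>z. f z / z) has_contour_integral J) q
           \<and> I + J = 2 * pi * \<i> * f 0"
proof -
  have v: "valid_path (p +++ q)" using p q pq by auto
  have im: "path_image (p +++ q) \<subseteq> W - {0}"
    using p q path_image_join_subset by blast
  have "((\<lambda>z. 1 / z) has_contour_integral (pi * \<i> + pi * \<i>)) (p +++ q)"
    by (rule has_contour_integral_join) (use p q in auto)
  then have ci: "contour_integral (p +++ q) (\<lambda>z. 1 / z) = 2 * pi * \<i>"
    using contour_integral_unique by fastforce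
  have w: "winding_number (p +++ q) 0 = 1"
    by (subst winding_number_valid_path[OF v]) (use im ci in auto)
  have "((\<lambda>z. f z / (z - 0)) has_contour_integral (2 * pi * \<i> * winding_number (p +++ q) 0 * f 0)) (p +++ q)"
    by (rule Cauchy_integral_formula_convex_simple[OF W(1,3)])
      (use W v im pq interior_open in auto)
  then have F: "((\<lambda>z. f z / z) has_contour_integral (2 * pi * \<i> * f 0)) (p +++ q)"
    by (simp add: w)
  then have "(\<lambda>z. f z / z) contour_integrable_on (p +++ q)"
    by (auto simp: contour_integrable_on_def)
  then have "(\<lambda>z. f z / z) contour_integrable_on p" "(\<lambda>z. f z / z) contour_integrable_on q"
    using p(1) q(1) by auto
  then obtain I J where I: "((\<lambda>z. f z / z) has_contour_integral I) p"
    and J: "((\<lambda>z. f z / z) has_contour_integral J) q"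
    by (auto simp: contour_integrable_on_def)
  have "((\<lambda>z. f z / z) has_contour_integral (I + J)) (p +++ q)"
    by (rule has_contour_integral_join) (use I J p q in auto)
  then show ?thesis using I J F has_contour_integral_unique by blast
qed

lemma integral_inverse_half_circle:
  assumes "R > 0"
  shows "((\<lambda>z. 1 / z) has_contour_integral pi * \<i>) (part_circlepath 0 R s (s + pi))"
proof -
  have "((\<lambda>t. \<i>) has_integral (pi * \<i>)) {s..s + pi}"
    using has_integral_const_real[of \<i> s "s + pi"] by (simp add: scaleR_conv_of_real)
  moreover have "\<i> = 1 / (0 + R * cis t) * R * \<i> * cis t" for t
    using assms by (simp add: field_simps)
  ultimately have "((\<lambda>t. 1 / (0 + R * cis t) * R * \<i> * cis t) has_integral (pi * \<i>)) {s..s + pi}"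
    by (simp only: )
  then show ?thesis
    by (subst has_contour_integral_part_circlepath_iff) (auto)
qed

text \<open>Three sides of a rectangle, run downwards so that they close the right half circle
  counterclockwise while staying in the thin strip to which the function extends.\<close>

definition left_path :: "real \<Rightarrow> real \<Rightarrow> real \<Rightarrow> complex" where
  "left_path R d = linepath (Complex 0 R) (Complex (-d) R) +++
     linepath (Complex (-d) R) (Complex (-d) (-R)) +++ linepath (Complex (-d) (-R)) (Complex 0 (-R))"

lemma segment_horizontal:
  assumes "w \<in> closed_segment (Complex a b) (Complex a' b)"
  shows "Im w = b \<and> min a a' \<le> Re w \<and> Re w \<le> max a a'"
proof -
  obtain u where u: "0 \<le> u" "u \<le> 1" "w = (1 - u) *\<^sub>R Complex a b + u *\<^sub>R Complex a' b"
    using assms by (auto simp: in_segment)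
  have im: "Im w = b" unfolding u(3) by (simp add: algebra_simps)
  have re: "Re w = (1 - u) * a + u * a'" using u by simp
  have "(1-u) * min a a' + u * min a a' \<le> Re w" "Re w \<le> (1-u) * max a a' + u * max a a'"
    unfolding re by (intro add_mono mult_left_mono; use u in simp)+
  then show ?thesis using im by (simp add: algebra_simps)
qed

lemma segment_vertical:
  assumes "w \<in> closed_segment (Complex a b) (Complex a b')"
  shows "Re w = a \<and> min b b' \<le> Im w \<and> Im w \<le> max b b'"
proof -
  obtain u where u: "0 \<le> u" "u \<le> 1" "w = (1 - u) *\<^sub>R Complex a b + u *\<^sub>R Complex a b'"
    using assms by (auto simp: in_segment)
  have re: "Re w = a" unfolding u(3) by (simp add: algebra_simps)
  have im: "Im w = (1 - u) * b + u * b'" using u by simp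
  have "(1-u) * min b b' + u * min b b' \<le> Im w" "Im w \<le> (1-u) * max b b' + u * max b b'"
    unfolding im by (intro add_mono mult_left_mono; use u in simp)+
  then show ?thesis using re by (simp add: algebra_simps)
qed

text \<open>The last claim says that the path misses the nonnegative real axis, as the branch
  \<open>Ln (- z)\<close> requires.\<close>

lemma path_image_left_path:
  assumes "R > 0" "d > 0" "w \<in> path_image (left_path R d)"
  shows "w \<noteq> 0" "-d \<le> Re w" "Re w \<le> 0" "\<bar>Im w\<bar> \<le> R" "Re w < 0 \<or> Im w \<noteq> 0"
proof -
  have "w \<in> closed_segment (Complex 0 R) (Complex (-d) R) \<or>
     w \<in> closed_segment (Complex (-d) R) (Complex (-d) (-R)) \<or>
     w \<in> closed_segment (Complex (-d) (-R)) (Complex 0 (-R))"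
    using assms(3) by (auto simp: left_path_def path_image_join)
  then have "(-d \<le> Re w \<and> Re w \<le> 0) \<and> \<bar>Im w\<bar> \<le> R \<and> (Re w < 0 \<or> Im w \<noteq> 0)"
    using assms(1,2) segment_horizontal[of w 0 R "-d"] segment_vertical[of w "-d" R "-R"]
      segment_horizontal[of w "-d" "-R" 0] by (auto simp: min_def max_def split: if_splits)
  then show "w \<noteq> 0" "-d \<le> Re w" "Re w \<le> 0" "\<bar>Im w\<bar> \<le> R" "Re w < 0 \<or> Im w \<noteq> 0" by auto
qed

lemma left_path_simps [simp]:
  "valid_path (left_path R d)" "pathstart (left_path R d) = Complex 0 R"
  "pathfinish (left_path R d) = Complex 0 (-R)"
  by (auto simp: left_path_def)

text \<open>\<open>Ln (- z)\<close> is a primitive along the path, and its endpoint values differ by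
  twice \<i> * pi/2.\<close>

lemma integral_inverse_left_path:
  assumes "R > 0" "d > 0"
  shows "((\<lambda>z. 1 / z) has_contour_integral pi * \<i>) (left_path R d)"
proof -
  have "((\<lambda>z. 1 / z) has_contour_integral (Ln (- pathfinish (left_path R d)) - Ln (- pathstart (left_path R d)))) (left_path R d)"
  proof (rule contour_integral_primitive[where S = "path_image (left_path R d)"])
    fix x assume x: "x \<in> path_image (left_path R d)"
    then have "- x \<notin> \<real>\<^sub>\<le>\<^sub>0"
      using path_image_left_path[OF assms x] by (auto simp: complex_nonpos_Reals_iff)
    then show "((\<lambda>z. Ln (- z)) has_field_derivative 1 / x) (at x within path_image (left_path R d))"
      using path_image_left_path[OF assms x]
      by (auto intro!: derivative_eq_intros simp: field_simps)
  qed auto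
  moreover have a: "- Complex 0 (-R) = R * \<i>" "- Complex 0 R = - (R * \<i>)" by (auto simp: complex_eq_iff)
  moreover have "Ln (R * \<i>) = ln R + \<i> * pi/2" "Ln (- (R * \<i>)) = ln R - \<i> * pi/2"
    using Ln_times_of_real[of R \<i>] Ln_times_of_real[of R "-\<i>"] Ln_of_real[of R] assms by auto
  ultimately show ?thesis by (simp add: mult.commute)
qed

lemma imaginary_on_circle:
  assumes "norm z = R" "Re z = 0"
  shows "z \<in> {R * \<i>, - (R * \<i>)}"
proof -
  have "(Im z)^2 = R^2" using assms cmod_power2[of z] by simp
  then have "Im z = R \<or> Im z = -R" by (simp add: power2_eq_iff)
  then show ?thesis using assms(2) by (auto simp: complex_eq_iff)
qed

text \<open>On the right arc \<open>f\<close> and \<open>S\<close> must be estimated together, since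
  only their difference is small there. To the left they part: \<open>S\<close> is entire and may be
  integrated over the left half circle, while \<open>f\<close> is confined to the strip and runs
  along the rectangle. The four bounds belong to the two arcs, the two horizontal sides and the
  vertical side, weighted by their lengths.\<close>

lemma newman_contour_bound:
  fixes f S E :: "complex \<Rightarrow> complex"
  assumes R: "0 < R" "R < R'" and d: "0 < d" "d < d'"
    and f: "f holomorphic_on {z. -d' < Re z \<and> \<bar>Im z\<bar> < R'}"
    and S: "S holomorphic_on UNIV" and E: "E holomorphic_on UNIV" "E 0 = 1"
    and B: "B1 \<ge> 0" "B2 \<ge> 0" "B3 \<ge> 0" "B4 \<ge> 0"
    and B1: "\<And>z. norm z = R \<Longrightarrow> Re z > 0 \<Longrightarrow> norm ((f z - S z) * E z / z) \<le> B1"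
    and B2: "\<And>z. norm z = R \<Longrightarrow> Re z < 0 \<Longrightarrow> norm (S z * E z / z) \<le> B2"
    and B3: "\<And>z. -d \<le> Re z \<Longrightarrow> Re z \<le> 0 \<Longrightarrow> \<bar>Im z\<bar> = R \<Longrightarrow> norm (f z * E z / z) \<le> B3"
    and B4: "\<And>z. Re z = -d \<Longrightarrow> \<bar>Im z\<bar> \<le> R \<Longrightarrow> norm (f z * E z / z) \<le> B4"
  shows "2 * pi * norm (f 0 - S 0) \<le> pi * R * B1 + pi * R * B2 + 2 * d * B3 + 2 * R * B4"
proof -
  define W where "W = {z. -d' < Re z \<and> \<bar>Im z\<bar> < R'}"
  have Weq: "W = {z. Re z > -d'} \<inter> ({z. Im z > -R'} \<inter> {z. Im z < R'})"
    unfolding W_def by auto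
  have W: "convex W" "open W"
    unfolding Weq by (intro convex_Int convex_halfspace_Re_gt convex_halfspace_Im_gt convex_halfspace_Im_lt
      open_Int open_halfspace_Re_gt open_halfspace_Im_gt open_halfspace_Im_lt)+
  define A where "A = part_circlepath 0 R (-pi/2) (-pi/2 + pi)"
  define A' where "A' = part_circlepath 0 R (pi/2) (pi/2 + pi)"
  define L where "L = left_path R d"
  have c0: "cis (pi/2 + pi) = - \<i>" "cis (pi/2) = \<i>" "cis (-pi/2) = -\<i>" "cis (-pi/2 + pi) = \<i>"
    by (simp_all add: complex_eq_iff cos_add sin_add del: minus_divide_left)
      (simp_all add: cos_add[of "pi/2" pi, simplified] sin_add[of "pi/2" pi, simplified])
  have ends: "pathstart A = Complex 0 (-R)" "pathfinish A = Complex 0 R"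
    "pathstart A' = Complex 0 R" "pathfinish A' = Complex 0 (-R)"
    "pathstart L = Complex 0 R" "pathfinish L = Complex 0 (-R)"
    unfolding A_def A'_def L_def
    by (simp_all only: pathstart_part_circlepath pathfinish_part_circlepath left_path_simps
        flip: cis_conv_exp, simp_all only: c0, simp_all add: complex_eq_iff)
  have Aim: "norm z = R \<and> 0 \<le> Re z \<and> (Re z = 0 \<longrightarrow> z \<in> {R * \<i>, - (R * \<i>)})" if "z \<in> path_image A" for z
  proof -
    have "z \<in> (\<lambda>x. 0 + R * cis x) ` closed_segment (-pi/2) (-pi/2+pi)"
      using that unfolding A_def path_image_part_circlepath' by simp
    then obtain t where t: "z = R * cis t" "t \<in> closed_segment (-pi/2) (-pi/2+pi)" by fastforce
    then have t2: "-pi/2 \<le> t" "t \<le> pi/2" by (auto simp: closed_segment_eq_real_ivl split: if_splits)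
    have n: "norm z = R" using t R by (simp add: norm_mult)
    have "Re z \<ge> 0" using t t2 R cos_ge_zero[of t] by simp
    then show ?thesis using n imaginary_on_circle[OF n] by auto
  qed
  have A'im: "norm z = R \<and> Re z \<le> 0 \<and> (Re z = 0 \<longrightarrow> z \<in> {R * \<i>, - (R * \<i>)})" if "z \<in> path_image A'" for z
  proof -
    have "z \<in> (\<lambda>x. 0 + R * cis x) ` closed_segment (pi/2) (pi/2+pi)"
      using that unfolding A'_def path_image_part_circlepath' by simp
    then obtain t where t: "z = R * cis t" "t \<in> closed_segment (pi/2) (pi/2+pi)" by fastforce
    then have t2: "pi/2 \<le> t" "t \<le> pi/2 + pi" by (auto simp: closed_segment_eq_real_ivl split: if_splits)
    have n: "norm z = R" using t R by (simp add: norm_mult)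
    have "cos (t - pi) \<ge> 0" using t2 by (intro cos_ge_zero) auto
    then have "cos t \<le> 0" by (simp add: cos_diff)
    then have "Re z \<le> 0" using t R by (simp add: mult_nonneg_nonpos)
    then show ?thesis using n imaginary_on_circle[OF n] by auto
  qed
  have W0: "0 \<in> W" using R d unfolding W_def by auto
  have AW: "path_image A \<subseteq> W - {0}"
  proof
    fix z assume z: "z \<in> path_image A"
    have "\<bar>Im z\<bar> \<le> R" "0 \<le> Re z" "norm z = R" using Aim[OF z] abs_Im_le_cmod[of z] by auto
    then show "z \<in> W - {0}" using R d unfolding W_def by auto
  qed
  have A'0: "path_image A' \<subseteq> UNIV - {0}" "path_image A \<subseteq> UNIV - {0}"
    using A'im Aim R by force+
  have LW: "path_image L \<subseteq> W - {0}"
    unfolding L_def W_def using path_image_left_path[OF R(1) d(1)] R d by force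
  have iA: "((\<lambda>z. 1 / z) has_contour_integral pi * \<i>) A" "((\<lambda>z. 1 / z) has_contour_integral pi * \<i>) A'"
    unfolding A_def A'_def using integral_inverse_half_circle[OF R(1)] by blast+
  have iL: "((\<lambda>z. 1 / z) has_contour_integral pi * \<i>) L"
    unfolding L_def using integral_inverse_left_path[OF R(1) d(1)] .
  have vA: "valid_path A" "valid_path A'" "valid_path L" unfolding A_def A'_def L_def by auto
  have "(\<lambda>z. f z * E z) holomorphic_on W"
    using f E(1) unfolding W_def by (intro holomorphic_intros) (auto intro: holomorphic_on_subset)
  from Cauchy_formula_two_paths[OF W this W0 vA(1) AW iA(1) vA(3) LW iL] ends
  obtain I1 J1 where I1: "((\<lambda>z. f z * E z / z) has_contour_integral I1) A"
    and J1: "((\<lambda>z. f z * E z / z) has_contour_integral J1) L" and s1: "I1 + J1 = 2 * pi * \<i> * (f 0 * E 0)"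
    by auto
  have "(\<lambda>z. S z * E z) holomorphic_on UNIV" using S E by (intro holomorphic_intros)
  from Cauchy_formula_two_paths[OF convex_UNIV open_UNIV this UNIV_I vA(1) A'0(2) iA(1) vA(2) A'0(1) iA(2)] ends
  obtain I2 J2 where I2: "((\<lambda>z. S z * E z / z) has_contour_integral I2) A"
    and J2: "((\<lambda>z. S z * E z / z) has_contour_integral J2) A'" and s2: "I2 + J2 = 2 * pi * \<i> * (S 0 * E 0)"
    by auto
  have I: "((\<lambda>z. (f z - S z) * E z / z) has_contour_integral (I1 - I2)) A"
    using has_contour_integral_diff[OF I1 I2] by (simp add: algebra_simps diff_divide_distrib)
  \<comment> \<open>\<open>B1\<close> and \<open>B2\<close> say nothing where the circle meets the
    imaginary axis. The strong form of the arc bound ignores these two points.\<close>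
  have n1: "norm (I1 - I2) \<le> B1 * R * (-pi/2 + pi - (-pi/2))"
    using B1 Aim by (intro has_contour_integral_bound_part_circlepath_strong
      [OF I[unfolded A_def], of "{R * \<i>, - (R * \<i>)}"]) (use R B in \<open>fastforce simp: A_def\<close>)+
  have n2: "norm J2 \<le> B2 * R * (pi/2 + pi - pi/2)"
    using B2 A'im by (intro has_contour_integral_bound_part_circlepath_strong
      [OF J2[unfolded A'_def], of "{R * \<i>, - (R * \<i>)}"]) (use R B in \<open>fastforce simp: A'_def\<close>)+
  define F where "F = (\<lambda>z. f z * E z / z)"
  have "F contour_integrable_on L" using J1 unfolding F_def by (auto simp: contour_integrable_on_def)
  then have "F contour_integrable_on linepath (Complex 0 R) (Complex (-d) R)"
    "F contour_integrable_on linepath (Complex (-d) R) (Complex (-d) (-R))"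
    "F contour_integrable_on linepath (Complex (-d) (-R)) (Complex 0 (-R))"
    unfolding L_def left_path_def by simp_all
  then obtain a b c where a: "(F has_contour_integral a) (linepath (Complex 0 R) (Complex (-d) R))"
    and b: "(F has_contour_integral b) (linepath (Complex (-d) R) (Complex (-d) (-R)))"
    and c: "(F has_contour_integral c) (linepath (Complex (-d) (-R)) (Complex 0 (-R)))"
    unfolding contour_integrable_on_def by blast
  have "(F has_contour_integral (a + (b + c))) L"
    unfolding L_def left_path_def
    by (intro has_contour_integral_join a b c) auto
  then have abc: "J1 = a + (b + c)" using J1 has_contour_integral_unique unfolding F_def by blast
  have na: "norm a \<le> B3 * norm (Complex (-d) R - Complex 0 R)"
    by (intro has_contour_integral_bound_linepath[OF a B(3)])
      (unfold F_def, intro B3; use segment_horizontal[of _ 0 R "-d"] R d in fastforce)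
  have nc: "norm c \<le> B3 * norm (Complex 0 (-R) - Complex (-d) (-R))"
    by (intro has_contour_integral_bound_linepath[OF c B(3)])
      (unfold F_def, intro B3; use segment_horizontal[of _ "-d" "-R" 0] R d in fastforce)
  have nb: "norm b \<le> B4 * norm (Complex (-d) (-R) - Complex (-d) R)"
    by (intro has_contour_integral_bound_linepath[OF b B(4)])
      (unfold F_def, intro B4; use segment_vertical[of _ "-d" R "-R"] R d in fastforce)
  have cn: "norm (Complex (-d) R - Complex 0 R) = d" "norm (Complex 0 (-R) - Complex (-d) (-R)) = d"
    "norm (Complex (-d) (-R) - Complex (-d) R) = 2 * R"
    using R d by (auto simp: cmod_def real_sqrt_mult)
  have nJ1: "norm J1 \<le> B3 * d + (B4 * (2 * R) + B3 * d)"
    unfolding abc using na nb nc norm_triangle_ineq[of a "b + c"] norm_triangle_ineq[of b c]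
    unfolding cn by linarith
  have "2 * pi * \<i> * (f 0 - S 0) = (I1 - I2) + J1 - J2"
    using s1 s2 E(2) by (simp add: algebra_simps)
  then have "norm (2 * pi * \<i> * (f 0 - S 0)) \<le> norm (I1 - I2) + norm J1 + norm J2"
    by (metis norm_triangle_ineq norm_triangle_ineq4 add_right_mono order_trans)
  also have "norm (2 * pi * \<i> * (f 0 - S 0)) = 2 * pi * norm (f 0 - S 0)"
    by (simp add: norm_mult)
  finally show ?thesis using n1 n2 nJ1 by (simp add: algebra_simps)
qed

section \<open>Newman's Tauberian theorem\<close>

lemma powr_mean_value:
  fixes u v c :: real
  assumes "0 < u" "u < v"
  obtains w where "u < w" "w < v" "v powr c - u powr c = (v - u) * (c * w powr (c - 1))"
proof -
  have "\<exists>w>u. w < v \<and> v powr c - u powr c = (v - u) * (c * w powr (c - 1))"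
    using assms by (intro MVT2) (auto intro!: derivative_eq_intros)
  then show ?thesis using that by blast
qed

text \<open>By the mean value theorem each term is at most a difference of consecutive values of
  \<open>real n powr -x / x\<close>, and these telescope. The factor 1/x is what the kernel will
  absorb.\<close>

lemma powr_tail_sum_le:
  fixes x :: real
  assumes x: "x > 0" and N: "N \<ge> 1" "N \<le> M"
  shows "(\<Sum>n=N..<M. real (Suc n) powr (-1 - x)) \<le> (real N powr -x - real M powr -x) / x"
proof -
  have step: "real (Suc n) powr (-1 - x) \<le> (real n powr -x - real (Suc n) powr -x) / x" if n: "n \<ge> 1" for n
  proof -
    obtain w where w: "real n < w" "w < real (Suc n)"
      "real (Suc n) powr -x - real n powr -x = (real (Suc n) - real n) * (-x * w powr (-x - 1))"
      using powr_mean_value[of "real n" "real (Suc n)" "-x"] n by auto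
    have "real (Suc n) powr (-x - 1) \<le> w powr (-x - 1)"
      using w n x by (intro powr_mono2') auto
    then have "x * real (Suc n) powr (-x - 1) \<le> x * w powr (-x - 1)" using x by simp
    also have "\<dots> = real n powr -x - real (Suc n) powr -x" using w(3) by (simp add: algebra_simps)
    finally show ?thesis using x by (simp add: field_simps minus_diff_commute)
  qed
  have "(\<Sum>n=N..<M. real (Suc n) powr (-1 - x)) \<le> (\<Sum>n=N..<M. (real n powr -x - real (Suc n) powr -x) / x)"
    using N by (intro sum_mono step) auto
  also have "\<dots> = (\<Sum>n=N..<M. real n powr -x - real (Suc n) powr -x) / x"
    by (simp add: sum_divide_distrib)
  also have "(\<Sum>n=N..<M. real n powr -x - real (Suc n) powr -x) = real N powr -x - real M powr -x"
    using sum_Suc_diff'[OF N(2), of "\<lambda>n. - (real n powr -x)"] by simp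
  finally show ?thesis .
qed

text \<open>The comparison with differences of \<open>real n powr x / x\<close> uses the interval to
  the right of a term when the summand increases (x >= 1) and the one to the left when it decreases.
  In the increasing case the last term has no interval left and is paid for by
  \<open>real N powr (x - 1)\<close>.\<close>

lemma powr_initial_sum_le:
  fixes x :: real
  assumes x: "x > 0" and N: "N \<ge> 1"
  shows "(\<Sum>n<N. real (Suc n) powr (x - 1)) \<le> real N powr (x - 1) + real N powr x / x"
proof (cases "x \<ge> 1")
  case True
  have step: "real (Suc n) powr (x - 1) \<le> (real (Suc (Suc n)) powr x - real (Suc n) powr x) / x" for n
  proof -
    obtain w where w: "real (Suc n) < w" "w < real (Suc (Suc n))"
      "real (Suc (Suc n)) powr x - real (Suc n) powr x
        = (real (Suc (Suc n)) - real (Suc n)) * (x * w powr (x - 1))"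
      using powr_mean_value[of "real (Suc n)" "real (Suc (Suc n))" "x"] by auto
    have "real (Suc n) powr (x - 1) \<le> w powr (x - 1)"
      using w True by (intro powr_mono2) auto
    then show ?thesis using w(3) x by (simp add: field_simps)
  qed
  obtain K where K: "N = Suc K" using N by (cases N) auto
  have "(\<Sum>n<K. real (Suc n) powr (x - 1)) \<le> (\<Sum>n<K. (real (Suc (Suc n)) powr x - real (Suc n) powr x) / x)"
    by (intro sum_mono step)
  also have "\<dots> = (real (Suc K) powr x - 1) / x"
    using sum_lessThan_telescope[of "\<lambda>n. real (Suc n) powr x" K]
    by (simp add: sum_divide_distrib[symmetric])
  also have "\<dots> \<le> real N powr x / x" using x K by (intro divide_right_mono) auto
  finally show ?thesis using K by simp
next
  case False
  have step: "real (Suc n) powr (x - 1) \<le> (real (Suc n) powr x - real n powr x) / x" for n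
  proof (cases "n = 0")
    case True then show ?thesis using x False by simp
  next
    case n: False
    obtain w where w: "real n < w" "w < real (Suc n)"
      "real (Suc n) powr x - real n powr x = (real (Suc n) - real n) * (x * w powr (x - 1))"
      using powr_mean_value[of "real n" "real (Suc n)" "x"] n by auto
    have "real (Suc n) powr (x - 1) \<le> w powr (x - 1)"
      using w False n by (intro powr_mono2') auto
    then show ?thesis using w(3) x by (simp add: field_simps)
  qed
  have "(\<Sum>n<N. real (Suc n) powr (x - 1)) \<le> (\<Sum>n<N. (real (Suc n) powr x - real n powr x) / x)"
    by (intro sum_mono step)
  also have "\<dots> = real N powr x / x"
    using sum_lessThan_telescope[of "\<lambda>n. real n powr x" N] by (simp add: sum_divide_distrib[symmetric])
  finally show ?thesis by (smt (verit) powr_ge_zero)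
qed

lemma norm_of_nat_powr: "n > 0 \<Longrightarrow> norm (of_nat n powr s :: complex) = real n powr Re s"
  by (simp add: norm_powr_real powr_def mult.commute)

text \<open>From z * cnj z = R^2. Dividing by z leaves a multiple of \<open>Re z\<close>, which
  cancels the 1 / |Re z| in the bounds for tail and initial sums near the imaginary axis.\<close>

lemma newman_kernel:
  fixes z :: complex
  assumes "norm z = R" "R > 0"
  shows "1 + z^2 / R^2 = z * (2 * Re z) / of_real (R^2)"
proof -
  have "z * (2 * Re z) = z * (z + cnj z)" by (simp add: complex_add_cnj)
  also have "\<dots> = z^2 + of_real (R^2)"
    using complex_norm_square[of z] assms by (simp add: algebra_simps power2_eq_square)
  finally show ?thesis using assms by (simp add: field_simps)
qed

text \<open>The weight is Newman's \<open>of_nat N powr z * (1 + z^2 / R^2)\<close>, equal to 1 at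
  0. Its power of N cancels the decay of the tail on the right arc and the growth of the partial sum
  on the left arc, so each arc contributes 2 * pi / R. The term 2 * pi / N comes from the extra
  summand in \<open>powr_initial_sum_le\<close>, and the last two terms come from the horizontal
  sides and the vertical side.\<close>

lemma newman_estimate:
  fixes a :: "nat \<Rightarrow> complex"
  assumes a: "\<And>n. norm (a n) \<le> 1"
    and sums: "\<And>z. Re z > 0 \<Longrightarrow> (\<lambda>n. a (Suc n) * of_nat (Suc n) powr (-1 - z)) sums f z"
    and R: "0 < R" "R < R'" and d: "0 < d" "d < d'" "d \<le> R"
    and f: "f holomorphic_on {z. -d' < Re z \<and> \<bar>Im z\<bar> < R'}"
    and M: "M \<ge> 0" "\<And>z. -d \<le> Re z \<Longrightarrow> Re z \<le> 0 \<Longrightarrow> \<bar>Im z\<bar> \<le> R \<Longrightarrow> norm (f z) \<le> M"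
    and N: "N \<ge> 1"
  shows "2 * pi * norm (f 0 - (\<Sum>n<N. a (Suc n) / of_nat (Suc n)))
    \<le> 4 * pi / R + 2 * pi / N + 10 * d * M / R + 10 * R * M * real N powr -d / d"
proof -
  define S where "S = (\<lambda>z. \<Sum>n<N. a (Suc n) * of_nat (Suc n) powr (-1 - z))"
  define E where "E = (\<lambda>z::complex. of_nat N powr z * (1 + z^2 / R^2))"
  have En: "norm (E z / z) = real N powr Re z * (2 * \<bar>Re z\<bar> / R^2)" if "norm z = R" for z
  proof -
    have z0: "z \<noteq> 0" using that R by auto
    have "E z / z = of_nat N powr z * (2 * Re z) / of_real (R^2)"
      unfolding E_def newman_kernel[OF that R(1)] using z0 by simp
    then show ?thesis using N norm_of_nat_powr[of N z] by (simp add: norm_mult norm_divide norm_power)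
  qed
  have B1: "norm ((f z - S z) * E z / z) \<le> 2 / R^2" if z: "norm z = R" "Re z > 0" for z
  proof -
    define x where "x = Re z"
    have lim: "(\<lambda>M. (\<Sum>n<M. a (Suc n) * of_nat (Suc n) powr (-1 - z)) - S z) \<longlonglongrightarrow> f z - S z"
      using sums[OF z(2)] unfolding sums_def by (intro tendsto_intros)
    have "norm (f z - S z) \<le> real N powr -x / x"
    proof (rule Lim_bounded[OF tendsto_norm[OF lim], of N], intro allI impI)
      fix M assume M: "M \<ge> N"
      have "(\<Sum>n<M. a (Suc n) * of_nat (Suc n) powr (-1 - z)) - S z
          = (\<Sum>n=N..<M. a (Suc n) * of_nat (Suc n) powr (-1 - z))"
        unfolding S_def using sum_diff_nat_ivl[of 0 N M "\<lambda>n. a (Suc n) * of_nat (Suc n) powr (-1 - z)"] M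
        by (simp add: atLeast0LessThan)
      also have "norm \<dots> \<le> (\<Sum>n=N..<M. real (Suc n) powr (-1 - x))"
      proof (rule sum_norm_le)
        fix n
        have "norm (a (Suc n) * of_nat (Suc n) powr (-1 - z)) = norm (a (Suc n)) * real (Suc n) powr (-1 - x)"
          unfolding norm_mult norm_of_nat_powr[OF zero_less_Suc] by (simp add: x_def)
        also have "\<dots> \<le> 1 * real (Suc n) powr (-1 - x)" by (intro mult_right_mono a) auto
        finally show "norm (a (Suc n) * of_nat (Suc n) powr (-1 - z)) \<le> real (Suc n) powr (-1 - x)" by simp
      qed
      also have "\<dots> \<le> (real N powr -x - real M powr -x) / x"
        using z M N by (intro powr_tail_sum_le) (auto simp: x_def)
      also have "\<dots> \<le> real N powr -x / x" using z by (intro divide_right_mono) (auto simp: x_def)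
      finally show "norm ((\<Sum>n<M. a (Suc n) * of_nat (Suc n) powr (-1 - z)) - S z) \<le> real N powr -x / x" .
    qed
    then have "norm ((f z - S z) * (E z / z)) \<le> (real N powr -x / x) * (real N powr x * (2 * x / R^2))"
      unfolding norm_mult[of "f z - S z"] En[OF z(1)] using z by (intro mult_mono) (auto simp: x_def)
    also have "\<dots> = (real N powr -x * real N powr x) * (2 / R^2)" using z by (simp add: x_def)
    also have "real N powr -x * real N powr x = 1" using N by (simp flip: powr_add)
    finally show ?thesis by simp
  qed
  have B2: "norm (S z * E z / z) \<le> 2 / (N * R) + 2 / R^2" if z: "norm z = R" "Re z < 0" for z
  proof -
    define x where "x = - Re z"
    have x: "0 < x" "x \<le> R" using z abs_Re_le_cmod[of z] by (auto simp: x_def)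
    have rx: "\<bar>Re z\<bar> = x" "Re z = -x" using z by (auto simp: x_def)
    have "norm (S z) \<le> (\<Sum>n<N. real (Suc n) powr (x - 1))"
      unfolding S_def
    proof (rule sum_norm_le)
      fix n
      have "norm (a (Suc n) * of_nat (Suc n) powr (-1 - z)) = norm (a (Suc n)) * real (Suc n) powr (x - 1)"
        unfolding norm_mult norm_of_nat_powr[OF zero_less_Suc] by (simp add: rx(2))
      also have "\<dots> \<le> 1 * real (Suc n) powr (x - 1)" by (intro mult_right_mono a) auto
      finally show "norm (a (Suc n) * of_nat (Suc n) powr (-1 - z)) \<le> real (Suc n) powr (x - 1)" by simp
    qed
    also have "\<dots> \<le> real N powr (x - 1) + real N powr x / x" by (rule powr_initial_sum_le[OF x(1) N])
    also have "\<dots> = real N powr x * (1 / N + 1 / x)" using N by (simp add: powr_diff field_simps)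
    finally have "norm (S z * (E z / z)) \<le> (real N powr x * (1 / N + 1 / x)) * (real N powr -x * (2 * x / R^2))"
      unfolding norm_mult[of "S z"] En[OF z(1)] rx using x N by (intro mult_mono) auto
    also have "\<dots> = (real N powr x * real N powr -x) * (2 * x / (N * R^2) + 2 / R^2)"
      using x by (simp add: field_simps)
    also have "real N powr x * real N powr -x = 1" using N by (simp flip: powr_add)
    also have "2 * x / (N * R^2) \<le> 2 * R / (N * R^2)" using x N by (intro divide_right_mono) auto
    also have "2 * R / (N * R^2) = 2 / (N * R)" using R by (simp add: power2_eq_square)
    finally show ?thesis by simp
  qed
  \<comment> \<open>Since d <= R, every point of the box has norm at most 2R, and 5 = 1 +
    2^2.\<close>
  have En': "norm (E z) \<le> real N powr Re z * 5" if "-d \<le> Re z" "Re z \<le> 0" "\<bar>Im z\<bar> \<le> R" for z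
  proof -
    have "norm z \<le> \<bar>Re z\<bar> + \<bar>Im z\<bar>" by (rule cmod_le)
    also have "\<dots> \<le> 2 * R" using that d by auto
    finally have "norm z ^ 2 \<le> (2 * R) ^ 2" by (intro power_mono) auto
    then have "norm z ^ 2 / R^2 \<le> 4" using R by (simp add: field_simps)
    then have "norm (1 + z^2 / R^2) \<le> 5"
      using norm_triangle_ineq[of 1 "z^2 / R^2"] by (simp add: norm_divide norm_power)
    then show ?thesis unfolding E_def norm_mult using N norm_of_nat_powr[of N z]
      by (simp add: mult_left_mono)
  qed
  have B3: "norm (f z * E z / z) \<le> 5 * M / R" if z: "-d \<le> Re z" "Re z \<le> 0" "\<bar>Im z\<bar> = R" for z
  proof -
    have "real N powr Re z \<le> real N powr 0" using z N by (intro powr_mono) auto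
    then have "norm (E z) \<le> 5" using En'[of z] z N by simp
    moreover have "norm z \<ge> R" using z abs_Im_le_cmod[of z] by simp
    ultimately have "norm (f z) * norm (E z) / norm z \<le> M * 5 / R"
      using M z R by (intro frac_le mult_mono) auto
    then show ?thesis by (simp add: norm_mult norm_divide mult.commute)
  qed
  have B4: "norm (f z * E z / z) \<le> 5 * M * real N powr -d / d" if z: "Re z = -d" "\<bar>Im z\<bar> \<le> R" for z
  proof -
    have "norm z \<ge> d" using z abs_Re_le_cmod[of z] d by simp
    then have "norm (f z) * norm (E z) / norm z \<le> M * (real N powr -d * 5) / d"
      using M z R d En'[of z] by (intro frac_le mult_mono) auto
    then show ?thesis by (simp add: norm_mult norm_divide mult_ac)
  qed
  have hS: "S holomorphic_on UNIV" unfolding S_def by (intro holomorphic_intros)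
  have hE: "E holomorphic_on UNIV" unfolding E_def using R by (intro holomorphic_intros) auto
  have E0: "E 0 = 1" using N by (simp add: E_def)
  have "2 * pi * norm (f 0 - S 0) \<le> pi * R * (2 / R^2) + pi * R * (2 / (N * R) + 2 / R^2)
      + 2 * d * (5 * M / R) + 2 * R * (5 * M * real N powr -d / d)"
    by (rule newman_contour_bound[OF R d(1,2) f hS hE E0 _ _ _ _ B1 B2 B3 B4]) (use M R d in auto)
  also have "\<dots> = 4 * pi / R + 2 * pi / N + 10 * d * M / R + 10 * R * M * real N powr -d / d"
    using R N by (simp add: power2_eq_square field_simps)
  finally have *: "2 * pi * norm (f 0 - S 0) \<le> \<dots>" .
  have "S 0 = (\<Sum>n<N. a (Suc n) / of_nat (Suc n))"
    unfolding S_def by (intro sum.cong refl) (simp add: powr_minus field_simps)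
  then show ?thesis using * by simp
qed

text \<open>The parameters are chosen in the order R (arcs), M (bound for f), d (horizontal sides),
  N (everything else), each allowed to depend on its predecessors.\<close>

theorem newman_tauberian:
  fixes a :: "nat \<Rightarrow> complex"
  assumes a: "\<And>n. norm (a n) \<le> 1"
    and sums: "\<And>z. Re z > 0 \<Longrightarrow> (\<lambda>n. a (Suc n) * of_nat (Suc n) powr (-1 - z)) sums f z"
    and U: "open U" "{z. Re z \<ge> 0} \<subseteq> U" and f: "f holomorphic_on U"
  shows "(\<lambda>n. a (Suc n) / of_nat (Suc n)) sums f 0"
  unfolding sums_def
proof (rule LIMSEQ_I)
  fix \<epsilon> :: real assume e: "\<epsilon> > 0"
  define R where "R = max 1 (8 * pi / \<epsilon>)"
  have R: "R \<ge> 1" "4 * pi / R \<le> \<epsilon> / 2"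
  proof -
    show "R \<ge> 1" by (simp add: R_def)
    have "8 * pi / \<epsilon> \<le> R" by (simp add: R_def)
    then show "4 * pi / R \<le> \<epsilon> / 2" using e \<open>R \<ge> 1\<close> by (simp add: field_simps)
  qed
  \<comment> \<open>A segment of the imaginary axis longer than the contour. By compactness a strip
    of some width d' to its left lies in U, and R + 1 serves as R'.\<close>
  define C where "C = cbox (Complex 0 (-(R+1))) (Complex 0 (R+1))"
  have "compact C" "C \<subseteq> U" using U(2) by (auto simp: C_def in_cbox_complex_iff)
  then obtain d' where d': "d' > 0" "(\<Union>x\<in>C. ball x d') \<subseteq> U"
    using compact_subset_open_imp_ball_epsilon_subset[of C U] U(1) by auto
  have sub: "{z. -d' < Re z \<and> \<bar>Im z\<bar> < R + 1} \<subseteq> U"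
  proof safe
    fix z assume z: "-d' < Re z" "\<bar>Im z\<bar> < R + 1"
    show "z \<in> U"
    proof (cases "Re z \<ge> 0")
      case True then show ?thesis using U by auto
    next
      case False
      have "Complex 0 (Im z) \<in> C" using z by (auto simp: C_def in_cbox_complex_iff)
      moreover have "z \<in> ball (Complex 0 (Im z)) d'"
        using z False by (simp add: dist_complex_def cmod_def)
      ultimately show ?thesis using d' by blast
    qed
  qed
  \<comment> \<open>The bound M is fixed on this wider box before d is chosen, so that shrinking d
    makes d * M small.\<close>
  define K where "K = cbox (Complex (-d'/2) (-R)) (Complex 0 R)"
  have KU: "K \<subseteq> U" using sub d'(1) R by (force simp: K_def in_cbox_complex_iff)
  have "compact (f ` K)"
    using f KU by (intro compact_continuous_image) (auto simp: K_def intro: holomorphic_on_imp_continuous_on holomorphic_on_subset)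
  then obtain M where M: "M > 0" "\<And>z. z \<in> K \<Longrightarrow> norm (f z) \<le> M"
    by (force dest!: compact_imp_bounded simp: bounded_pos)
  define d where "d = min (d'/2) (min R (\<epsilon> / (20 * M)))"
  have d: "d > 0" "d < d'" "d \<le> R" "d \<le> d'/2" "10 * d * M / R \<le> \<epsilon> / 2"
  proof -
    show d0: "d > 0" "d < d'" "d \<le> R" "d \<le> d'/2" using d' R M e by (auto simp: d_def)
    have "d \<le> \<epsilon> / (20 * M)" by (simp add: d_def)
    then have "10 * d * M \<le> \<epsilon> / 2" using M by (simp add: field_simps)
    moreover have "10 * d * M / R \<le> 10 * d * M / 1" using d0 M R by (intro divide_left_mono) auto
    ultimately show "10 * d * M / R \<le> \<epsilon> / 2" by simp
  qed
  have "(\<lambda>N. 2 * pi / real N + 10 * R * M * real N powr -d / d) \<longlonglongrightarrow> 0 + 10 * R * M * 0 / d"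
    using d(1) by (intro tendsto_intros real_tendsto_divide_at_top[OF tendsto_const]
        filterlim_real_sequentially tendsto_neg_powr filterlim_compose[OF _ filterlim_real_sequentially]) auto
  then have "\<forall>\<^sub>F N in sequentially. 2 * pi / real N + 10 * R * M * real N powr -d / d < \<epsilon>"
    using e by (intro order_tendstoD) auto
  then have "\<forall>\<^sub>F N in sequentially. N \<ge> 1 \<and> 2 * pi / real N + 10 * R * M * real N powr -d / d < \<epsilon>"
    using eventually_ge_at_top[of 1] by eventually_elim auto
  then obtain N0 where N0: "\<And>N. N \<ge> N0 \<Longrightarrow> N \<ge> 1 \<and> 2 * pi / real N + 10 * R * M * real N powr -d / d < \<epsilon>"
    by (auto simp: eventually_sequentially)
  show "\<exists>no. \<forall>n\<ge>no. norm ((\<Sum>i<n. a (Suc i) / of_nat (Suc i)) - f 0) < \<epsilon>"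
  proof (intro exI[of _ N0] allI impI)
    fix N assume N: "N \<ge> N0"
    have Mb: "norm (f z) \<le> M" if "-d \<le> Re z" "Re z \<le> 0" "\<bar>Im z\<bar> \<le> R" for z
      using that d by (intro M) (auto simp: K_def in_cbox_complex_iff)
    have "2 * pi * norm (f 0 - (\<Sum>n<N. a (Suc n) / of_nat (Suc n)))
        \<le> 4 * pi / R + 2 * pi / N + 10 * d * M / R + 10 * R * M * real N powr -d / d"
      by (rule newman_estimate[OF a sums _ _ d(1-3) holomorphic_on_subset[OF f sub] _ Mb])
        (use R M N N0[of N] in auto)
    also have "\<dots> < 2 * \<epsilon>" using R(2) d(5) N0[OF N] by linarith
    finally have 1: "pi * norm (f 0 - (\<Sum>n<N. a (Suc n) / of_nat (Suc n))) < \<epsilon>" by simp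
    have "1 * norm (f 0 - (\<Sum>n<N. a (Suc n) / of_nat (Suc n))) \<le> pi * norm (f 0 - (\<Sum>n<N. a (Suc n) / of_nat (Suc n)))"
      using pi_gt3 by (intro mult_right_mono) auto
    then show "norm ((\<Sum>i<N. a (Suc i) / of_nat (Suc i)) - f 0) < \<epsilon>"
      using 1 by (simp add: norm_minus_commute)
  qed
qed

section \<open>Dirichlet series\<close>

text \<open>Dirichlet convolution. Every number divides 0, so at \<open>n = 0\<close> the index set
  is infinite and the sum takes the default value 0.\<close>

definition dconv :: "(nat \<Rightarrow> 'a::comm_ring_1) \<Rightarrow> (nat \<Rightarrow> 'a) \<Rightarrow> nat \<Rightarrow> 'a" where
  "dconv f g n = (\<Sum>d | d dvd n. f d * g (n div d))"

text \<open>Reindexing by (a, b) -> (a * b, a). On positive numbers every fibre is a finite set of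
  divisors.\<close>

lemma has_sum_regroup_divisors:
  fixes f :: "nat \<Rightarrow> nat \<Rightarrow> 'a::{topological_comm_monoid_add,t3_space}"
  assumes "((\<lambda>(a,b). f a b) has_sum S) ({0<..} \<times> {0<..})"
  shows "((\<lambda>n. \<Sum>d | d dvd n. f d (n div d)) has_sum S) {0<..}"
proof -
  have "((\<lambda>(n,d). f d (n div d)) has_sum S) (Sigma {0<..} (\<lambda>n. {d. d dvd n}))
      \<longleftrightarrow> ((\<lambda>(a,b). f a b) has_sum S) ({0<..} \<times> {0<..})"
    by (rule has_sum_reindex_bij_witness[of _ "\<lambda>(a,b). (a * b, a)" "\<lambda>(n,d). (d, n div d)"])
      (auto elim!: dvdE)
  with assms have "((\<lambda>(n,d). f d (n div d)) has_sum S) (Sigma {0<..} (\<lambda>n. {d. d dvd n}))"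
    by blast
  then show ?thesis
    by (rule has_sum_SigmaD) (auto intro!: has_sum_finiteI)
qed

lemma sums_divisor_pairs:
  fixes u v :: "nat \<Rightarrow> complex"
  assumes u: "summable (\<lambda>n. norm (u n))" "u 0 = 0" and v: "summable (\<lambda>n. norm (v n))" "v 0 = 0"
  shows "(\<lambda>n. \<Sum>d | d dvd n. u d * v (n div d)) sums ((\<Sum>n. u n) * (\<Sum>n. v n))"
proof -
  let ?P = "{0<..} :: nat set"
  have hs: "(f has_sum suminf f) ?P" "(\<lambda>n. norm (f n)) summable_on ?P"
    if "summable (\<lambda>n. norm (f n))" "f 0 = 0" for f :: "nat \<Rightarrow> complex"
  proof -
    have "(f has_sum suminf f) UNIV"
      using norm_summable_imp_has_sum[OF that(1)] summable_norm_cancel[OF that(1)] by (simp add: summable_sums)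
    also have "(f has_sum suminf f) UNIV \<longleftrightarrow> (f has_sum suminf f) ?P"
      by (intro has_sum_cong_neutral) (use that in auto)
    finally show "(f has_sum suminf f) ?P" .
    have "(\<lambda>n. norm (f n)) summable_on UNIV" using norm_summable_imp_summable_on[of "\<lambda>n. norm (f n)"] that by simp
    then show "(\<lambda>n. norm (f n)) summable_on ?P" using summable_on_subset_banach by blast
  qed
  note U = hs[OF u] and V = hs[OF v]
  have sm: "(\<lambda>(a,b). u a * v b) summable_on ?P \<times> ?P"
  proof (rule abs_summable_summable)
    have "(\<lambda>p. norm ((\<lambda>(a,b). u a * v b) p)) = (\<lambda>(a,b). norm (u a) * norm (v b))"
      by (auto simp: norm_mult)
    moreover have "(\<lambda>(a,b). norm (u a) * norm (v b)) summable_on ?P \<times> ?P"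
    proof (rule summable_on_SigmaI)
      show "((\<lambda>b. case (a, b) of (a, b) \<Rightarrow> norm (u a) * norm (v b)) has_sum (norm (u a) * infsum (\<lambda>n. norm (v n)) ?P)) ?P" for a
        using has_sum_cmult_right[OF has_sum_infsum[OF V(2)], of "norm (u a)"] by simp
      show "(\<lambda>a. norm (u a) * infsum (\<lambda>n. norm (v n)) ?P) summable_on ?P"
        using U(2) by (intro summable_on_cmult_left)
    qed auto
    ultimately show "(\<lambda>p. norm ((\<lambda>(a,b). u a * v b) p)) summable_on ?P \<times> ?P" by simp
  qed
  have "((\<lambda>(a,b). u a * v b) has_sum (suminf u * suminf v)) (?P \<times> ?P)"
  proof (rule has_sum_SigmaI[OF _ _ sm])
    show "((\<lambda>b. case (a, b) of (a, b) \<Rightarrow> u a * v b) has_sum (u a * suminf v)) ?P" for a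
      using has_sum_cmult_right[OF V(1), of "u a"] by simp
    show "((\<lambda>a. u a * suminf v) has_sum (suminf u * suminf v)) ?P"
      by (rule has_sum_cmult_left[OF U(1)])
  qed
  then have "((\<lambda>n. \<Sum>d | d dvd n. u d * v (n div d)) has_sum (suminf u * suminf v)) ?P"
    by (rule has_sum_regroup_divisors)
  also have "?this \<longleftrightarrow> ((\<lambda>n. \<Sum>d | d dvd n. u d * v (n div d)) has_sum (suminf u * suminf v)) UNIV"
    by (intro has_sum_cong_neutral) auto
  finally show ?thesis by (rule has_sum_imp_sums)
qed

lemma dirichlet_product_sums:
  fixes a b :: "nat \<Rightarrow> complex"
  assumes "summable (\<lambda>n. norm (a n * of_nat n powr -s))" "summable (\<lambda>n. norm (b n * of_nat n powr -s))"
  shows "(\<lambda>n. dconv a b n * of_nat n powr -s) sums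
           ((\<Sum>n. a n * of_nat n powr -s) * (\<Sum>n. b n * of_nat n powr -s))"
proof -
  have "(\<Sum>d | d dvd n. (a d * of_nat d powr -s) * (b (n div d) * of_nat (n div d) powr -s))
      = dconv a b n * of_nat n powr -s" for n
  proof (cases "n = 0")
    case True then show ?thesis by (simp add: dconv_def)
  next
    case False
    have "(a d * of_nat d powr -s) * (b (n div d) * of_nat (n div d) powr -s)
        = a d * b (n div d) * of_nat n powr -s" if "d dvd n" for d
    proof -
      have "of_nat n powr -s = (of_nat d * of_nat (n div d) :: complex) powr -s"
        using that by (metis dvd_mult_div_cancel of_nat_mult)
      also have "\<dots> = of_nat d powr -s * of_nat (n div d) powr -s"
        by (rule powr_times_real) auto
      finally show ?thesis by simp
    qed
    then show ?thesis unfolding dconv_def sum_distrib_right by (intro sum.cong) auto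
  qed
  then show ?thesis using sums_divisor_pairs[OF assms(1) _ assms(2)] by simp
qed

text \<open>The derivative of \<open>z powr -s\<close> is bounded along the segment. The gain of one
  power of x over the trivial bound carries Dirichlet series from Re s > 1 to Re s > 0.\<close>

lemma norm_powr_diff_le:
  fixes s :: complex and x y :: real
  assumes "0 < x" "x \<le> y" "y \<le> x + 1" "Re s > -1"
  shows "norm (of_real x powr -s - of_real y powr -s) \<le> norm s * x powr (-Re s - 1)"
proof -
  define S where "S = closed_segment (complex_of_real x) (of_real y)"
  have S: "\<exists>t. z = of_real t \<and> x \<le> t \<and> t \<le> y" if "z \<in> S" for z
    using that assms(2) unfolding S_def closed_segment_of_real by (auto simp: closed_segment_eq_real_ivl)
  have "norm (of_real x powr -s - of_real y powr -s) \<le> (norm s * x powr (-Re s - 1)) * norm (complex_of_real x - of_real y)"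
  proof (rule field_differentiable_bound[where S = S and f = "\<lambda>z. z powr -s"])
    show "convex S" by (simp add: S_def)
    fix z assume "z \<in> S"
    then obtain t where t: "z = of_real t" "x \<le> t" "t \<le> y" using S by blast
    show "((\<lambda>z. z powr -s) has_field_derivative (-s * z powr (-s - 1))) (at z within S)"
      using t assms by (auto intro!: derivative_eq_intros simp: complex_nonpos_Reals_iff)
    have "norm (z powr (-s - 1)) = t powr (-Re s - 1)"
      using t assms by (simp add: norm_powr_real powr_def)
    also have "\<dots> \<le> x powr (-Re s - 1)" using t assms by (intro powr_mono2') auto
    finally show "norm (-s * z powr (-s - 1)) \<le> norm s * x powr (-Re s - 1)"
      by (simp add: norm_mult mult_left_mono)
  qed (auto simp: S_def)
  also have "norm (complex_of_real x - of_real y) \<le> 1"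
    using assms by (simp flip: of_real_diff)
  finally show ?thesis by (simp add: mult_left_mono)
qed

text \<open>A majorant is required only for bounded s at positive distance from the boundary line,
  because the majorants in use grow with |s| and degenerate at the line. Around each point a small
  ball meets these conditions.\<close>

lemma holomorphic_series:
  fixes f :: "nat \<Rightarrow> complex \<Rightarrow> complex"
  assumes f: "\<And>n. f n holomorphic_on {s. Re s > c}"
    and dom: "\<And>r \<delta>. \<delta> > 0 \<Longrightarrow> \<exists>h. summable h \<and> (\<forall>n s. norm s \<le> r \<longrightarrow> Re s \<ge> c + \<delta> \<longrightarrow> norm (f n s) \<le> h n)"
  shows "\<exists>g. g holomorphic_on {s. Re s > c} \<and>
     (\<forall>s. Re s > c \<longrightarrow> (\<lambda>n. f n s) sums g s \<and> (\<lambda>n. deriv (f n) s) sums deriv g s)"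
proof -
  let ?S = "{s. Re s > c}"
  have opn: "open ?S" by (rule open_halfspace_Re_gt)
  have "\<exists>g g'. \<forall>x\<in>?S. ((\<lambda>n. f n x) sums g x) \<and> ((\<lambda>n. deriv (f n) x) sums g' x) \<and> (g has_field_derivative g' x) (at x)"
  proof (rule series_and_derivative_comparison_complex[OF opn])
    show "(f n has_field_derivative deriv (f n) x) (at x)" if "x \<in> ?S" for n x
      by (rule holomorphic_derivI[OF f opn that])
    fix x assume x: "x \<in> ?S"
    define d where "d = (Re x - c) / 2"
    have d: "d > 0" using x by (simp add: d_def)
    obtain h where h: "summable h" "\<And>n s. norm s \<le> norm x + d \<Longrightarrow> Re s \<ge> c + d \<Longrightarrow> norm (f n s) \<le> h n"
      using dom[OF d, of "norm x + d"] by blast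
    have hn: "norm (f n y) \<le> h n" if "y \<in> ball x d" for n y
    proof (rule h(2))
      have *: "norm (y - x) < d" using that by (simp add: dist_norm norm_minus_commute)
      then show "norm y \<le> norm x + d" using norm_triangle_sub[of y x] by linarith
      have "\<bar>Re y - Re x\<bar> < d" using * abs_Re_le_cmod[of "y - x"] by simp
      then have "Re y > Re x - d" by linarith
      moreover have "Re x = c + 2 * d" unfolding d_def by (simp add: field_simps)
      ultimately show "Re y \<ge> c + d" by linarith
    qed
    have h0: "h n \<ge> 0" for n using hn[of x n] d norm_ge_zero order_trans by (metis centre_in_ball)
    show "\<exists>d h. 0 < d \<and> summable h \<and> range h \<subseteq> \<real>\<^sub>\<ge>\<^sub>0 \<and>
       (\<forall>\<^sub>F n in sequentially. \<forall>y\<in>ball x d \<inter> ?S. cmod (f n y) \<le> cmod (h n))"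
      using d h(1) h0 hn by (intro exI[of _ d] exI[of _ "\<lambda>n. complex_of_real (h n)"])
        (auto simp: summable_of_real intro!: always_eventually)
  qed
  then obtain g g' where g: "\<And>x. x \<in> ?S \<Longrightarrow> ((\<lambda>n. f n x) sums g x) \<and> ((\<lambda>n. deriv (f n) x) sums g' x) \<and> (g has_field_derivative g' x) (at x)"
    by blast
  have "g holomorphic_on ?S" using g opn by (auto simp: holomorphic_on_open)
  then show ?thesis using g DERIV_imp_deriv by (intro exI[of _ g]) force
qed

lemma summable_nat_powr: "\<sigma> > 1 \<Longrightarrow> summable (\<lambda>n. real n powr -\<sigma>)"
  by (simp add: summable_real_powr_iff)

lemma summable_nat_powr': "\<delta> > 0 \<Longrightarrow> summable (\<lambda>n. real n powr (-1 - \<delta>))"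
  by (simp add: summable_real_powr_iff)

lemma powr_le_powr_neg:
  assumes "\<sigma> \<le> (\<tau>::real)"
  shows "real n powr -\<tau> \<le> real n powr -\<sigma>"
proof (cases "n = 0")
  case False then show ?thesis using assms by (intro powr_mono) auto
qed auto

lemma holomorphic_powr_term: "(\<lambda>s. c * of_nat n powr -s) holomorphic_on A"
proof (cases "n = 0")
  case False then show ?thesis by (intro holomorphic_intros) auto
qed auto

lemma dirichlet_series_bounded:
  fixes a :: "nat \<Rightarrow> complex"
  assumes "\<And>n. norm (a n) \<le> K" "Re s > 1"
  shows "summable (\<lambda>n. norm (a n * of_nat n powr -s))"
proof (rule summable_comparison_test')
  show "summable (\<lambda>n. K * real n powr -Re s)" using assms by (intro summable_mult summable_nat_powr) auto
  show "norm (norm (a n * of_nat n powr -s)) \<le> K * real n powr -Re s" for n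
    using assms(1)[of n] by (cases "n = 0") (auto simp: norm_mult norm_of_nat_powr mult_right_mono)
qed

lemma dirichlet_series_holomorphic:
  fixes a :: "nat \<Rightarrow> complex"
  assumes a: "\<And>n. norm (a n) \<le> 1"
  shows "\<exists>g. g holomorphic_on {s. Re s > 1} \<and>
     (\<forall>s. Re s > 1 \<longrightarrow> (\<lambda>n. a n * of_nat n powr -s) sums g s \<and>
        (\<lambda>n. - a n * ln (of_nat n) * of_nat n powr -s) sums deriv g s)"
proof -
  have d: "deriv (\<lambda>s. a n * of_nat n powr -s) s = - a n * ln (of_nat n) * of_nat n powr -s" for n s
  proof (cases "n = 0")
    case False
    then have "((\<lambda>s. a n * exp (-s * ln (of_nat n))) has_field_derivative
        - a n * ln (of_nat n) * exp (-s * ln (of_nat n))) (at s)"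
      by (auto intro!: derivative_eq_intros)
    then show ?thesis using False by (intro DERIV_imp_deriv) (simp add: powr_def)
  qed auto
  have "\<exists>g. g holomorphic_on {s. Re s > 1} \<and>
     (\<forall>s. Re s > 1 \<longrightarrow> (\<lambda>n. a n * of_nat n powr -s) sums g s \<and> (\<lambda>n. deriv (\<lambda>s. a n * of_nat n powr -s) s) sums deriv g s)"
  proof (rule holomorphic_series[OF holomorphic_powr_term])
    fix r \<delta> :: real assume "\<delta> > 0"
    have "norm (a n * of_nat n powr -s) \<le> real n powr -(1 + \<delta>)" if "Re s \<ge> 1 + \<delta>" for n s
    proof (cases "n = 0")
      case False
      have "norm (a n * of_nat n powr -s) \<le> 1 * real n powr -Re s"
        using False a[of n] by (simp add: norm_mult norm_of_nat_powr mult_right_mono)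
      then show ?thesis using powr_le_powr_neg[OF that, of n] by linarith
    qed auto
    then show "\<exists>h. summable h \<and> (\<forall>n s. norm s \<le> r \<longrightarrow> Re s \<ge> 1 + \<delta> \<longrightarrow> norm (a n * of_nat n powr -s) \<le> h n)"
      using \<open>\<delta> > 0\<close> by (intro exI[of _ "\<lambda>n. real n powr -(1 + \<delta>)"]) (auto intro: summable_nat_powr')
  qed
  then show ?thesis unfolding d .
qed

lemma abel_partial_sums:
  fixes a u :: "nat \<Rightarrow> 'a::comm_ring"
  shows "(\<Sum>n<Suc M. a n * u n) = (\<Sum>n<Suc M. (\<Sum>k\<le>n. a k) * (u n - u (Suc n))) + (\<Sum>k\<le>M. a k) * u (Suc M)"
  by (induction M) (simp_all add: algebra_simps)

lemma abel_summation:
  fixes a u :: "nat \<Rightarrow> 'a::real_normed_field"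
  assumes s: "(\<lambda>n. (\<Sum>k\<le>n. a k) * (u n - u (Suc n))) sums g"
    and lim: "(\<lambda>n. (\<Sum>k\<le>n. a k) * u (Suc n)) \<longlonglongrightarrow> 0"
  shows "(\<lambda>n. a n * u n) sums g"
proof -
  have "(\<lambda>N. (\<Sum>n<Suc N. (\<Sum>k\<le>n. a k) * (u n - u (Suc n))) + (\<Sum>k\<le>N. a k) * u (Suc N)) \<longlonglongrightarrow> g + 0"
    using LIMSEQ_Suc[OF s[unfolded sums_def]] lim by (intro tendsto_add)
  then have "(\<lambda>N. \<Sum>n<Suc N. a n * u n) \<longlonglongrightarrow> g"
    by (simp only: abel_partial_sums[of a u, symmetric] add_0_right)
  then show ?thesis unfolding sums_def by (rule LIMSEQ_imp_Suc)
qed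

text \<open>Summation by parts turns a series that may converge only conditionally into one
  dominated by K * |s| * n^(-1 - Re s). The condition \<open>a 0 = 0\<close> removes the term n = 0,
  to which \<open>norm_powr_diff_le\<close> does not apply. The summed-by-parts form is exported
  too, since the argument at s = 1 starts from it.\<close>

lemma abel_dirichlet_series:
  fixes a :: "nat \<Rightarrow> complex"
  assumes K: "\<And>n. norm (\<Sum>k\<le>n. a k) \<le> K" and a0: "a 0 = 0"
  shows "\<exists>g. g holomorphic_on {s. Re s > 0} \<and> (\<forall>s. Re s > 0 \<longrightarrow>
     (\<lambda>n. (\<Sum>k\<le>n. a k) * (of_nat n powr -s - of_nat (Suc n) powr -s)) sums g s \<and>
     (\<lambda>n. a n * of_nat n powr -s) sums g s)"
proof -
  have K0: "K \<ge> 0" using K[of 0] norm_ge_zero order_trans by blast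
  have "\<exists>g. g holomorphic_on {s. Re s > 0} \<and> (\<forall>s. Re s > 0 \<longrightarrow>
     (\<lambda>n. (\<Sum>k\<le>n. a k) * (of_nat n powr -s - of_nat (Suc n) powr -s)) sums g s \<and>
     (\<lambda>n. deriv (\<lambda>s. (\<Sum>k\<le>n. a k) * (of_nat n powr -s - of_nat (Suc n) powr -s)) s) sums deriv g s)"
  proof (rule holomorphic_series)
    fix n
    show "(\<lambda>s. (\<Sum>k\<le>n. a k) * (of_nat n powr -s - of_nat (Suc n) powr -s)) holomorphic_on {s. Re s > 0}"
      unfolding right_diff_distrib by (intro holomorphic_on_diff holomorphic_powr_term)
  next
    fix r \<delta> :: real assume \<delta>: "\<delta> > 0"
    have "norm ((\<Sum>k\<le>n. a k) * (of_nat n powr -s - of_nat (Suc n) powr -s)) \<le> K * (\<bar>r\<bar> * real n powr -(1 + \<delta>))"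
      if s: "norm s \<le> r" "Re s \<ge> 0 + \<delta>" for n s
    proof (cases "n = 0")
      case False
      have "norm (of_nat n powr -s - of_nat (Suc n) powr -s) \<le> norm s * real n powr (-Re s - 1)"
        using norm_powr_diff_le[of "real n" "real (Suc n)" s] False s \<delta> by auto
      also have "\<dots> \<le> \<bar>r\<bar> * real n powr -(1 + \<delta>)"
        using s powr_le_powr_neg[of "1 + \<delta>" "Re s + 1" n] by (intro mult_mono) auto
      finally show ?thesis using K K0 unfolding norm_mult by (intro mult_mono) auto
    qed (use a0 in auto)
    then show "\<exists>h. summable h \<and> (\<forall>n s. norm s \<le> r \<longrightarrow> Re s \<ge> 0 + \<delta> \<longrightarrow>
       norm ((\<Sum>k\<le>n. a k) * (of_nat n powr -s - of_nat (Suc n) powr -s)) \<le> h n)"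
      using \<delta> by (intro exI[of _ "\<lambda>n. K * (\<bar>r\<bar> * real n powr -(1 + \<delta>))"])
        (auto intro!: summable_mult summable_nat_powr')
  qed
  then obtain g where g: "g holomorphic_on {s. Re s > 0}"
    "\<And>s. Re s > 0 \<Longrightarrow> (\<lambda>n. (\<Sum>k\<le>n. a k) * (of_nat n powr -s - of_nat (Suc n) powr -s)) sums g s"
    by blast
  have "(\<lambda>n. a n * of_nat n powr -s) sums g s" if "Re s > 0" for s
  proof (rule abel_summation[OF g(2)[OF that]])
    have "(\<lambda>n. K * real (Suc n) powr -Re s) \<longlonglongrightarrow> K * 0"
      using that by (intro tendsto_intros tendsto_neg_powr
          filterlim_compose[OF filterlim_real_sequentially filterlim_Suc]) auto
    then have lim: "(\<lambda>n. K * real (Suc n) powr -Re s) \<longlonglongrightarrow> 0" by simp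
    have "norm ((\<Sum>k\<le>n. a k) * of_nat (Suc n) powr -s) \<le> K * real (Suc n) powr -Re s" for n
      using K[of n] unfolding norm_mult norm_of_nat_powr[OF zero_less_Suc] by (simp add: mult_right_mono)
    then show "(\<lambda>n. (\<Sum>k\<le>n. a k) * of_nat (Suc n) powr -s) \<longlonglongrightarrow> 0"
      using lim by (intro Lim_null_comparison[OF _ lim] always_eventually) blast
  qed
  then show ?thesis using g by blast
qed

text \<open>The sum 1 + H s continues (s - 1) times the zeta function. The telescoping differences
  of n^(1-s) sum to 1, and what remains of (s - 1) n^(-s) is one power of n smaller. Every remainder
  vanishes at s = 1, so H 1 = 0, that is, the residue is 1.\<close>

lemma zeta_continuation:
  "\<exists>H. H holomorphic_on {s. Re s > 0} \<and> H 1 = 0 \<and>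
     (\<forall>s. Re s > 1 \<longrightarrow> (\<lambda>n. (s - 1) * of_nat n powr -s) sums (1 + H s))"
proof -
  define f where "f = (\<lambda>n s. (s - 1) * of_nat (Suc n) powr -s
      - (of_nat (Suc n) powr (1 - s) - of_nat (Suc (Suc n)) powr (1 - s)) :: complex)"
  have bound: "norm (f n s) \<le> norm (s - 1) * (norm s * real (Suc n) powr (-Re s - 1))" if s: "Re s > 0" for n s
  proof -
    define S where "S = closed_segment (complex_of_real (real (Suc n))) (of_real (real (Suc (Suc n))))"
    have S: "\<exists>t. z = of_real t \<and> real (Suc n) \<le> t \<and> t \<le> real (Suc (Suc n))" if "z \<in> S" for z
      using that unfolding S_def closed_segment_of_real by (auto simp: closed_segment_eq_real_ivl)
    \<comment> \<open>The increment of \<open>\<phi>\<close> from n+1 to n+2 is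
      \<open>f n s\<close>, and its derivative is (s - 1) times a difference covered by
      \<open>norm_powr_diff_le\<close>.\<close>
    define \<phi> where "\<phi> = (\<lambda>z. (s - 1) * of_nat (Suc n) powr -s * z + z powr (1 - s))"
    have "norm (\<phi> (of_real (real (Suc (Suc n)))) - \<phi> (of_real (real (Suc n))))
       \<le> (norm (s - 1) * (norm s * real (Suc n) powr (-Re s - 1)))
         * norm (of_real (real (Suc (Suc n))) - complex_of_real (real (Suc n)))"
    proof (rule field_differentiable_bound[where S = S and
          f' = "\<lambda>z. (s - 1) * (of_nat (Suc n) powr -s - z powr -s)"])
      show "convex S" by (simp add: S_def)
      fix z assume "z \<in> S"
      then obtain t where t: "z = of_real t" "real (Suc n) \<le> t" "t \<le> real (Suc (Suc n))" using S by blast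
      then have t0: "t > 0" by auto
      show "(\<phi> has_field_derivative (s - 1) * (of_nat (Suc n) powr -s - z powr -s)) (at z within S)"
        unfolding \<phi>_def using t t0
        by (auto intro!: derivative_eq_intros simp: complex_nonpos_Reals_iff algebra_simps simp del: of_nat_Suc)
      have "norm (of_real (real (Suc n)) powr -s - of_real t powr -s) \<le> norm s * real (Suc n) powr (-Re s - 1)"
        using t s by (intro norm_powr_diff_le) auto
      then show "norm ((s - 1) * (of_nat (Suc n) powr -s - z powr -s)) \<le> norm (s - 1) * (norm s * real (Suc n) powr (-Re s - 1))"
        unfolding norm_mult t(1) by (intro mult_left_mono) auto
    qed (auto simp: S_def)
    moreover have "\<phi> (of_real (real (Suc (Suc n)))) - \<phi> (of_real (real (Suc n))) = f n s"
      by (simp add: \<phi>_def f_def algebra_simps)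
    moreover have "of_real (real (Suc (Suc n))) - complex_of_real (real (Suc n)) = 1" by simp
    ultimately show ?thesis by (metis mult.right_neutral norm_one)
  qed
  have "\<exists>g. g holomorphic_on {s. Re s > 0} \<and> (\<forall>s. Re s > 0 \<longrightarrow> (\<lambda>n. f n s) sums g s \<and> (\<lambda>n. deriv (f n) s) sums deriv g s)"
  proof (rule holomorphic_series)
    show "f n holomorphic_on {s. Re s > 0}" for n
      unfolding f_def by (intro holomorphic_intros) (auto simp del: of_nat_Suc)
    fix r \<delta> :: real assume \<delta>: "\<delta> > 0"
    have "norm (f n s) \<le> (\<bar>r\<bar> + 1) * (\<bar>r\<bar> * real (Suc n) powr -(1 + \<delta>))"
      if s: "norm s \<le> r" "Re s \<ge> 0 + \<delta>" for n s
    proof -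
      have "norm (s - 1) \<le> \<bar>r\<bar> + 1" using s norm_triangle_ineq4[of s 1] by simp
      moreover have "real (Suc n) powr (-Re s - 1) \<le> real (Suc n) powr -(1 + \<delta>)"
        using s powr_le_powr_neg[of "1 + \<delta>" "Re s + 1" "Suc n"] by auto
      ultimately have "norm (s - 1) * (norm s * real (Suc n) powr (-Re s - 1)) \<le> (\<bar>r\<bar> + 1) * (\<bar>r\<bar> * real (Suc n) powr -(1 + \<delta>))"
        using s by (intro mult_mono) auto
      then show ?thesis using bound[of s n] s \<delta> by linarith
    qed
    moreover have "summable (\<lambda>n. (\<bar>r\<bar> + 1) * (\<bar>r\<bar> * real (Suc n) powr -(1 + \<delta>)))"
      using summable_nat_powr[of "1 + \<delta>"] \<delta> summable_Suc_iff[of "\<lambda>n. real n powr -(1+\<delta>)"]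
      by (intro summable_mult) auto
    ultimately show "\<exists>h. summable h \<and> (\<forall>n s. norm s \<le> r \<longrightarrow> Re s \<ge> 0 + \<delta> \<longrightarrow> norm (f n s) \<le> h n)"
      by blast
  qed
  then obtain H where H: "H holomorphic_on {s. Re s > 0}" "\<And>s. Re s > 0 \<Longrightarrow> (\<lambda>n. f n s) sums H s" by blast
  have "f n 1 = 0" for n unfolding f_def by (simp del: of_nat_Suc)
  then have H1: "H 1 = 0" using H(2)[of 1] sums_unique2[of "\<lambda>n. 0" "H 1" 0] by simp
  have "(\<lambda>n. (s - 1) * of_nat n powr -s) sums (1 + H s)" if s: "Re s > 1" for s
  proof -
    have "(\<lambda>n. of_nat (Suc n) powr (1 - s)) \<longlonglongrightarrow> (0::complex)"
    proof (rule tendsto_norm_zero_cancel)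
      have "(\<lambda>n. real (Suc n) powr -(Re s - 1)) \<longlonglongrightarrow> 0"
        using s by (intro tendsto_neg_powr
            filterlim_compose[OF filterlim_real_sequentially filterlim_Suc]) auto
      then show "(\<lambda>n. norm (of_nat (Suc n) powr (1 - s) :: complex)) \<longlonglongrightarrow> 0"
        unfolding norm_of_nat_powr[OF zero_less_Suc] by simp
    qed
    from telescope_sums'[OF this]
    have "(\<lambda>n. of_nat (Suc n) powr (1 - s) - of_nat (Suc (Suc n)) powr (1 - s) :: complex) sums 1" by simp
    from sums_add[OF this H(2)[of s]] s
    have "(\<lambda>n. (s - 1) * of_nat (Suc n) powr -s) sums (1 + H s)"
      by (simp add: f_def)
    then show ?thesis using sums_Suc_iff[of "\<lambda>n. (s - 1) * of_nat n powr -s" "1 + H s"] by simp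
  qed
  then show ?thesis using H H1 by blast
qed

section \<open>The Moebius function\<close>

definition moebius :: "nat \<Rightarrow> int" where
  "moebius n = (if squarefree n then (-1) ^ card (prime_factors n) else 0)"

lemma moebius_1 [simp]: "moebius (Suc 0) = 1"
  by (simp add: moebius_def)

lemma abs_moebius_le: "\<bar>moebius n\<bar> \<le> 1"
  by (simp add: moebius_def power_abs)

lemma abs_mult_moebius_le:
  assumes "\<bar>x :: real\<bar> \<le> 1"
  shows "\<bar>x\<bar> * \<bar>of_int (moebius n)\<bar> \<le> 1"
proof -
  have "\<bar>of_int (moebius n) :: real\<bar> \<le> 1" using abs_moebius_le[of n] by linarith
  then show ?thesis using mult_mono[OF assms, of "\<bar>of_int (moebius n)\<bar>" 1] by simp
qed

lemma moebius_prime_mult: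
  fixes p e :: nat
  assumes "prime p" "e > 0"
  shows "moebius (p * e) = (if p dvd e then 0 else - moebius e)"
proof (cases "p dvd e")
  case True
  then have "p ^ 2 dvd p * e" by (auto simp: power2_eq_square)
  then have "\<not> squarefree (p * e)" using assms(1) by (auto simp: squarefree_def)
  then show ?thesis using True by (simp add: moebius_def)
next
  case False
  then have c: "coprime p e" using assms(1) by (simp add: prime_imp_coprime)
  have "squarefree (p * e) \<longleftrightarrow> squarefree e"
    using c assms(1) by (auto simp: squarefree_mult_coprime squarefree_prime dest: squarefree_multD)
  moreover have "prime_factors (p * e) = insert p (prime_factors e)"
    using assms by (simp add: prime_factors_product prime_prime_factors)
  moreover have "p \<notin> prime_factors e" using False by (simp add: in_prime_factors_iff)
  ultimately show ?thesis using False by (auto simp: moebius_def)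
qed

text \<open>For a prime p dividing n = p * m, the divisors p * e contribute
  \<open>- moebius e\<close> when p does not divide e and 0 otherwise. This cancels the divisors of
  n prime to p, which are the divisors of m prime to p.\<close>

lemma sum_moebius_divisors:
  assumes "n > 0"
  shows "(\<Sum>d | d dvd n. moebius d) = (if n = 1 then 1 else 0)"
proof (cases "n = 1")
  case False
  then obtain p where p: "prime p" "p dvd n" using prime_factor_nat by blast
  then obtain m where m: "n = p * m" by auto
  have p0: "p > 0" using p(1) by (rule prime_gt_0_nat)
  have fin: "finite {d. d dvd n}" "finite {d. d dvd m}" using assms m by auto
  have "(\<Sum>d | d dvd n. moebius d) = (\<Sum>d\<in>{d. d dvd n \<and> \<not> p dvd d} \<union> {d. d dvd n \<and> p dvd d}. moebius d)"
    by (rule sum.cong) auto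
  also have "\<dots> = (\<Sum>d\<in>{d. d dvd n \<and> \<not> p dvd d}. moebius d) + (\<Sum>d\<in>{d. d dvd n \<and> p dvd d}. moebius d)"
    using fin by (intro sum.union_disjoint) auto
  also have "{d. d dvd n \<and> p dvd d} = (\<lambda>e. p * e) ` {e. e dvd m}"
    using p0 unfolding m by (auto simp: dvd_def)
  also have "(\<Sum>d\<in>(\<lambda>e. p * e) ` {e. e dvd m}. moebius d) = (\<Sum>e | e dvd m. moebius (p * e))"
    using p0 by (subst sum.reindex) (auto simp: inj_on_def)
  also have "\<dots> = (\<Sum>e | e dvd m. if p dvd e then 0 else - moebius e)"
  proof (intro sum.cong refl)
    fix e assume "e \<in> {e. e dvd m}"
    then have "e > 0" using m assms by (auto intro!: Nat.gr0I)
    then show "moebius (p * e) = (if p dvd e then 0 else - moebius e)" by (rule moebius_prime_mult[OF p(1)])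
  qed
  also have "\<dots> = (\<Sum>e\<in>{e. e dvd m \<and> \<not> p dvd e}. - moebius e)"
    using fin by (intro sum.mono_neutral_cong_right) auto
  also have "{e. e dvd m \<and> \<not> p dvd e} = {d. d dvd n \<and> \<not> p dvd d}"
  proof -
    have "d dvd p * m \<longleftrightarrow> d dvd m" if "\<not> p dvd d" for d
      using prime_imp_coprime[OF p(1) that] by (simp add: coprime_commute coprime_dvd_mult_right_iff)
    then show ?thesis unfolding m by blast
  qed
  finally show ?thesis using False by (simp add: sum_negf)
qed auto

text \<open>Raising the exponent of p by one adds exactly the divisors containing the full power,
  which makes divisor sums computable by induction on k.\<close>

lemma divisors_prime_power_mult:
  fixes p m :: nat
  assumes p: "prime p" "\<not> p dvd m" "m > 0"
  shows "{d. d dvd p ^ Suc k * m} = {d. d dvd p ^ k * m} \<union> (\<lambda>e. p ^ Suc k * e) ` {e. e dvd m}"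
    and "{d. d dvd p ^ k * m} \<inter> (\<lambda>e. p ^ Suc k * e) ` {e. e dvd m} = {}"
proof -
  have "d dvd p ^ k * m \<or> d \<in> (\<lambda>e. p ^ Suc k * e) ` {e. e dvd m}" if d: "d dvd p ^ Suc k * m" for d
  proof -
    obtain a b where ab: "d = a * b" "a dvd p ^ Suc k" "b dvd m" using division_decomp[OF d] by blast
    obtain j where j: "j \<le> Suc k" "a = p ^ j" using divides_primepow_nat[OF p(1)] ab(2) by blast
    show ?thesis
    proof (cases "j \<le> k")
      case True
      then have "d dvd p ^ k * m"
        unfolding ab(1) j(2) by (rule mult_dvd_mono[OF le_imp_power_dvd ab(3)])
      then show ?thesis ..
    next
      case False
      then have "j = Suc k" using j by simp
      then show ?thesis using ab(1,3) j(2) by blast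
    qed
  qed
  moreover have "p ^ Suc k * e dvd p ^ Suc k * m" if "e dvd m" for e
    using that by (rule mult_dvd_mono[OF dvd_refl])
  moreover have "d dvd p ^ Suc k * m" if "d dvd p ^ k * m" for d
    using dvd_trans[OF that] by (simp add: mult.assoc)
  ultimately show "{d. d dvd p ^ Suc k * m} = {d. d dvd p ^ k * m} \<union> (\<lambda>e. p ^ Suc k * e) ` {e. e dvd m}"
    by blast
  have "\<not> p ^ Suc k * e dvd p ^ k * m" for e
  proof
    assume "p ^ Suc k * e dvd p ^ k * m"
    then have "p ^ k * (p * e) dvd p ^ k * m" by (simp add: mult_ac)
    then have "p * e dvd m" using p(1) by (simp add: prime_gt_0_nat)
    then show False using p(2) dvd_mult_left by blast
  qed
  then show "{d. d dvd p ^ k * m} \<inter> (\<lambda>e. p ^ Suc k * e) ` {e. e dvd m} = {}" by blast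
qed

section \<open>Real characters\<close>

text \<open>Non-principality is encoded by the vanishing sum over a period. This is the form that
  bounds the partial sums, and it also excludes the constant 1, whence
  \<open>\<psi> 0 = 0\<close>.\<close>

locale real_character =
  fixes \<psi> :: "nat \<Rightarrow> real" and N :: nat
  assumes N_pos: "N > 0"
    and periodic: "\<psi> (n + N) = \<psi> n"
    and mult: "\<psi> (m * n) = \<psi> m * \<psi> n"
    and range: "\<psi> n \<in> {-1, 0, 1}"
    and one: "\<psi> 1 = 1"
    and sum_zero: "(\<Sum>n<N. \<psi> n) = 0"
begin

lemma abs_le: "\<bar>\<psi> n\<bar> \<le> 1" using range[of n] by auto

lemma zero: "\<psi> 0 = 0"
proof (rule ccontr)
  assume "\<psi> 0 \<noteq> 0"
  then have "\<psi> n = 1" for n using mult[of 0 n] by simp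
  then show False using sum_zero N_pos by simp
qed

lemma one' [simp]: "\<psi> (Suc 0) = 1" using one by simp

lemma power: "\<psi> (n ^ k) = \<psi> n ^ k"
  by (induction k) (simp_all add: mult)

text \<open>The coefficients of the product of the zeta function with the L-series of
  \<open>\<psi>\<close>.\<close>

definition divisor_sum :: "nat \<Rightarrow> real" where
  "divisor_sum n = (\<Sum>d | d dvd n. \<psi> d)"

lemma divisor_sum_prime_power_mult:
  assumes p: "prime p" "\<not> p dvd m" "m > 0"
  shows "divisor_sum (p ^ k * m) = (\<Sum>j\<le>k. \<psi> p ^ j) * divisor_sum m"
proof (induction k)
  case 0 then show ?case by simp
next
  case (Suc k)
  have pos: "p > 0" "p ^ Suc k > 0" using p(1) by (auto simp: prime_gt_0_nat)
  have "divisor_sum (p ^ Suc k * m) = divisor_sum (p ^ k * m) + (\<Sum>d\<in>(\<lambda>e. p ^ Suc k * e) ` {e. e dvd m}. \<psi> d)"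
    unfolding divisor_sum_def divisors_prime_power_mult(1)[OF p]
    using divisors_prime_power_mult(2)[OF p] p pos by (intro sum.union_disjoint) (auto simp del: power_Suc)
  also have "(\<Sum>d\<in>(\<lambda>e. p ^ Suc k * e) ` {e. e dvd m}. \<psi> d) = \<psi> p ^ Suc k * divisor_sum m"
    using pos by (subst sum.reindex) (auto simp: inj_on_def divisor_sum_def mult power sum_distrib_left simp del: power_Suc)
  finally show ?case using Suc by (simp add: algebra_simps)
qed

text \<open>Split off the full power p^k. Its factor is 1, k + 1, or an alternating sum equal to 1
  for even k and 0 for odd k, according to \<open>\<psi> p\<close> = 0, 1, -1. In a square every
  such k is even and the cofactor is again a square.\<close>

lemma divisor_sum_nonneg: "n > 0 \<Longrightarrow> divisor_sum n \<ge> 0 \<and> ((\<exists>m. n = m\<^sup>2) \<longrightarrow> divisor_sum n \<ge> 1)"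
proof (induction n rule: less_induct)
  case (less n)
  show ?case
  proof (cases "n = 1")
    case True then show ?thesis by (simp add: divisor_sum_def)
  next
    case False
    then obtain p where p: "prime p" "p dvd n" using prime_factor_nat by blast
    obtain k m where km: "n = p ^ k * m" "\<not> p dvd m"
      using prime_power_canonical[OF p(1) less.prems] by (metis mult.commute)
    have m0: "m > 0" using km less.prems by (auto intro: Nat.gr0I)
    have k0: "k > 0" using km p by (auto intro: Nat.gr0I)
    have "p ^ k > 1" using k0 p(1) prime_gt_1_nat one_less_power by blast
    then have lt: "m < n" using km m0 by simp
    have ds: "divisor_sum n = (\<Sum>j\<le>k. \<psi> p ^ j) * divisor_sum m"
      unfolding km(1) by (rule divisor_sum_prime_power_mult[OF p(1) km(2) m0])
    have alt: "(\<Sum>j\<le>k. (-1::real) ^ j) = (if even k then 1 else 0)" for k by (induction k) auto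
    have zer: "(\<Sum>j\<le>k. (0::real) ^ j) = 1" for k by (induction k) auto
    have geo: "(\<Sum>j\<le>k. \<psi> p ^ j) \<ge> 0 \<and> (even k \<longrightarrow> (\<Sum>j\<le>k. \<psi> p ^ j) \<ge> 1)"
      using range[of p] alt[of k] zer[of k] by auto
    have sq: "even k \<and> (\<exists>l. m = l\<^sup>2)" if "n = l\<^sup>2" for l
    proof -
      have l0: "l > 0" using that less.prems by (auto intro: Nat.gr0I)
      obtain j q where jq: "l = p ^ j * q" "\<not> p dvd q"
        using prime_power_canonical[OF p(1) l0] by (metis mult.commute)
      have e: "p ^ k * m = p ^ (2 * j) * q\<^sup>2"
        using that km jq by (simp add: power_mult_distrib power_mult mult.commute)
      have nd: "\<not> p dvd q\<^sup>2" using jq p(1) prime_dvd_power by blast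
      have "k = multiplicity p (p ^ k * m)"
        using km p(1) m0 by (simp add: prime_elem_multiplicity_mult_distrib not_dvd_imp_multiplicity_0)
      moreover have "2 * j = multiplicity p (p ^ (2 * j) * q\<^sup>2)"
        using nd p(1) jq by (subst prime_elem_multiplicity_mult_distrib) (auto simp: not_dvd_imp_multiplicity_0 intro: Nat.gr0I)
      ultimately have "k = 2 * j" using e by simp
      then show ?thesis using e p(1) by (auto simp: prime_gt_0_nat)
    qed
    have "divisor_sum n \<ge> 0" unfolding ds using less.IH[OF lt m0] geo by auto
    moreover have "divisor_sum n \<ge> 1" if "\<exists>l. n = l\<^sup>2"
    proof -
      have "1 * 1 \<le> (\<Sum>j\<le>k. \<psi> p ^ j) * divisor_sum m"
        using less.IH[OF lt m0] geo sq that by (intro mult_mono) auto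
      then show ?thesis unfolding ds by simp
    qed
    ultimately show ?thesis by blast
  qed
qed

end

section \<open>Logarithmic derivatives\<close>

text \<open>The partial sums are themselves periodic, so they take only finitely many
  values.\<close>

lemma periodic_partial_sums_bounded:
  fixes f :: "nat \<Rightarrow> real"
  assumes N: "N > 0" and per: "\<And>n. f (n + N) = f n" and sum0: "(\<Sum>k<N. f k) = 0"
  shows "\<exists>K. \<forall>n. \<bar>\<Sum>k<n. f k\<bar> \<le> K"
proof -
  define g where "g n = (\<Sum>k<n. f k)" for n
  have gN: "g (n + N) = g n" for n
  proof (induction n)
    case 0 then show ?case using sum0 by (simp add: g_def)
  next
    case (Suc n) then show ?case using per[of n] by (simp add: g_def)
  qed
  have gm: "g (n + m * N) = g n" for n m
    by (induction m) (simp_all add: gN add.assoc[symmetric] add.commute[of N])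
  have "\<bar>g n\<bar> \<le> (\<Sum>k<N. \<bar>g k\<bar>)" for n
  proof -
    have "g n = g (n mod N)" using gm[of "n mod N" "n div N"] by simp
    then show ?thesis using member_le_sum[of "n mod N" "{..<N}" "\<lambda>k. \<bar>g k\<bar>"] N by simp
  qed
  then show ?thesis unfolding g_def by blast
qed

text \<open>The number k is the order of vanishing at s0, read off from g = (s - s0)^k * h with h
  nonzero nearby. The point w excludes g = 0 identically.\<close>

lemma log_deriv_at_zero:
  assumes g: "g holomorphic_on S" and S: "open S" "connected S" "s0 \<in> S" and nz: "w \<in> S" "g w \<noteq> 0"
  shows "\<exists>k::nat. ((\<lambda>s. (s - s0) * (deriv g s / g s)) \<longlongrightarrow> of_nat k) (at s0) \<and> (k = 0 \<longleftrightarrow> g s0 \<noteq> 0)"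
proof -
  have lim0: "((\<lambda>s. (s - s0) * (deriv h s / h s)) \<longlongrightarrow> 0) (at s0)"
    if h: "h holomorphic_on T" "open T" "s0 \<in> T" "h s0 \<noteq> 0" for h T
  proof -
    have "isCont h s0" "isCont (deriv h) s0"
      using h holomorphic_deriv[OF h(1,2)] by (auto simp: continuous_on_eq_continuous_at
          dest!: holomorphic_on_imp_continuous_on)
    then have "((\<lambda>s. (s - s0) * (deriv h s / h s)) \<longlongrightarrow> (s0 - s0) * (deriv h s0 / h s0)) (at s0)"
      using h(4) by (intro tendsto_intros) (auto simp: isCont_def)
    then show ?thesis by simp
  qed
  show ?thesis
  proof (cases "g s0 = 0")
    case False
    then show ?thesis using lim0[OF g S(1,3)] by (intro exI[of _ 0]) auto
  next
    case True
    have "\<not> g constant_on S" using True nz S unfolding constant_on_def by metis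
    then obtain h r n where h: "0 < n" "0 < r" "ball s0 r \<subseteq> S" "h holomorphic_on ball s0 r"
      "\<And>w. w \<in> ball s0 r \<Longrightarrow> g w = (w - s0) ^ n * h w" "\<And>w. w \<in> ball s0 r \<Longrightarrow> h w \<noteq> 0"
      using holomorphic_factor_zero_nonconstant[OF g S(1,2,3) True] by metis
    have eq: "(s - s0) * (deriv g s / g s) = of_nat n + (s - s0) * (deriv h s / h s)"
      if s: "s \<in> ball s0 r" "s \<noteq> s0" for s
    proof -
      have "(h has_field_derivative deriv h s) (at s)"
        using holomorphic_derivI[OF h(4) open_ball s(1)] .
      then have "((\<lambda>w. (w - s0) ^ n * h w) has_field_derivative
          (of_nat n * (s - s0) ^ (n - 1)) * h s + (s - s0) ^ n * deriv h s) (at s)"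
        by (auto intro!: derivative_eq_intros)
      then have "(g has_field_derivative
          (of_nat n * (s - s0) ^ (n - 1)) * h s + (s - s0) ^ n * deriv h s) (at s)"
        by (rule has_field_derivative_transform_within_open[OF _ open_ball s(1)]) (simp add: h(5))
      then have dg: "deriv g s = of_nat n * (s - s0) ^ (n - 1) * h s + (s - s0) ^ n * deriv h s"
        by (rule DERIV_imp_deriv)
      have pw: "(s - s0) ^ n = (s - s0) * (s - s0) ^ (n - 1)"
        using h(1) by (metis power_minus_mult mult.commute)
      have "s - s0 \<noteq> 0" "h s \<noteq> 0" using s h(6) by auto
      then show ?thesis unfolding dg h(5)[OF s(1)] pw by (simp add: field_simps)
    qed
    have "((\<lambda>s. of_nat n + (s - s0) * (deriv h s / h s)) \<longlongrightarrow> of_nat n + 0) (at s0)"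
      using h by (intro tendsto_intros lim0[OF h(4)]) auto
    moreover have "\<forall>\<^sub>F s in at s0. of_nat n + (s - s0) * (deriv h s / h s) = (s - s0) * (deriv g s / g s)"
      using eventually_at_ball'[OF h(2), of s0 UNIV] by eventually_elim (rule eq[symmetric], auto)
    ultimately have "((\<lambda>s. (s - s0) * (deriv g s / g s)) \<longlongrightarrow> of_nat n) (at s0)"
      using Lim_transform_eventually by fastforce
    then show ?thesis using h(1) True by (intro exI[of _ n]) auto
  qed
qed

text \<open>Complete multiplicativity pulls f out of the convolution of \<open>f * moebius\<close>
  with f, leaving the divisor sum of \<open>moebius\<close>, which is concentrated at 1.\<close>

lemma dirichlet_series_mult_inverse:
  fixes f :: "nat \<Rightarrow> real"
  assumes f: "\<And>n. \<bar>f n\<bar> \<le> 1" "\<And>m n. f (m * n) = f m * f n" "f 1 = 1"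
    and s: "Re s > 1"
  shows "(\<lambda>n. of_real (f n * of_int (moebius n)) * of_nat n powr -s) sums (1 / (\<Sum>n. of_real (f n) * of_nat n powr -s))"
    and "(\<Sum>n. of_real (f n) * of_nat n powr -s) \<noteq> (0::complex)"
proof -
  define a where "a = (\<lambda>n. complex_of_real (f n * of_int (moebius n)))"
  define b where "b = (\<lambda>n. complex_of_real (f n))"
  have an: "norm (a n) \<le> 1" for n
    unfolding a_def norm_of_real abs_mult by (rule abs_mult_moebius_le[OF f(1)])
  have sm: "summable (\<lambda>n. norm (a n * of_nat n powr -s))" "summable (\<lambda>n. norm (b n * of_nat n powr -s))"
    using an f(1) by (auto intro!: dirichlet_series_bounded[OF _ s] simp: b_def)
  have dc: "dconv a b n = (if n = 1 then 1 else 0)" if "n > 0" for n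
  proof -
    have "dconv a b n = (\<Sum>d | d dvd n. b n * of_int (moebius d))"
      unfolding dconv_def
    proof (intro sum.cong refl)
      fix d assume "d \<in> {d. d dvd n}"
      then have "f d * f (n div d) = f n" using f(2)[of d "n div d"] by simp
      moreover have "a d * b (n div d) = of_real (f d * f (n div d)) * of_int (moebius d)"
        by (simp add: a_def b_def)
      ultimately show "a d * b (n div d) = b n * of_int (moebius d)" by (simp only: b_def)
    qed
    also have "\<dots> = b n * of_int (\<Sum>d | d dvd n. moebius d)" by (simp add: sum_distrib_left)
    finally show ?thesis using that f(3) by (simp add: sum_moebius_divisors b_def)
  qed
  have "(\<lambda>n. dconv a b n * of_nat n powr -s) = (\<lambda>n. if n = 1 then 1 else 0)"
  proof
    fix n show "dconv a b n * of_nat n powr -s = (if n = 1 then 1 else 0)"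
      by (cases "n = 0") (auto simp: dc)
  qed
  then have "(\<lambda>n. if n = 1 then 1 else 0) sums
      ((\<Sum>n. a n * of_nat n powr -s) * (\<Sum>n. b n * of_nat n powr -s))"
    using dirichlet_product_sums[OF sm] by (simp only:)
  then have e: "(\<Sum>n. a n * of_nat n powr -s) * (\<Sum>n. b n * of_nat n powr -s) = 1"
    by (rule sums_unique2[OF _ sums_single[of 1 "\<lambda>_. 1"]])
  then have nz: "(\<Sum>n. b n * of_nat n powr -s) \<noteq> 0" by auto
  then show "(\<Sum>n. of_real (f n) * of_nat n powr -s) \<noteq> (0::complex)" unfolding b_def .
  have "(\<lambda>n. a n * of_nat n powr -s) sums (\<Sum>n. a n * of_nat n powr -s)"
    using summable_norm_cancel[OF sm(1)] by (rule summable_sums)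
  moreover have "(\<Sum>n. a n * of_nat n powr -s) = 1 / (\<Sum>n. b n * of_nat n powr -s)"
    by (rule eq_divide_imp[OF nz e])
  ultimately show "(\<lambda>n. of_real (f n * of_int (moebius n)) * of_nat n powr -s) sums (1 / (\<Sum>n. of_real (f n) * of_nat n powr -s))"
    unfolding a_def b_def by simp
qed

text \<open>The convolution of \<open>f * mangoldt\<close> with f is f * ln, the coefficient
  sequence of minus the derivative. Termwise differentiation is available for a function h agreeing
  with g on the open half-plane, so their derivatives agree as well.\<close>

lemma dirichlet_series_log_deriv:
  fixes f :: "nat \<Rightarrow> real"
  assumes f: "\<And>n. \<bar>f n\<bar> \<le> 1" "\<And>m n. f (m * n) = f m * f n" "f 1 = 1"
    and g: "\<And>s. Re s > 1 \<Longrightarrow> (\<lambda>n. of_real (f n) * of_nat n powr -s) sums g s"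
    and s: "Re s > 1"
  shows "g s \<noteq> 0" "(\<lambda>n. of_real (f n * mangoldt n) * of_nat n powr -s) sums (- deriv g s / g s)"
proof -
  define a where "a = (\<lambda>n. complex_of_real (f n * mangoldt n))"
  define b where "b = (\<lambda>n. complex_of_real (f n))"
  have gs: "(\<Sum>n. of_real (f n) * of_nat n powr -s) = g s" if "Re s > 1" for s
    using g[OF that] by (simp add: sums_iff)
  show nz: "g s \<noteq> 0" using dirichlet_series_mult_inverse(2)[of f s] f s gs by auto
  obtain h where h: "\<And>s. Re s > 1 \<Longrightarrow> (\<lambda>n. b n * of_nat n powr -s) sums h s \<and>
        (\<lambda>n. - b n * ln (of_nat n) * of_nat n powr -s) sums deriv h s"
    using dirichlet_series_holomorphic[of b] f(1) by (auto simp: b_def)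
  have hg: "h s = g s" if "Re s > 1" for s
    using conjunct1[OF h[OF that]] g[OF that] unfolding b_def by (rule sums_unique2)
  have "\<forall>\<^sub>F z in nhds s. h z = g z"
    using eventually_nhds_in_open[OF open_halfspace_Re_gt, of s 1] s
    by (auto elim!: eventually_mono simp: hg)
  then have dh: "deriv h s = deriv g s" by (intro deriv_cong_ev) auto
  have gb: "(\<Sum>n. b n * of_nat n powr -s) = g s" unfolding b_def by (rule gs[OF s])
  have sb: "summable (\<lambda>n. norm (b n * of_nat n powr -s))"
    using f(1) by (auto intro!: dirichlet_series_bounded[OF _ s] simp: b_def)
  have sa: "summable (\<lambda>n. norm (a n * of_nat n powr -s))"
  proof (rule summable_comparison_test')
    \<comment> \<open>Half of the room to the right of 1 is spent on ln n <= n^e / e, and the other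
      half keeps the series convergent.\<close>
    define e where "e = (Re s - 1) / 2"
    have e: "e > 0" "Re s - e > 1" using s by (auto simp: e_def field_simps)
    show "summable (\<lambda>n. (1 / e) * real n powr -(Re s - e))"
      using e by (intro summable_mult summable_nat_powr)
    fix n :: nat
    show "norm (norm (a n * of_nat n powr -s)) \<le> (1 / e) * real n powr -(Re s - e)"
    proof (cases "n = 0")
      case False
      have "norm (a n) \<le> 1 * ln n"
        unfolding a_def norm_of_real abs_mult using f(1) False
        by (intro mult_mono) (auto simp: mangoldt_nonneg mangoldt_le)
      also have "\<dots> \<le> real n powr e / e" using ln_powr_bound[of n e] False e by simp
      finally have "norm (a n) * real n powr -Re s \<le> real n powr e / e * real n powr -Re s"
        by (intro mult_right_mono) auto
      also have "\<dots> = (1 / e) * real n powr -(Re s - e)"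
        using False by (simp add: powr_diff powr_minus field_simps)
      finally show ?thesis using False by (simp add: norm_mult norm_of_nat_powr)
    qed auto
  qed
  have dc: "dconv a b n = b n * ln (of_nat n)" if "n > 0" for n
  proof -
    have "dconv a b n = (\<Sum>d | d dvd n. b n * mangoldt d)"
      unfolding dconv_def
    proof (intro sum.cong refl)
      fix d assume "d \<in> {d. d dvd n}"
      then have "f d * f (n div d) = f n" using f(2)[of d "n div d"] by simp
      moreover have "a d * b (n div d) = of_real (f d * f (n div d)) * mangoldt d"
        by (simp add: a_def b_def)
      ultimately show "a d * b (n div d) = b n * mangoldt d" by (simp only: b_def)
    qed
    also have "\<dots> = b n * (\<Sum>d | d dvd n. mangoldt d)" by (simp add: sum_distrib_left)
    also have "(\<Sum>d | d dvd n. mangoldt d :: complex) = of_real (ln (real n))"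
      using that by (intro mangoldt_sum) auto
    finally show ?thesis using that by (simp add: Ln_of_nat)
  qed
  have "(\<lambda>n. dconv a b n * of_nat n powr -s) = (\<lambda>n. b n * ln (of_nat n) * of_nat n powr -s)"
  proof
    fix n show "dconv a b n * of_nat n powr -s = b n * ln (of_nat n) * of_nat n powr -s"
      by (cases "n = 0") (auto simp: dc)
  qed
  then have "(\<lambda>n. b n * ln (of_nat n) * of_nat n powr -s) sums ((\<Sum>n. a n * of_nat n powr -s) * g s)"
    using dirichlet_product_sums[OF sa sb] gb by (simp only:)
  moreover have "(\<lambda>n. b n * ln (of_nat n) * of_nat n powr -s) sums (- deriv g s)"
    using sums_minus[OF conjunct2[OF h[OF s]]] by (simp add: dh)
  ultimately have "(\<Sum>n. a n * of_nat n powr -s) * g s = - deriv g s" by (rule sums_unique2)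
  then have "(\<Sum>n. a n * of_nat n powr -s) = - deriv g s / g s" using nz by (simp add: field_simps)
  moreover have "(\<lambda>n. a n * of_nat n powr -s) sums (\<Sum>n. a n * of_nat n powr -s)"
    using summable_norm_cancel[OF sa] by (rule summable_sums)
  ultimately show "(\<lambda>n. of_real (f n * mangoldt n) * of_nat n powr -s) sums (- deriv g s / g s)"
    unfolding a_def by simp
qed

text \<open>Arithmetic-geometric mean applied to the pairs t^i and t^(n-1-i), whose product is
  always t^(n-1).\<close>

lemma geometric_sum_ge:
  fixes t :: real
  assumes t: "0 < t"
  shows "(real n)\<^sup>2 * t ^ (n - 1) \<le> (\<Sum>i<n. t ^ i)\<^sup>2"
proof -
  have "real n * sqrt (t ^ (n - 1)) = (\<Sum>i<n. sqrt (t ^ i * t ^ (n - 1 - i)))"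
    by (simp flip: power_add)
  also have "\<dots> \<le> (\<Sum>i<n. (t ^ i + t ^ (n - 1 - i)) / 2)"
    using t by (intro sum_mono arith_geo_mean_sqrt) auto
  also have "\<dots> = ((\<Sum>i<n. t ^ i) + (\<Sum>i<n. t ^ (n - 1 - i))) / 2"
    by (simp add: sum.distrib flip: sum_divide_distrib)
  also have "(\<Sum>i<n. t ^ (n - 1 - i)) = (\<Sum>i<n. t ^ i)"
    using sum.nat_diff_reindex[of "\<lambda>i. t ^ i" n] by simp
  finally have "(real n * sqrt (t ^ (n - 1)))\<^sup>2 \<le> (\<Sum>i<n. t ^ i)\<^sup>2"
    using t by (intro power_mono) auto
  then show ?thesis using t by (simp add: power_mult_distrib)
qed

text \<open>With G n = 1 + ... + t^(n-1), the claim reduces to n * (n+1) * t^n <= G n * G (n+1). Its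
  square is the product of \<open>geometric_sum_ge\<close> for n and for n+1, with a spare factor t
  < 1.\<close>

lemma lambert_weight_decreasing:
  fixes t :: real
  assumes t: "0 < t" "t < 1" and n: "n \<ge> 1"
  shows "1 / (real (Suc n) * (1 - t)) - t ^ Suc n / (1 - t ^ Suc n) \<le> 1 / (real n * (1 - t)) - t ^ n / (1 - t ^ n)"
proof -
  define G where "G = (\<lambda>n. \<Sum>i<n. t ^ i)"
  have G: "1 - t ^ m = (1 - t) * G m" for m unfolding G_def by (rule one_diff_power_eq)
  have Gpos: "G m > 0" if "m \<ge> 1" for m
    unfolding G_def using t that by (intro sum_pos) (auto simp: lessThan_empty_iff)
  have g: "(real m)\<^sup>2 * t ^ (m - 1) \<le> (G m)\<^sup>2" for m
    unfolding G_def by (rule geometric_sum_ge[OF t(1)])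
  have "t ^ n * t ^ n = t ^ (n - 1) * t ^ n * t" using n by (cases n) auto
  then have "(real n * real (Suc n) * t ^ n)\<^sup>2 = ((real n)\<^sup>2 * t ^ (n - 1)) * ((real (Suc n))\<^sup>2 * t ^ (Suc n - 1)) * t"
    unfolding power_mult_distrib power2_eq_square[of "t ^ n"] by simp
  also have "\<dots> \<le> ((G n)\<^sup>2 * (G (Suc n))\<^sup>2) * 1"
    using t by (intro mult_mono[OF mult_mono[OF g g]]) auto
  finally have "(real n * real (Suc n) * t ^ n)\<^sup>2 \<le> (G n * G (Suc n))\<^sup>2"
    by (simp only: power_mult_distrib mult_1_right)
  then have key: "real n * real (Suc n) * t ^ n \<le> G n * G (Suc n)"
  proof (rule power2_le_imp_le)
    show "0 \<le> G n * G (Suc n)"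
      unfolding G_def using t by (intro mult_nonneg_nonneg sum_nonneg) auto
  qed
  have pos: "G n > 0" "G (Suc n) > 0" "real n > 0" "real (Suc n) > 0" "1 - t > 0"
    using Gpos n t by auto
  have "t ^ n / (1 - t ^ n) - t ^ Suc n / (1 - t ^ Suc n)
      = (t ^ n * (1 - t ^ Suc n) - t ^ Suc n * (1 - t ^ n)) / ((1 - t ^ n) * (1 - t ^ Suc n))"
    using pos G[of n] G[of "Suc n"] by (intro diff_frac_eq) auto
  also have "t ^ n * (1 - t ^ Suc n) - t ^ Suc n * (1 - t ^ n) = t ^ n * (1 - t)"
    by (simp add: algebra_simps)
  also have "t ^ n * (1 - t) / ((1 - t ^ n) * (1 - t ^ Suc n)) = t ^ n / (G n * G (Suc n)) / (1 - t)"
    unfolding G using pos by simp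
  also have "t ^ n / (G n * G (Suc n)) \<le> 1 / (real n * real (Suc n))"
    using divide_right_mono[OF key, of "real n * real (Suc n) * (G n * G (Suc n))"] pos
    by (simp add: mult_ac del: of_nat_Suc)
  also have "1 / (real n * real (Suc n)) = 1 / real n - 1 / real (Suc n)"
    using pos by (simp add: field_simps)
  finally have "t ^ n / (1 - t ^ n) - t ^ Suc n / (1 - t ^ Suc n) \<le> (1 / real n - 1 / real (Suc n)) / (1 - t)"
    using pos by (simp add: divide_right_mono)
  also have "\<dots> = 1 / (real n * (1 - t)) - 1 / (real (Suc n) * (1 - t))"
    by (simp add: diff_divide_distrib)
  finally show ?thesis by linarith
qed

section \<open>Nonvanishing at 1\<close>

context real_character
begin

lemma partial_sums_bounded: "\<exists>K. \<forall>n. \<bar>\<Sum>k\<le>n. \<psi> k\<bar> \<le> K"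
  using periodic_partial_sums_bounded[OF N_pos periodic sum_zero]
  unfolding lessThan_Suc_atMost[symmetric] by blast

text \<open>Because the series with weights 1/n - 1/(n+1) is assumed to vanish, a multiple of it can
  be added to replace the Lambert weights by \<open>b\<close>. These decrease from
  \<open>b 1 = 1\<close> to 0, so the total variation is 1 and the bound K does not depend on
  t.\<close>

lemma lambert_series_bounded:
  assumes zero_sum: "(\<lambda>n. (\<Sum>k\<le>n. \<psi> k) * (1 / real n - 1 / real (Suc n))) sums 0"
    and K: "\<And>n. \<bar>\<Sum>k\<le>n. \<psi> k\<bar> \<le> K"
    and t: "0 < t" "t < 1" and F: "(\<lambda>n. \<psi> n * (t ^ n / (1 - t ^ n))) sums F"
  shows "\<bar>F\<bar> \<le> K"
proof -
  define A where "A n = (\<Sum>k\<le>n. \<psi> k)" for n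
  define w where "w = (\<lambda>n. t ^ n / (1 - t ^ n))"
  define b where "b = (\<lambda>n. 1 / (real n * (1 - t)) - w n)"
  have A0: "A 0 = 0" by (simp add: A_def zero)
  have tl: "(\<lambda>n. t ^ n) \<longlonglongrightarrow> 0" using t by (intro LIMSEQ_power_zero) auto
  have wl: "w \<longlonglongrightarrow> 0"
    using tendsto_divide[OF tl tendsto_diff[OF tendsto_const[of 1] tl]] by (simp add: w_def)
  have bl: "b \<longlonglongrightarrow> 0"
  proof -
    have "(\<lambda>n. (1 / real n) * (1 / (1 - t)) - w n) \<longlonglongrightarrow> 0 * (1 / (1 - t)) - 0"
      by (intro tendsto_intros lim_1_over_n wl)
    then show ?thesis by (simp add: b_def)
  qed
  have bdec: "b (Suc n) \<le> b n" if "n \<ge> 1" for n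
    using lambert_weight_decreasing[OF t that] by (simp add: b_def w_def)
  have b1: "b 1 = 1" using t by (simp add: b_def w_def diff_divide_distrib[symmetric])
  have Awl: "(\<lambda>n. A n * w (Suc n)) \<longlonglongrightarrow> 0"
  proof (rule Lim_null_comparison)
    show "(\<lambda>n. K * \<bar>w (Suc n)\<bar>) \<longlonglongrightarrow> 0"
      using tendsto_mult_right_zero[OF tendsto_rabs_zero[OF LIMSEQ_Suc[OF wl]]] .
    show "\<forall>\<^sub>F n in sequentially. norm (A n * w (Suc n)) \<le> K * \<bar>w (Suc n)\<bar>"
      unfolding A_def real_norm_def abs_mult by (intro always_eventually allI mult_right_mono K) auto
  qed
  have "(\<lambda>M. (\<Sum>n<Suc M. \<psi> n * w n) - A M * w (Suc M)) \<longlonglongrightarrow> F - 0"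
    using LIMSEQ_Suc[OF F[unfolded sums_def]] Awl unfolding w_def by (intro tendsto_diff)
  moreover have "(\<Sum>n<Suc M. \<psi> n * w n) - A M * w (Suc M) = (\<Sum>n<Suc M. A n * (w n - w (Suc n)))" for M
    using abel_partial_sums[of \<psi> w M] unfolding A_def by linarith
  ultimately have "(\<lambda>M. \<Sum>n<Suc M. A n * (w n - w (Suc n))) \<longlonglongrightarrow> F"
    by (simp only: diff_0_right)
  then have Aw: "(\<lambda>n. A n * (w n - w (Suc n))) sums F"
    unfolding sums_def by (rule LIMSEQ_imp_Suc)
  have "(\<lambda>n. 1 / (1 - t) * (A n * (1 / real n - 1 / real (Suc n))) - A n * (w n - w (Suc n))) sums (1 / (1 - t) * 0 - F)"
    using zero_sum unfolding A_def[symmetric] by (intro sums_diff sums_mult Aw)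
  moreover have "1 / (1 - t) * (A n * (1 / real n - 1 / real (Suc n))) - A n * (w n - w (Suc n)) = A n * (b n - b (Suc n))" for n
    unfolding b_def by (simp add: algebra_simps)
  ultimately have "(\<lambda>n. A n * (b n - b (Suc n))) sums (- F)" by simp
  then have lim: "(\<lambda>M. \<bar>\<Sum>n<Suc M. A n * (b n - b (Suc n))\<bar>) \<longlonglongrightarrow> \<bar>- F\<bar>"
    unfolding sums_def by (intro tendsto_rabs) (rule LIMSEQ_Suc)
  have le: "\<bar>\<Sum>n<Suc M. A n * (b n - b (Suc n))\<bar> \<le> K * (1 - b (Suc M))" for M
  proof -
    \<comment> \<open>The index 0 must go: division by zero makes \<open>b 0 = 0\<close>, so
      \<open>b\<close> decreases only from 1 on.\<close>
    have "(\<Sum>n<Suc M. A n * (b n - b (Suc n))) = (\<Sum>n\<in>{1..<Suc M}. A n * (b n - b (Suc n)))"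
      by (intro sum.mono_neutral_right) (auto simp: A0 not_less Suc_le_eq)
    also have "\<bar>\<dots>\<bar> \<le> (\<Sum>n\<in>{1..<Suc M}. \<bar>A n * (b n - b (Suc n))\<bar>)" by (rule sum_abs)
    also have "\<dots> \<le> (\<Sum>n\<in>{1..<Suc M}. K * (b n - b (Suc n)))"
    proof (rule sum_mono)
      fix n assume n: "n \<in> {1..<Suc M}"
      then have "\<bar>b n - b (Suc n)\<bar> = b n - b (Suc n)" using bdec[of n] by auto
      then show "\<bar>A n * (b n - b (Suc n))\<bar> \<le> K * (b n - b (Suc n))"
        unfolding abs_mult using K[of n] bdec[of n] n by (simp add: A_def mult_right_mono)
    qed
    also have "\<dots> = K * (\<Sum>n\<in>{1..<Suc M}. b n - b (Suc n))" by (rule sum_distrib_left[symmetric])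
    also have "(\<Sum>n\<in>{1..<Suc M}. b n - b (Suc n)) = b 1 - b (Suc M)"
      using sum_Suc_diff'[of 1 "Suc M" "\<lambda>n. - b n"] by simp
    finally show ?thesis unfolding b1 .
  qed
  have "(\<lambda>M. K * (1 - b (Suc M))) \<longlonglongrightarrow> K * (1 - 0)"
    by (intro tendsto_intros LIMSEQ_Suc[OF bl])
  then show ?thesis
    using LIMSEQ_le[OF lim, of "\<lambda>M. K * (1 - b (Suc M))" K] le by simp
qed

text \<open>Expand each t^n / (1 - t^n) as the geometric series of t^(n * m) and collect equal
  exponents. The double series converges absolutely, being dominated by t^n / (1 - t).\<close>

lemma lambert_series_regroup:
  assumes t: "0 < t" "t < 1"
  shows "\<exists>F. (\<lambda>n. \<psi> n * (t ^ n / (1 - t ^ n))) sums F \<and> ((\<lambda>n. divisor_sum n * t ^ n) has_sum F) {0<..}"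
proof -
  let ?P = "{0<..} :: nat set"
  have geo: "((\<lambda>m. t ^ (n * m)) has_sum (t ^ n / (1 - t ^ n))) ?P" if "n > 0" for n
  proof -
    have tn: "0 < t ^ n" "t ^ n < 1" using t that by (auto simp: power_less_one_iff)
    have "(\<lambda>m. t ^ n * (t ^ n) ^ m) sums (t ^ n * (1 / (1 - t ^ n)))"
      by (intro sums_mult geometric_sums) (use tn in auto)
    then have "((\<lambda>m. t ^ n * (t ^ n) ^ m) has_sum (t ^ n / (1 - t ^ n))) UNIV"
      using tn by (intro sums_nonneg_imp_has_sum) auto
    also have "?this \<longleftrightarrow> ?thesis"
      by (rule has_sum_reindex_bij_witness[of _ "\<lambda>m. m - 1" Suc]) (auto simp: power_mult power_add)
    finally show ?thesis .
  qed
  have bound: "t ^ n / (1 - t ^ n) \<le> t ^ n / (1 - t)" if "n > 0" for n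
    using t that power_decreasing[of 1 n t] by (intro divide_left_mono) (auto simp: power_less_one_iff)
  have sm0: "summable (\<lambda>n. t ^ n / (1 - t))"
    using t by (intro summable_divide summable_geometric) auto
  have wnn: "0 \<le> t ^ n / (1 - t ^ n)" for n
    using t by (auto simp: power_le_one)
  have sm: "summable (\<lambda>n. norm (\<psi> n * (t ^ n / (1 - t ^ n))))"
  proof (rule summable_comparison_test'[OF sm0])
    fix n :: nat
    show "norm (norm (\<psi> n * (t ^ n / (1 - t ^ n)))) \<le> t ^ n / (1 - t)"
    proof (cases "n = 0")
      case False
      have "\<bar>\<psi> n\<bar> * \<bar>t ^ n / (1 - t ^ n)\<bar> \<le> 1 * (t ^ n / (1 - t))"
        using abs_le[of n] bound[of n] wnn[of n] False
        by (intro mult_mono) (auto simp only: abs_of_nonneg neq0_conv abs_ge_zero)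
      then show ?thesis by (simp add: abs_mult)
    qed (use t in auto)
  qed
  define F where "F = (\<Sum>n. \<psi> n * (t ^ n / (1 - t ^ n)))"
  have F: "(\<lambda>n. \<psi> n * (t ^ n / (1 - t ^ n))) sums F"
    unfolding F_def using summable_norm_cancel[OF sm] by (rule summable_sums)
  have FU: "((\<lambda>n. \<psi> n * (t ^ n / (1 - t ^ n))) has_sum F) UNIV"
    by (rule norm_summable_imp_has_sum[OF sm F])
  have FP: "((\<lambda>n. \<psi> n * (t ^ n / (1 - t ^ n))) has_sum F) ?P"
    using FU by (subst has_sum_cong_neutral[where T = UNIV]) (auto simp: zero)
  have sP: "(\<lambda>(a,b). \<psi> a * t ^ (a * b)) summable_on ?P \<times> ?P"
  proof (rule abs_summable_summable)
    have "(\<lambda>(a,b). \<bar>\<psi> a\<bar> * t ^ (a * b)) summable_on ?P \<times> ?P"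
    proof (rule summable_on_SigmaI)
      show "((\<lambda>b. case (a, b) of (a, b) \<Rightarrow> \<bar>\<psi> a\<bar> * t ^ (a * b)) has_sum (\<bar>\<psi> a\<bar> * (t ^ a / (1 - t ^ a)))) ?P"
        if "a \<in> ?P" for a
        using has_sum_cmult_right[OF geo[of a], of "\<bar>\<psi> a\<bar>"] that by simp
      have "(\<lambda>n. norm (\<psi> n * (t ^ n / (1 - t ^ n)))) summable_on UNIV"
        using sm by (intro norm_summable_imp_summable_on) simp
      moreover have "(\<lambda>n. norm (\<psi> n * (t ^ n / (1 - t ^ n)))) = (\<lambda>a. \<bar>\<psi> a\<bar> * (t ^ a / (1 - t ^ a)))"
        unfolding real_norm_def abs_mult by (simp only: abs_of_nonneg[OF wnn])
      ultimately show "(\<lambda>a. \<bar>\<psi> a\<bar> * (t ^ a / (1 - t ^ a))) summable_on ?P"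
        using summable_on_subset_banach by fastforce
    qed (use t in auto)
    moreover have "(\<lambda>p. norm ((\<lambda>(a,b). \<psi> a * t ^ (a * b)) p)) = (\<lambda>(a,b). \<bar>\<psi> a\<bar> * t ^ (a * b))"
      using t by (auto simp: abs_mult)
    ultimately show "(\<lambda>p. norm ((\<lambda>(a,b). \<psi> a * t ^ (a * b)) p)) summable_on ?P \<times> ?P" by simp
  qed
  have "((\<lambda>(a,b). \<psi> a * t ^ (a * b)) has_sum F) (?P \<times> ?P)"
  proof (rule has_sum_SigmaI[OF _ FP sP])
    show "((\<lambda>b. case (a, b) of (a, b) \<Rightarrow> \<psi> a * t ^ (a * b)) has_sum (\<psi> a * (t ^ a / (1 - t ^ a)))) ?P"
      if "a \<in> ?P" for a
      using has_sum_cmult_right[OF geo[of a], of "\<psi> a"] that by simp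
  qed
  then have "((\<lambda>n. \<Sum>d | d dvd n. \<psi> d * t ^ (d * (n div d))) has_sum F) ?P"
    by (rule has_sum_regroup_divisors)
  moreover have "(\<Sum>d | d dvd n. \<psi> d * t ^ (d * (n div d))) = divisor_sum n * t ^ n" for n
    unfolding divisor_sum_def sum_distrib_right by (intro sum.cong) auto
  ultimately show ?thesis using F by auto
qed

text \<open>Monsky's argument: if \<open>L(1,\<psi>)\<close> vanished, the Lambert series \<open>\<Sum> \<psi>(n) t\<^sup>n / (1 - t\<^sup>n)\<close>
  would stay bounded as \<open>t\<close> tends to 1, whereas its coefficients are nonnegative and at least 1 at squares.\<close>
lemma sum_at_one_nonzero:
  "\<not> (\<lambda>n. (\<Sum>k\<le>n. \<psi> k) * (1 / real n - 1 / real (Suc n))) sums 0"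
proof
  assume z: "(\<lambda>n. (\<Sum>k\<le>n. \<psi> k) * (1 / real n - 1 / real (Suc n))) sums 0"
  obtain K where K: "\<And>n. \<bar>\<Sum>k\<le>n. \<psi> k\<bar> \<le> K" using partial_sums_bounded by blast
  obtain M :: nat where M: "2 * K < M" "M > 0"
    using reals_Archimedean2[of "max 0 (2 * K)"] by (metis max_less_iff_conj of_nat_0_less_iff)
  \<comment> \<open>Chosen so that t^(M^2) = 1/2. Each of the squares 1, 4, ..., M^2 then adds at
    least 1/2, and F >= M/2 exceeds K.\<close>
  define t where "t = (1/2::real) powr (1 / real (M ^ 2))"
  have t: "0 < t" "t < 1" using M powr_less_mono'[of "1/2" 0 "1 / real (M ^ 2)"] by (auto simp: t_def)
  have tM: "t ^ (M ^ 2) = 1 / 2"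
  proof -
    have "t ^ (M ^ 2) = t powr real (M ^ 2)" by (rule powr_realpow[OF t(1), symmetric])
    also have "\<dots> = (1/2) powr (1 / real (M ^ 2) * real (M ^ 2))" unfolding t_def by (rule powr_powr)
    also have "1 / real (M ^ 2) * real (M ^ 2) = 1" using M by simp
    finally show ?thesis by simp
  qed
  obtain F where F: "(\<lambda>n. \<psi> n * (t ^ n / (1 - t ^ n))) sums F"
    and F': "((\<lambda>n. divisor_sum n * t ^ n) has_sum F) {0<..}"
    using lambert_series_regroup[OF t] by blast
  have "real M * (1 / 2) = (\<Sum>j\<in>{1..M}. 1 / 2)" by simp
  also have "\<dots> \<le> (\<Sum>j\<in>{1..M}. divisor_sum (j\<^sup>2) * t ^ (j\<^sup>2))"
  proof (rule sum_mono)
    fix j assume j: "j \<in> {1..M}"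
    have "t ^ (M ^ 2) \<le> t ^ (j ^ 2)" using t j by (intro power_decreasing power_mono) auto
    then have "1 * (1 / 2) \<le> divisor_sum (j\<^sup>2) * t ^ (j\<^sup>2)"
      using divisor_sum_nonneg[of "j\<^sup>2"] j t tM by (intro mult_mono) auto
    then show "1 / 2 \<le> divisor_sum (j\<^sup>2) * t ^ (j\<^sup>2)" by simp
  qed
  also have "\<dots> = (\<Sum>n\<in>(\<lambda>j. j\<^sup>2) ` {1..M}. divisor_sum n * t ^ n)"
    by (subst sum.reindex) (auto simp: inj_on_def)
  also have "\<dots> \<le> F"
    by (rule finite_sum_le_has_sum[OF F']) (use divisor_sum_nonneg t in auto)
  finally have "M / 2 \<le> F" by simp
  moreover have "\<bar>F\<bar> \<le> K" by (rule lambert_series_bounded[OF z K t F])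
  ultimately show False using M by auto
qed

end

section \<open>Nonvanishing on the line Re s = 1\<close>

text \<open>The two signs serve the values 1 and -1 of a real character.\<close>

lemma cos_three_four_one: "0 \<le> 3 + 4 * cos x + cos (2 * x)" "0 \<le> 3 - 4 * cos x + cos (2 * (x::real))"
proof -
  have "3 + 4 * cos x + cos (2 * x) = 2 * (1 + cos x)^2" "3 - 4 * cos x + cos (2 * x) = 2 * (1 - cos x)^2"
    unfolding cos_double_cos by (simp_all add: power2_eq_square algebra_simps)
  then show "0 \<le> 3 + 4 * cos x + cos (2 * x)" "0 \<le> 3 - 4 * cos x + cos (2 * x)" by simp_all
qed

lemma Re_of_nat_powr_vertical:
  assumes "n > 0"
  shows "Re (of_nat n powr -(of_real \<sigma> + \<i> * of_real t)) = real n powr -\<sigma> * cos (t * ln n)"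
proof -
  have "of_nat n powr -(of_real \<sigma> + \<i> * of_real t) = exp (of_real (-\<sigma> * ln n) + \<i> * of_real (- (t * ln n)))"
    using assms by (simp add: powr_def Ln_of_nat algebra_simps)
  also have "Re \<dots> = exp (-\<sigma> * ln n) * cos (t * ln n)"
    unfolding exp_add exp_of_real by (simp add: Re_exp)
  also have "exp (-\<sigma> * ln n) = real n powr -\<sigma>" using assms by (simp add: powr_def)
  finally show ?thesis .
qed

context real_character
begin

definition L :: "complex \<Rightarrow> complex" where
  "L s = (\<Sum>n. of_real (\<psi> n) * of_nat n powr -s)"

lemma L_properties:
  shows L_holomorphic: "L holomorphic_on {s. Re s > 0}"
    and L_sums: "Re s > 0 \<Longrightarrow> (\<lambda>n. of_real (\<psi> n) * of_nat n powr -s) sums L s"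
    and L_abel_sums: "Re s > 0 \<Longrightarrow>
      (\<lambda>n. of_real (\<Sum>k\<le>n. \<psi> k) * (of_nat n powr -s - of_nat (Suc n) powr -s)) sums L s"
proof -
  obtain K where K: "\<And>n. \<bar>\<Sum>k\<le>n. \<psi> k\<bar> \<le> K" using partial_sums_bounded by blast
  have "norm (\<Sum>k\<le>n. complex_of_real (\<psi> k)) \<le> K" for n
    using K[of n] by (simp flip: of_real_sum)
  from abel_dirichlet_series[OF this] zero
  obtain g where g: "g holomorphic_on {s. Re s > 0}"
    "\<And>s. Re s > 0 \<Longrightarrow> (\<lambda>n. (\<Sum>k\<le>n. of_real (\<psi> k)) * (of_nat n powr -s - of_nat (Suc n) powr -s)) sums g s"
    "\<And>s. Re s > 0 \<Longrightarrow> (\<lambda>n. of_real (\<psi> n) * of_nat n powr -s) sums g s"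
    by auto
  have Lg: "L s = g s" if "Re s > 0" for s
    using g(3)[OF that] unfolding L_def by (simp add: sums_iff)
  show "L holomorphic_on {s. Re s > 0}"
    using g(1) by (rule holomorphic_transform) (simp add: Lg)
  show "Re s > 0 \<Longrightarrow> (\<lambda>n. of_real (\<psi> n) * of_nat n powr -s) sums L s"
    using g(3) Lg by simp
  show "Re s > 0 \<Longrightarrow> (\<lambda>n. of_real (\<Sum>k\<le>n. \<psi> k) * (of_nat n powr -s - of_nat (Suc n) powr -s)) sums L s"
    using g(2)[of s] Lg[of s] by (simp only: of_real_sum)
qed

lemma L_nonzero_at_1: "L 1 \<noteq> 0"
proof
  assume "L 1 = 0"
  then have "(\<lambda>n. of_real (\<Sum>k\<le>n. \<psi> k) * (of_nat n powr -1 - of_nat (Suc n) powr -1)) sums (0::complex)"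
    using L_abel_sums[of 1] by simp
  from sums_Re[OF this]
  have *: "(\<lambda>n. Re (of_real (\<Sum>k\<le>n. \<psi> k) * (of_nat n powr -1 - of_nat (Suc n) powr -1))) sums 0" by simp
  have "Re (of_real (\<Sum>k\<le>n. \<psi> k) * (of_nat n powr -1 - of_nat (Suc n) powr -1))
      = (\<Sum>k\<le>n. \<psi> k) * (1 / real n - 1 / real (Suc n))" for n
  proof -
    \<comment> \<open>Also true for m = 0, where both sides are 0 by convention.\<close>
    have p: "of_nat m powr -1 = complex_of_real (1 / real m)" for m
      by (cases "m = 0") (simp_all add: powr_minus divide_inverse)
    show ?thesis unfolding p by (simp flip: of_real_diff of_real_mult del: of_nat_Suc)
  qed
  then show False using * sum_at_one_nonzero by (simp only: )
qed

text \<open>The square of \<open>\<psi>\<close> is periodic with mean c > 0. Subtracting c leaves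
  bounded partial sums, hence a series that extends to Re s > 0, and the constant part is c times
  \<open>zeta_continuation\<close>. So Z is (s - 1) times the principal L-series and Z 1 = c,
  without any Euler factors at the primes dividing N.\<close>

lemma principal_continuation:
  "\<exists>Z. Z holomorphic_on {s. Re s > 0} \<and> Z 1 \<noteq> 0 \<and>
     (\<forall>s. Re s > 1 \<longrightarrow> (\<lambda>n. (s - 1) * (of_real ((\<psi> n)\<^sup>2) * of_nat n powr -s)) sums Z s)"
proof -
  define c where "c = (\<Sum>n<N. (\<psi> n)\<^sup>2) / N"
  \<comment> \<open>The value at 0 is overwritten to meet the hypothesis of
    \<open>abel_dirichlet_series\<close>, which shifts the partial sums by c.\<close>
  define a where "a = (\<lambda>n. if n = 0 then 0 else (\<psi> n)\<^sup>2 - c)"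
  have c: "c > 0"
  proof -
    have "N \<noteq> 1" using sum_zero zero one periodic[of 0] by auto
    then have "1 < N" using N_pos by simp
    then have "(\<psi> 1)\<^sup>2 \<le> (\<Sum>n<N. (\<psi> n)\<^sup>2)" by (intro member_le_sum) auto
    then show ?thesis using N_pos by (simp add: c_def)
  qed
  obtain K where K: "\<And>n. \<bar>\<Sum>k<n. (\<psi> k)\<^sup>2 - c\<bar> \<le> K"
    using periodic_partial_sums_bounded[of N "\<lambda>n. (\<psi> n)\<^sup>2 - c"] N_pos periodic
    by (auto simp: sum_subtractf c_def)
  have "\<bar>\<Sum>k\<le>n. a k\<bar> \<le> K + c" for n
  proof -
    have "(\<Sum>k\<le>n. a k) = (\<Sum>k<Suc n. (\<psi> k)\<^sup>2 - c) + c"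
      unfolding lessThan_Suc_atMost by (induction n) (auto simp: a_def zero)
    then show ?thesis using K[of "Suc n"] c by linarith
  qed
  then have "norm (\<Sum>k\<le>n. complex_of_real (a k)) \<le> K + c" for n
    by (metis norm_of_real of_real_sum)
  from abel_dirichlet_series[OF this]
  obtain G where G: "G holomorphic_on {s. Re s > 0}"
    "\<And>s. Re s > 0 \<Longrightarrow> (\<lambda>n. of_real (a n) * of_nat n powr -s) sums G s"
    by (auto simp: a_def)
  obtain H where H: "H holomorphic_on {s. Re s > 0}" "H 1 = 0"
    "\<And>s. Re s > 1 \<Longrightarrow> (\<lambda>n. (s - 1) * of_nat n powr -s) sums (1 + H s)"
    using zeta_continuation by blast
  define Z where "Z = (\<lambda>s. (s - 1) * G s + of_real c * (1 + H s))"
  have "Z holomorphic_on {s. Re s > 0}" unfolding Z_def by (intro holomorphic_intros G H)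
  moreover have "Z 1 \<noteq> 0" using c H(2) by (simp add: Z_def)
  moreover have "(\<lambda>n. (s - 1) * (of_real ((\<psi> n)\<^sup>2) * of_nat n powr -s)) sums Z s" if s: "Re s > 1" for s
  proof -
    have "(\<lambda>n. (s - 1) * (of_real (a n) * of_nat n powr -s) + of_real c * ((s - 1) * of_nat n powr -s)) sums Z s"
      unfolding Z_def using s by (intro sums_add sums_mult G H) auto
    moreover have "(s - 1) * (of_real (a n) * of_nat n powr -s) + of_real c * ((s - 1) * of_nat n powr -s)
      = (s - 1) * (of_real ((\<psi> n)\<^sup>2) * of_nat n powr -s)" for n
      by (cases "n = 0") (auto simp: a_def algebra_simps)
    ultimately show ?thesis by (simp only: )
  qed
  ultimately show ?thesis by blast
qed

text \<open>Termwise, the weight is \<open>mangoldt n * real n powr -\<sigma>\<close>. Its cofactor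
  is 0 if \<open>\<psi> n = 0\<close> and otherwise one of the two forms of
  \<open>cos_three_four_one\<close>.\<close>

lemma mangoldt_three_four_one:
  assumes s: "\<sigma> > 1"
    and B1: "\<And>s. Re s > 1 \<Longrightarrow> (\<lambda>n. of_real (\<psi> n * mangoldt n) * of_nat n powr -s) sums B1 s"
    and B0: "\<And>s. Re s > 1 \<Longrightarrow> (\<lambda>n. of_real ((\<psi> n)\<^sup>2 * mangoldt n) * of_nat n powr -s) sums B0 s"
  shows "0 \<le> 3 * Re (B0 (of_real \<sigma> + \<i> * of_real 0)) + 4 * Re (B1 (of_real \<sigma> + \<i> * of_real t))
           + Re (B0 (of_real \<sigma> + \<i> * of_real (2 * t)))"
proof (rule sums_le[OF _ sums_zero])
  show "(\<lambda>n. 3 * Re (of_real ((\<psi> n)\<^sup>2 * mangoldt n) * of_nat n powr -(of_real \<sigma> + \<i> * of_real 0))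
       + 4 * Re (of_real (\<psi> n * mangoldt n) * of_nat n powr -(of_real \<sigma> + \<i> * of_real t))
       + Re (of_real ((\<psi> n)\<^sup>2 * mangoldt n) * of_nat n powr -(of_real \<sigma> + \<i> * of_real (2 * t)))) sums
     (3 * Re (B0 (of_real \<sigma> + \<i> * of_real 0)) + 4 * Re (B1 (of_real \<sigma> + \<i> * of_real t))
           + Re (B0 (of_real \<sigma> + \<i> * of_real (2 * t))))"
    by (intro sums_add sums_mult sums_Re B0 B1) (use s in auto)
  fix n :: nat
  show "0 \<le> 3 * Re (of_real ((\<psi> n)\<^sup>2 * mangoldt n) * of_nat n powr -(of_real \<sigma> + \<i> * of_real 0))
       + 4 * Re (of_real (\<psi> n * mangoldt n) * of_nat n powr -(of_real \<sigma> + \<i> * of_real t))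
       + Re (of_real ((\<psi> n)\<^sup>2 * mangoldt n) * of_nat n powr -(of_real \<sigma> + \<i> * of_real (2 * t)))"
  proof (cases "n = 0")
    case False
    define \<theta> where "\<theta> = t * ln n"
    define m where "m = mangoldt n * real n powr -\<sigma>"
    have re: "Re (of_real r * z) = r * Re z" for r z by simp
    have m: "m \<ge> 0" unfolding m_def by (intro mult_nonneg_nonneg mangoldt_nonneg) auto
    have "3 * ((\<psi> n)\<^sup>2 * m) + 4 * (\<psi> n * m * cos \<theta>) + (\<psi> n)\<^sup>2 * m * cos (2 * \<theta>)
      = m * (3 * (\<psi> n)\<^sup>2 + 4 * (\<psi> n * cos \<theta>) + (\<psi> n)\<^sup>2 * cos (2 * \<theta>))" by (simp add: algebra_simps)
    also have "\<dots> \<ge> 0"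
      using range[of n] cos_three_four_one[of \<theta>] m by (intro mult_nonneg_nonneg) auto
    finally have "0 \<le> 3 * ((\<psi> n)\<^sup>2 * m) + 4 * (\<psi> n * m * cos \<theta>) + (\<psi> n)\<^sup>2 * m * cos (2 * \<theta>)" .
    then show ?thesis
      using False unfolding re by (subst (1 2 3) Re_of_nat_powr_vertical) (simp_all add: m_def \<theta>_def mult_ac)
  qed auto
qed

text \<open>Multiply the 3-4-1 inequality at \<sigma> = 1 + x by x and let x tend to 0 from the
  right. The simple pole of the principal series gives 3, a zero of order k of L gives -4k, and a
  zero of order k2 of Z at 1 + 2it gives -k2. Since t is not 0, the pole does not reach 1 + 2it, so
  4k + k2 <= 3, which forces k = 0.\<close>

lemma L_nonzero_off_real_axis:
  assumes t: "t \<noteq> 0"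
  shows "L (1 + \<i> * of_real t) \<noteq> 0"
proof
  assume L0: "L (1 + \<i> * of_real t) = 0"
  let ?S = "{s. Re s > 0}"
  have S: "open ?S" "connected ?S"
    by (intro open_halfspace_Re_gt convex_connected convex_halfspace_Re_gt)+
  obtain Z where Z: "Z holomorphic_on ?S" "Z 1 \<noteq> 0"
    "\<And>s. Re s > 1 \<Longrightarrow> (\<lambda>n. (s - 1) * (of_real ((\<psi> n)\<^sup>2) * of_nat n powr -s)) sums Z s"
    using principal_continuation by blast
  define L0 where "L0 = (\<lambda>s. Z s / (s - 1))"
  have L0s: "(\<lambda>n. of_real ((\<psi> n)\<^sup>2) * of_nat n powr -s) sums L0 s" if "Re s > 1" for s
  proof -
    have "s \<noteq> 1" using that by auto
    then show ?thesis using sums_divide[OF Z(3)[OF that], of "s - 1"] by (simp add: L0_def)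
  qed
  have sq: "\<bar>(\<psi> n)\<^sup>2\<bar> \<le> 1" "(\<psi> (m * n))\<^sup>2 = (\<psi> m)\<^sup>2 * (\<psi> n)\<^sup>2" "(\<psi> 1)\<^sup>2 = 1" for m n
    using range[of n] by (auto simp: mult power_mult_distrib)
  have B0: "(\<lambda>n. of_real ((\<psi> n)\<^sup>2 * mangoldt n) * of_nat n powr -s) sums (1 / (s - 1) - deriv Z s / Z s)"
    if s: "Re s > 1" for s
  proof -
    have nz: "L0 s \<noteq> 0" by (rule dirichlet_series_log_deriv(1)[OF sq L0s s])
    have "(Z has_field_derivative deriv Z s) (at s)"
      using s by (intro holomorphic_derivI[OF Z(1) S(1)]) auto
    moreover have s1: "s - 1 \<noteq> 0" using s by auto
    ultimately have "(L0 has_field_derivative (deriv Z s * (s - 1) - Z s) / ((s - 1) * (s - 1))) (at s)"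
      unfolding L0_def by (auto intro!: derivative_eq_intros)
    then have "deriv L0 s = (deriv Z s * (s - 1) - Z s) / ((s - 1) * (s - 1))" by (rule DERIV_imp_deriv)
    moreover have "Z s \<noteq> 0" using nz by (auto simp: L0_def)
    ultimately have "- deriv L0 s / L0 s = 1 / (s - 1) - deriv Z s / Z s"
      using s1 by (simp add: L0_def divide_simps)
    then show ?thesis using dirichlet_series_log_deriv(2)[OF sq L0s s] by simp
  qed
  have B1: "(\<lambda>n. of_real (\<psi> n * mangoldt n) * of_nat n powr -s) sums (- (deriv L s / L s))" if s: "Re s > 1" for s
    using dirichlet_series_log_deriv(2)[OF abs_le mult one L_sums s] by simp
  obtain k where k: "((\<lambda>s. (s - (1 + \<i> * of_real t)) * (deriv L s / L s)) \<longlongrightarrow> of_nat k) (at (1 + \<i> * of_real t))"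
    "k \<noteq> 0"
    using log_deriv_at_zero[OF L_holomorphic S, of "1 + \<i> * of_real t" 1] L_nonzero_at_1 L0 by auto
  obtain k2 where k2: "((\<lambda>s. (s - (1 + \<i> * of_real (2 * t))) * (deriv Z s / Z s)) \<longlongrightarrow> of_nat k2) (at (1 + \<i> * of_real (2 * t)))"
    using log_deriv_at_zero[OF Z(1) S, of "1 + \<i> * of_real (2 * t)" 1] Z(2) by auto
  have k0: "((\<lambda>s. (s - (1 + \<i> * of_real 0)) * (deriv Z s / Z s)) \<longlongrightarrow> of_nat 0) (at (1 + \<i> * of_real 0))"
    using log_deriv_at_zero[OF Z(1) S, of "1 + \<i> * of_real 0" 1] Z(2) by auto
  have line: "filterlim (\<lambda>x. of_real (1 + x) + \<i> * of_real u) (at (1 + \<i> * of_real u)) (at_right (0::real))" for u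
  proof -
    have "((\<lambda>x. of_real (1 + x) + \<i> * of_real u) \<longlongrightarrow> of_real (1 + 0) + \<i> * of_real u) (at_right (0::real))"
      by (intro tendsto_intros)
    then show ?thesis
      unfolding filterlim_at by (auto simp: eventually_at_filter)
  qed
  have lin: "of_real (1 + x) + \<i> * of_real u - (1 + \<i> * of_real u) = of_real x" for x u by simp
  have lim1: "((\<lambda>x. of_real x * (deriv L (of_real (1 + x) + \<i> * of_real t) / L (of_real (1 + x) + \<i> * of_real t))) \<longlongrightarrow> of_nat k) (at_right 0)"
    using filterlim_compose[OF k(1) line[of t]] unfolding lin .
  have lim2: "((\<lambda>x. of_real x * (deriv Z (of_real (1 + x) + \<i> * of_real (2 * t)) / Z (of_real (1 + x) + \<i> * of_real (2 * t)))) \<longlongrightarrow> of_nat k2) (at_right 0)"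
    using filterlim_compose[OF k2 line[of "2 * t"]] unfolding lin .
  have lim0: "((\<lambda>x. of_real x * (deriv Z (of_real (1 + x) + \<i> * of_real 0) / Z (of_real (1 + x) + \<i> * of_real 0))) \<longlongrightarrow> of_nat 0) (at_right 0)"
    using filterlim_compose[OF k0 line[of 0]] unfolding lin .
  \<comment> \<open>x times the 3-4-1 expression, with the pole terms simplified so that each
    summand has a limit.\<close>
  define P where "P = (\<lambda>x. 3 * Re (1 - of_real x * (deriv Z (of_real (1 + x) + \<i> * of_real 0) / Z (of_real (1 + x) + \<i> * of_real 0)))
     + 4 * Re (- (of_real x * (deriv L (of_real (1 + x) + \<i> * of_real t) / L (of_real (1 + x) + \<i> * of_real t))))
     + Re (of_real x / (of_real x + \<i> * of_real (2 * t)) - of_real x * (deriv Z (of_real (1 + x) + \<i> * of_real (2 * t)) / Z (of_real (1 + x) + \<i> * of_real (2 * t)))))"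
  have "(P \<longlongrightarrow> 3 * Re (1 - of_nat 0) + 4 * Re (- of_nat k)
      + Re (of_real 0 / (of_real 0 + \<i> * of_real (2 * t)) - of_nat k2)) (at_right 0)"
    unfolding P_def using t by (intro tendsto_intros lim0 lim1 lim2) auto
  moreover have "\<forall>\<^sub>F x in at_right 0. P x \<ge> 0"
  proof (rule eventually_at_rightI[of 0 1])
    fix x :: real assume x: "x \<in> {0<..<1}"
    have e: "0 \<le> x * (3 * Re (1 / (of_real (1 + x) + \<i> * of_real 0 - 1) - deriv Z (of_real (1 + x) + \<i> * of_real 0) / Z (of_real (1 + x) + \<i> * of_real 0))
      + 4 * Re (- (deriv L (of_real (1 + x) + \<i> * of_real t) / L (of_real (1 + x) + \<i> * of_real t)))
      + Re (1 / (of_real (1 + x) + \<i> * of_real (2 * t) - 1) - deriv Z (of_real (1 + x) + \<i> * of_real (2 * t)) / Z (of_real (1 + x) + \<i> * of_real (2 * t))))"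
      using x by (intro mult_nonneg_nonneg mangoldt_three_four_one B0 B1) auto
    have m: "x * Re z = Re (of_real x * z)" for z by simp
    have 1: "of_real x * (1 / (of_real (1 + x) + \<i> * of_real 0 - 1)) = 1" using x by simp
    have 2: "of_real x * (1 / (of_real (1 + x) + \<i> * of_real (2 * t) - 1)) = of_real x / (of_real x + \<i> * of_real (2 * t))" by simp
    show "P x \<ge> 0"
      using e unfolding distrib_left mult.left_commute[of x] m right_diff_distrib 1 2 mult_minus_right P_def .
  qed auto
  ultimately have "0 \<le> 3 * Re (1 - of_nat 0) + 4 * Re (- of_nat k)
      + Re (of_real 0 / (of_real 0 + \<i> * of_real (2 * t)) - of_nat k2)"
    by (intro tendsto_lowerbound[where F = "at_right (0::real)"]) auto
  then have "4 * real k + real k2 \<le> 3" by simp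
  then show False using k(2) by (cases k) auto
qed

lemma L_nonzero: "Re s \<ge> 1 \<Longrightarrow> L s \<noteq> 0"
proof -
  assume s: "Re s \<ge> 1"
  consider "Re s > 1" | "s = 1" | t where "t \<noteq> 0" "s = 1 + \<i> * of_real t"
  proof (cases "Re s > 1")
    case False
    then have "s = 1 + \<i> * of_real (Im s)" using s by (simp add: complex_eq_iff)
    then show ?thesis using that(2,3) by (cases "Im s = 0") auto
  qed (use that in blast)
  then show ?thesis
  proof cases
    case 1
    then show ?thesis using dirichlet_series_log_deriv(1)[OF abs_le mult one L_sums, of s] by auto
  qed (use L_nonzero_at_1 L_nonzero_off_real_axis in auto)
qed

text \<open>Newman's theorem for 1 / L (1 + z). By \<open>L_nonzero\<close> the open set on which L
  (1 + z) does not vanish contains the closed right half-plane.\<close>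

lemma moebius_series_convergent:
  "\<exists>l. (\<lambda>n. \<psi> n * of_int (moebius n) / real n) sums l"
proof -
  define a where "a = (\<lambda>n. complex_of_real (\<psi> n * of_int (moebius n)))"
  define U where "U = {z. Re z > -1 \<and> L (1 + z) \<noteq> 0}"
  define V where "V = {z. Re z > -1}"
  have an: "norm (a n) \<le> 1" for n
    unfolding a_def norm_of_real abs_mult by (rule abs_mult_moebius_le[OF abs_le])
  have V: "open V" unfolding V_def by (rule open_halfspace_Re_gt)
  have hL: "(\<lambda>z. L (1 + z)) holomorphic_on V"
  proof -
    have "(\<lambda>z. 1 + z) holomorphic_on V" by (intro holomorphic_intros)
    moreover have "(\<lambda>z. 1 + z) ` V \<subseteq> {s. Re s > 0}" by (auto simp: V_def)
    ultimately show ?thesis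
      using holomorphic_on_compose_gen[OF _ L_holomorphic, of "\<lambda>z. 1 + z" V] unfolding o_def by blast
  qed
  have "U = V \<inter> (\<lambda>z. L (1 + z)) -` (- {0})" by (auto simp: U_def V_def)
  moreover have "open (V \<inter> (\<lambda>z. L (1 + z)) -` (- {0}))"
    by (rule continuous_open_preimage[OF holomorphic_on_imp_continuous_on[OF hL] V]) auto
  ultimately have U: "open U" by (simp only:)
  have "(\<lambda>n. a (Suc n) / of_nat (Suc n)) sums (1 / L (1 + 0))"
  proof (rule newman_tauberian[OF an _ U])
    show "{z. 0 \<le> Re z} \<subseteq> U" using L_nonzero by (auto simp: U_def)
    show "(\<lambda>z. 1 / L (1 + z)) holomorphic_on U"
      using hL by (intro holomorphic_intros holomorphic_on_subset[OF hL]) (auto simp: U_def V_def)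
    fix z :: complex assume z: "Re z > 0"
    have "(\<lambda>n. a n * of_nat n powr -(1 + z)) sums (1 / L (1 + z))"
      using dirichlet_series_mult_inverse(1)[OF abs_le mult one, of "1 + z"] z unfolding a_def L_def by simp
    then show "(\<lambda>n. a (Suc n) * of_nat (Suc n) powr (-1 - z)) sums (1 / L (1 + z))"
      using sums_Suc_iff[of "\<lambda>n. a n * of_nat n powr -(1 + z)" "1 / L (1 + z)"] by simp
  qed
  from sums_Re[OF this]
  have "(\<lambda>n. Re (a (Suc n) / of_nat (Suc n))) sums Re (1 / L (1 + 0))" .
  moreover have "Re (a n / of_nat n) = \<psi> n * of_int (moebius n) / real n" for n
  proof -
    have "a n / of_nat n = of_real (\<psi> n * of_int (moebius n) / real n)" by (simp add: a_def)
    then show ?thesis by (simp only: Re_complex_of_real)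
  qed
  ultimately have "(\<lambda>n. \<psi> (Suc n) * of_int (moebius (Suc n)) / real (Suc n)) sums Re (1 / L (1 + 0))"
    by (simp only: )
  then show ?thesis
    using sums_Suc_iff[of "\<lambda>n. \<psi> n * of_int (moebius n) / real n"] by auto
qed

end

text \<open>Kronecker's lemma. Summation by parts expresses the partial sums of a through the
  deviations S of the series from its limit. Dividing by n leaves a deviation minus an average of
  deviations.\<close>

lemma convergent_series_imp_mean_zero:
  fixes a :: "nat \<Rightarrow> real"
  assumes "(\<lambda>n. a n / real n) sums l" and a0: "a 0 = 0"
  shows "(\<lambda>n. (\<Sum>k\<le>n. a k) / real n) \<longlonglongrightarrow> 0"
proof (rule LIMSEQ_I)
  fix r :: real assume r: "r > 0"
  define S where "S n = (\<Sum>k<n. a k / real k) - l" for n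
  have S: "S \<longlonglongrightarrow> 0"
    using tendsto_diff[OF assms(1)[unfolded sums_def] tendsto_const[of l]] by (simp add: S_def[abs_def])
  have id: "(\<Sum>k\<le>n. a k) = real n * S (Suc n) - (\<Sum>k<n. S (Suc k)) " for n
  proof (induction n)
    case (Suc n)
    have "S (Suc (Suc n)) = S (Suc n) + a (Suc n) / real (Suc n)" by (simp add: S_def)
    then have "real (Suc n) * S (Suc (Suc n)) = real (Suc n) * S (Suc n) + a (Suc n)"
      by (simp add: field_simps del: of_nat_Suc)
    then show ?case using Suc by (simp add: algebra_simps)
  qed (simp add: a0)
  obtain n0 where n0: "\<And>n. n \<ge> n0 \<Longrightarrow> \<bar>S n\<bar> < r / 4"
    using LIMSEQ_D[OF S, of "r/4"] r by auto
  define C where "C = (\<Sum>k<n0. \<bar>S (Suc k)\<bar>)"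
  have C: "C \<ge> 0" by (auto simp: C_def intro: sum_nonneg)
  obtain n1 where n1: "real n1 > 4 * C / r" using reals_Archimedean2 by blast
  show "\<exists>no. \<forall>n\<ge>no. norm ((\<Sum>k\<le>n. a k) / real n - 0) < r"
  proof (intro exI[of _ "n0 + n1 + 1"] allI impI)
    fix n assume n: "n \<ge> n0 + n1 + 1"
    have "\<bar>\<Sum>k<n. S (Suc k)\<bar> \<le> (\<Sum>k<n. \<bar>S (Suc k)\<bar>)" by (rule sum_abs)
    also have "\<dots> = C + (\<Sum>k\<in>{n0..<n}. \<bar>S (Suc k)\<bar>)"
      unfolding C_def using n by (subst sum.union_disjoint[symmetric]) (auto intro!: sum.cong)
    also have "(\<Sum>k\<in>{n0..<n}. \<bar>S (Suc k)\<bar>) \<le> (\<Sum>k\<in>{n0..<n}. r / 4)"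
      using n0 by (intro sum_mono) (simp add: less_imp_le)
    also have "\<dots> \<le> real n * (r / 4)" using r n by (simp add: mult_right_mono)
    finally have 1: "\<bar>\<Sum>k<n. S (Suc k)\<bar> \<le> C + real n * (r / 4)" by simp
    have "real n1 \<le> real n" using n by simp
    then have "4 * C / r < real n" using n1 by linarith
    then have 2: "C < real n * (r / 4)" using r by (simp add: field_simps)
    have 3: "\<bar>real n * S (Suc n)\<bar> \<le> real n * (r / 4)"
      unfolding abs_mult using n0[of "Suc n"] n by (intro mult_mono) auto
    have "\<bar>\<Sum>k\<le>n. a k\<bar> < real n * r" 
    proof -
      have "real n * r = 4 * (real n * (r / 4))" by simp
      then show ?thesis unfolding id
        using abs_triangle_ineq4[of "real n * S (Suc n)" "\<Sum>k<n. S (Suc k)"] 1 2 3 C by linarith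
    qed
    then show "norm ((\<Sum>k\<le>n. a k) / real n - 0) < r" using n by (simp add: field_simps)
  qed
qed

lemma (in real_character) moebius_mean_zero:
  "(\<lambda>n. (\<Sum>k\<le>n. \<psi> k * of_int (moebius k)) / real n) \<longlonglongrightarrow> 0"
  using moebius_series_convergent by (auto intro!: convergent_series_imp_mean_zero simp: zero)

section \<open>The hyperbola method\<close>

lemma sum_pairs_divisors:
  fixes F :: "nat \<Rightarrow> nat \<Rightarrow> 'a::comm_monoid_add"
  shows "(\<Sum>m\<in>{1..x}. \<Sum>k\<in>{1..x div m}. F m k) = (\<Sum>n\<in>{1..x}. \<Sum>d | d dvd n. F d (n div d))"
proof -
  have "(\<Sum>m\<in>{1..x}. \<Sum>k\<in>{1..x div m}. F m k) = (\<Sum>(m,k)\<in>(SIGMA m:{1..x}. {1..x div m}). F m k)"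
    by (subst sum.Sigma) auto
  also have "\<dots> = (\<Sum>(n,d)\<in>(SIGMA n:{1..x}. {d. d dvd n}). F d (n div d))"
  proof (rule sum.reindex_bij_witness[of _ "\<lambda>(n,d). (d, n div d)" "\<lambda>(m,k). (m * k, m)"])
    fix p assume "p \<in> (SIGMA m:{1..x}. {1..x div m})"
    then obtain m k where p: "p = (m, k)" "1 \<le> m" "m \<le> x" "1 \<le> k" "k \<le> x div m" by auto
    have "m * k \<le> x" using p(2,5) by (simp add: less_eq_div_iff_mult_less_eq mult.commute)
    then show "(case p of (m, k) \<Rightarrow> (m * k, m)) \<in> (SIGMA n:{1..x}. {d. d dvd n})" using p by auto
  next
    fix p assume "p \<in> (SIGMA n:{1..x}. {d. d dvd n})"
    then obtain n d where p: "p = (n, d)" "1 \<le> n" "n \<le> x" "d dvd n" by auto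
    then obtain e where e: "n = d * e" by auto
    have pos: "d > 0" "e > 0" using e p by (auto intro: Nat.gr0I)
    have "d \<le> n" using pos e by simp
    then have "d \<le> x" using p(3) by (rule order_trans)
    then show "(case p of (n, d) \<Rightarrow> (d, n div d)) \<in> (SIGMA m:{1..x}. {1..x div m})"
      using p e pos by (auto simp: less_eq_div_iff_mult_less_eq mult.commute Suc_le_eq)
  qed auto
  also have "\<dots> = (\<Sum>n\<in>{1..x}. \<Sum>d | d dvd n. F d (n div d))"
    by (subst sum.Sigma) auto
  finally show ?thesis .
qed

text \<open>\<open>powr_initial_sum_le\<close> with exponent 1/2 gives y^(-1/2) + 2 * y^(1/2), which
  is at most 3 * sqrt y.\<close>

lemma sum_inverse_sqrt_le: "(\<Sum>m\<in>{1..y}. sqrt (real x / real m)) \<le> 3 * sqrt (real x * real y)"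
proof (cases "y = 0")
  case False
  have half: "(1/2 - 1 :: real) = - (1/2)" by simp
  have t: "sqrt (real x / real m) = sqrt x * real m powr (1/2 - 1)" for m
    unfolding half powr_minus powr_half_sqrt[OF of_nat_0_le_iff] by (simp add: divide_inverse real_sqrt_mult real_sqrt_inverse)
  have "(\<Sum>m\<in>{1..y}. sqrt (real x / real m)) = (\<Sum>n<y. sqrt (real x / real (Suc n)))"
    by (rule sum.reindex_bij_witness[of _ Suc "\<lambda>n. n - 1"]) auto
  also have "\<dots> = sqrt x * (\<Sum>n<y. real (Suc n) powr (1/2 - 1))"
    unfolding t sum_distrib_left ..
  also have "\<dots> \<le> sqrt x * (real y powr (1/2 - 1) + real y powr (1/2) / (1/2))"
    using False by (intro mult_left_mono powr_initial_sum_le) auto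
  also have "real y powr (1/2 - 1) \<le> real y powr (1/2)" using False by (intro powr_mono) auto
  also have "real y powr (1/2) + real y powr (1/2) / (1/2) = 3 * sqrt y" by (simp add: powr_half_sqrt)
  finally show ?thesis by (simp add: real_sqrt_mult mult_left_mono)
qed auto

context real_character
begin

definition log_sum :: "nat \<Rightarrow> real" where "log_sum x = (\<Sum>k\<in>{1..x}. \<psi> k * ln k)"
definition mangoldt_sum_upto :: "nat \<Rightarrow> real" where "mangoldt_sum_upto x = (\<Sum>k\<in>{1..x}. \<psi> k * mangoldt k)"
definition moebius_sum :: "nat \<Rightarrow> real" where "moebius_sum x = (\<Sum>k\<in>{1..x}. \<psi> k * of_int (moebius k))"

text \<open>The identity ln = 1 * \<open>mangoldt\<close> of Dirichlet convolution, twisted by the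
  completely multiplicative \<open>\<psi>\<close> and summed up to x.\<close>

lemma log_sum_conv: "log_sum x = (\<Sum>m\<in>{1..x}. \<psi> m * mangoldt_sum_upto (x div m))"
proof -
  have "(\<Sum>m\<in>{1..x}. \<psi> m * mangoldt_sum_upto (x div m)) = (\<Sum>m\<in>{1..x}. \<Sum>k\<in>{1..x div m}. \<psi> m * (\<psi> k * mangoldt k))"
    by (simp add: mangoldt_sum_upto_def sum_distrib_left)
  also have "\<dots> = (\<Sum>k\<in>{1..x}. \<Sum>m\<in>{1..x div k}. \<psi> m * (\<psi> k * mangoldt k))"
  proof -
    have s: "(SIGMA m:{1..x}. {1..x div m}) = {(m,k). 1 \<le> m \<and> 1 \<le> k \<and> m * k \<le> x}"
      by (auto simp: less_eq_div_iff_mult_less_eq mult.commute Suc_le_eq)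
        (metis One_nat_def Suc_leI dual_order.trans mult.commute mult_le_mono2 nat_mult_1_right)
    have "(\<Sum>m\<in>{1..x}. \<Sum>k\<in>{1..x div m}. H m k) = (\<Sum>(m,k)\<in>{(m,k). 1 \<le> m \<and> 1 \<le> k \<and> m * k \<le> x}. H m k)" for H :: "nat \<Rightarrow> nat \<Rightarrow> real"
      unfolding s[symmetric] by (rule sum.Sigma) auto
    note conv = this
    show ?thesis unfolding conv
      by (rule sum.reindex_bij_witness[of _ "\<lambda>(a,b). (b,a)" "\<lambda>(a,b). (b,a)"]) (auto simp: mult.commute)
  qed
  also have "\<dots> = (\<Sum>n\<in>{1..x}. \<Sum>d | d dvd n. \<psi> (n div d) * (\<psi> d * mangoldt d))"
    by (rule sum_pairs_divisors)
  also have "\<dots> = (\<Sum>n\<in>{1..x}. \<psi> n * ln n)"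
  proof (intro sum.cong refl)
    fix n assume n: "n \<in> {1..x}"
    have "(\<Sum>d | d dvd n. \<psi> (n div d) * (\<psi> d * mangoldt d)) = (\<Sum>d | d dvd n. \<psi> n * mangoldt d)"
    proof (intro sum.cong refl)
      fix d assume "d \<in> {d. d dvd n}"
      then have "\<psi> (n div d) * \<psi> d = \<psi> n" using mult[of "n div d" d] by simp
      then show "\<psi> (n div d) * (\<psi> d * mangoldt d) = \<psi> n * mangoldt d" by (metis mult.assoc)
    qed
    also have "\<dots> = \<psi> n * (\<Sum>d | d dvd n. mangoldt d)" by (rule sum_distrib_left[symmetric])
    also have "(\<Sum>d | d dvd n. mangoldt d :: real) = ln n" using mangoldt_sum[of n, where ?'a = real] n by simp
    finally show "(\<Sum>d | d dvd n. \<psi> (n div d) * (\<psi> d * mangoldt d)) = \<psi> n * ln n" .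
  qed
  finally show ?thesis by (simp add: log_sum_def)
qed

text \<open>Moebius inversion of \<open>log_sum_conv\<close>: iterated floors combine to x div (m *
  k), and for fixed product n the sum of \<open>moebius\<close> survives only at n = 1.\<close>

lemma mangoldt_sum_conv:
  "mangoldt_sum_upto x = (\<Sum>m\<in>{1..x}. \<psi> m * of_int (moebius m) * log_sum (x div m))"
proof -
  have "(\<Sum>m\<in>{1..x}. \<psi> m * of_int (moebius m) * log_sum (x div m))
      = (\<Sum>m\<in>{1..x}. \<Sum>k\<in>{1..x div m}. \<psi> (m * k) * of_int (moebius m) * mangoldt_sum_upto (x div (m * k)))"
    unfolding log_sum_conv sum_distrib_left by (intro sum.cong refl) (simp add: mult mult_ac div_mult2_eq)
  also have "\<dots> = (\<Sum>n\<in>{1..x}. \<Sum>d | d dvd n. \<psi> (d * (n div d)) * of_int (moebius d) * mangoldt_sum_upto (x div (d * (n div d))))"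
    by (rule sum_pairs_divisors)
  also have "\<dots> = (\<Sum>n\<in>{1..x}. if n = 1 then mangoldt_sum_upto x else 0)"
  proof (intro sum.cong refl)
    fix n assume n: "n \<in> {1..x}"
    have "(\<Sum>d | d dvd n. \<psi> (d * (n div d)) * of_int (moebius d) * mangoldt_sum_upto (x div (d * (n div d))))
        = (\<Sum>d | d dvd n. \<psi> n * mangoldt_sum_upto (x div n) * of_int (moebius d))"
      by (intro sum.cong refl) auto
    also have "\<dots> = \<psi> n * mangoldt_sum_upto (x div n) * of_int (\<Sum>d | d dvd n. moebius d)"
      by (simp add: sum_distrib_left)
    also have "\<dots> = (if n = 1 then mangoldt_sum_upto x else 0)" using n by (simp add: sum_moebius_divisors)
    finally show "(\<Sum>d | d dvd n. \<psi> (d * (n div d)) * of_int (moebius d) * mangoldt_sum_upto (x div (d * (n div d))))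
        = (if n = 1 then mangoldt_sum_upto x else 0)" .
  qed
  also have "\<dots> = mangoldt_sum_upto x" by (cases "x = 0") (auto simp: mangoldt_sum_upto_def)
  finally show ?thesis by simp
qed

text \<open>Summation by parts against bounded character sums gives 2K * ln (y+1). The weaker square
  root is the form that \<open>sum_inverse_sqrt_le\<close> can sum.\<close>

lemma log_sum_bound: "\<exists>C\<ge>0. \<forall>y. \<bar>log_sum y\<bar> \<le> C * sqrt y"
proof -
  obtain K where K: "\<And>n. \<bar>\<Sum>k\<le>n. \<psi> k\<bar> \<le> K" using partial_sums_bounded by blast
  have K0: "K \<ge> 0" using K[of 0] by linarith
  have "\<bar>log_sum y\<bar> \<le> (2 * K * 4) * sqrt y" for y
  proof (cases "y = 0")
    case False
    have "log_sum y = (\<Sum>k<Suc y. \<psi> k * ln k)"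
      unfolding log_sum_def by (rule sum.mono_neutral_left) (auto simp: not_le Suc_le_eq)
    also have "\<dots> = (\<Sum>n<Suc y. (\<Sum>k\<le>n. \<psi> k) * (ln (real n) - ln (real (Suc n)))) + (\<Sum>k\<le>y. \<psi> k) * ln (real (Suc y))"
      using abel_partial_sums[of \<psi> "\<lambda>n. ln (real n)" y] .
    finally have "\<bar>log_sum y\<bar> \<le> \<bar>\<Sum>n<Suc y. (\<Sum>k\<le>n. \<psi> k) * (ln (real n) - ln (real (Suc n)))\<bar> + \<bar>(\<Sum>k\<le>y. \<psi> k) * ln (real (Suc y))\<bar>"
      by linarith
    also have "\<bar>\<Sum>n<Suc y. (\<Sum>k\<le>n. \<psi> k) * (ln (real n) - ln (real (Suc n)))\<bar> \<le> (\<Sum>n<Suc y. K * (ln (real (Suc n)) - ln (real n)))"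
    proof (rule order_trans[OF sum_abs], rule sum_mono)
      fix n
      have "ln (real n) \<le> ln (real (Suc n))" by (cases "n = 0") auto
      then have "\<bar>ln (real n) - ln (real (Suc n))\<bar> = ln (real (Suc n)) - ln (real n)" by linarith
      then show "\<bar>(\<Sum>k\<le>n. \<psi> k) * (ln (real n) - ln (real (Suc n)))\<bar> \<le> K * (ln (real (Suc n)) - ln (real n))"
        unfolding abs_mult using K[of n] by (metis abs_ge_zero mult_right_mono)
    qed
    also have "\<dots> = K * (\<Sum>n<Suc y. ln (real (Suc n)) - ln (real n))" by (rule sum_distrib_left[symmetric])
    \<comment> \<open>The default value \<open>ln 0 = 0\<close> makes this total just
      \<open>ln (real (Suc y))\<close>.\<close>
    also have "(\<Sum>n<Suc y. ln (real (Suc n)) - ln (real n)) = ln (real (Suc y)) - ln (real 0)"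
      by (rule sum_lessThan_telescope)
    also have "\<bar>(\<Sum>k\<le>y. \<psi> k) * ln (real (Suc y))\<bar> \<le> K * ln (real (Suc y))"
      unfolding abs_mult using K[of y] by (intro mult_mono) auto
    finally have "\<bar>log_sum y\<bar> \<le> 2 * K * ln (real (Suc y))" by simp
    also have "ln (real (Suc y)) \<le> real (Suc y) powr (1/2) / (1/2)" by (rule ln_powr_bound) auto
    also have "\<dots> \<le> 4 * sqrt y"
    proof -
      have "sqrt (real (Suc y)) \<le> sqrt (4 * real y)" using False by (intro real_sqrt_le_mono) auto
      then show ?thesis by (simp add: powr_half_sqrt real_sqrt_mult)
    qed
    finally show ?thesis using K0 by (simp add: mult_left_mono)
  qed (simp add: log_sum_def)
  then show ?thesis using K0 by (intro exI[of _ "2 * K * 4"]) auto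
qed

text \<open>Dirichlet's hyperbola method, applied to \<open>\<psi>\<Lambda> = \<psi>\<mu> * \<psi> log\<close> with cutoff \<open>x div Y\<close>.\<close>
lemma mangoldt_sum_split:
  assumes Y: "Y > 0"
  shows "mangoldt_sum_upto x = (\<Sum>m\<in>{1..x div Y}. \<psi> m * of_int (moebius m) * log_sum (x div m))
     + (\<Sum>b\<in>{1..Y}. \<psi> b * ln b * (moebius_sum (x div b) - moebius_sum (x div Y)))"
proof -
  define u where "u = (\<lambda>m. \<psi> m * of_int (moebius m))"
  define X where "X = x div Y"
  have Xx: "X \<le> x" by (simp add: X_def)
  have "mangoldt_sum_upto x = (\<Sum>m\<in>{1..X}. u m * log_sum (x div m)) + (\<Sum>m\<in>{X+1..x}. u m * log_sum (x div m))"
    unfolding mangoldt_sum_conv u_def using Xx by (subst sum.union_disjoint[symmetric]) (auto intro!: sum.cong)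
  also have "(\<Sum>m\<in>{X+1..x}. u m * log_sum (x div m)) = (\<Sum>m\<in>{X+1..x}. \<Sum>b\<in>{1..x div m}. u m * (\<psi> b * ln b))"
    by (simp add: log_sum_def sum_distrib_left)
  also have "\<dots> = (\<Sum>(m,b)\<in>(SIGMA m:{X+1..x}. {1..x div m}). u m * (\<psi> b * ln b))"
    by (subst sum.Sigma) auto
  also have "\<dots> = (\<Sum>(b,m)\<in>(SIGMA b:{1..Y}. {X+1..x div b}). u m * (\<psi> b * ln b))"
  proof (rule sum.reindex_bij_witness[of _ "\<lambda>(a,b). (b,a)" "\<lambda>(a,b). (b,a)"])
    fix p assume "p \<in> (SIGMA m:{X+1..x}. {1..x div m})"
    then obtain m b where p: "p = (m, b)" "X + 1 \<le> m" "m \<le> x" "1 \<le> b" "b \<le> x div m" by auto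
    have bm: "b * m \<le> x" using p by (simp add: less_eq_div_iff_mult_less_eq)
    then have mb: "m \<le> x div b" using p by (simp add: less_eq_div_iff_mult_less_eq mult.commute)
    have "b \<le> Y"
    proof (rule ccontr)
      assume "\<not> b \<le> Y"
      then have "x div b \<le> x div Y" using Y by (intro div_le_mono2) auto
      then show False using mb p(2) by (simp add: X_def)
    qed
    then show "(case p of (a, b) \<Rightarrow> (b, a)) \<in> (SIGMA b:{1..Y}. {X+1..x div b})" using p mb by auto
  next
    fix p assume "p \<in> (SIGMA b:{1..Y}. {X+1..x div b})"
    then obtain m b where p: "p = (b, m)" "X + 1 \<le> m" "1 \<le> b" "m \<le> x div b" by auto
    have "m * b \<le> x" using p by (simp add: less_eq_div_iff_mult_less_eq)
    then have "b \<le> x div m" using p by (simp add: less_eq_div_iff_mult_less_eq mult.commute)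
    moreover have "m \<le> x" using p(4) div_le_dividend[of x b] by linarith
    ultimately show "(case p of (a, b) \<Rightarrow> (b, a)) \<in> (SIGMA m:{X+1..x}. {1..x div m})" using p by auto
  qed auto
  also have "\<dots> = (\<Sum>b\<in>{1..Y}. \<Sum>m\<in>{X+1..x div b}. u m * (\<psi> b * ln b))"
    by (subst sum.Sigma) auto
  also have "\<dots> = (\<Sum>b\<in>{1..Y}. \<psi> b * ln b * (moebius_sum (x div b) - moebius_sum X))"
  proof (intro sum.cong refl)
    fix b assume b: "b \<in> {1..Y}"
    have Xb: "X \<le> x div b" unfolding X_def using b by (intro div_le_mono2) auto
    have "moebius_sum (x div b) = moebius_sum X + (\<Sum>m\<in>{X+1..x div b}. u m)"
      unfolding moebius_sum_def u_def using Xb by (subst sum.union_disjoint[symmetric]) (auto intro!: sum.cong)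
    then show "(\<Sum>m\<in>{X+1..x div b}. u m * (\<psi> b * ln b)) = \<psi> b * ln b * (moebius_sum (x div b) - moebius_sum X)"
      by (simp add: sum_distrib_right[symmetric])
  qed
  finally show ?thesis unfolding X_def u_def .
qed

lemma moebius_sum_div_tendsto:
  assumes b: "b > 0"
  shows "(\<lambda>x. moebius_sum (x div b) / real x) \<longlonglongrightarrow> 0"
proof -
  have "moebius_sum n = (\<Sum>k\<le>n. \<psi> k * of_int (moebius k))" for n
    unfolding moebius_sum_def by (rule sum.mono_neutral_left) (auto simp: zero not_le Suc_le_eq)
  then have "(\<lambda>n. moebius_sum n / real n) \<longlonglongrightarrow> 0" using moebius_mean_zero by simp
  moreover have "filterlim (\<lambda>x. x div b) at_top sequentially"
    by (rule filterlim_at_top_div_const_nat) (use b in auto)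
  ultimately have lim: "(\<lambda>x. moebius_sum (x div b) / real (x div b)) \<longlonglongrightarrow> 0"
    by (rule filterlim_compose)
  show ?thesis
  proof (rule Lim_null_comparison[OF _ tendsto_rabs_zero[OF lim]], rule always_eventually, rule allI)
    fix x
    show "norm (moebius_sum (x div b) / real x) \<le> \<bar>moebius_sum (x div b) / real (x div b)\<bar>"
    proof (cases "x div b = 0")
      case True then show ?thesis by (simp add: moebius_sum_def)
    next
      case False
      then have "real (x div b) \<le> real x" "real (x div b) > 0" by (auto simp del: div_eq_0_iff)
      then show ?thesis by (simp add: frac_le)
    qed
  qed
qed

text \<open>In \<open>mangoldt_sum_split\<close> the first part is at most x * 3C / sqrt Y,
  uniformly in x. Once Y is fixed, the second is a sum of fixed length whose terms are o(x) by the
  mean value of \<open>\<psi> n * moebius n\<close>.\<close>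

lemma mangoldt_mean_zero: "(\<lambda>x. mangoldt_sum_upto x / real x) \<longlonglongrightarrow> 0"
proof (rule LIMSEQ_I)
  fix r :: real assume r: "r > 0"
  obtain C where C: "C \<ge> 0" "\<And>y. \<bar>log_sum y\<bar> \<le> C * sqrt y" using log_sum_bound by blast
  obtain Y :: nat where Y: "real Y > max 1 ((6 * C / r)\<^sup>2)" using reals_Archimedean2 by blast
  have Y0: "Y > 0" using Y by (auto intro: Nat.gr0I)
  have CY: "3 * C / sqrt Y < r / 2"
  proof -
    have "sqrt ((6 * C / r)\<^sup>2) < sqrt Y" using Y by (intro real_sqrt_less_mono) auto
    then have "6 * C / r < sqrt Y" using C r by simp
    then show ?thesis using r Y0 by (simp add: field_simps)
  qed
  have "(\<lambda>x. \<Sum>b\<in>{1..Y}. \<psi> b * ln b * (moebius_sum (x div b) / real x - moebius_sum (x div Y) / real x)) \<longlonglongrightarrow> (\<Sum>b\<in>{1..Y}. \<psi> b * ln b * (0 - 0))"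
    using Y0 by (intro tendsto_sum tendsto_mult tendsto_diff tendsto_const moebius_sum_div_tendsto) auto
  then have "(\<lambda>x. \<Sum>b\<in>{1..Y}. \<psi> b * ln b * (moebius_sum (x div b) / real x - moebius_sum (x div Y) / real x)) \<longlonglongrightarrow> 0"
    by simp
  from LIMSEQ_D[OF this, of "r/2"] r
  obtain n0 where n0: "\<And>x. x \<ge> n0 \<Longrightarrow> \<bar>\<Sum>b\<in>{1..Y}. \<psi> b * ln b * (moebius_sum (x div b) / real x - moebius_sum (x div Y) / real x)\<bar> < r / 2"
    by auto
  show "\<exists>no. \<forall>x\<ge>no. norm (mangoldt_sum_upto x / real x - 0) < r"
  proof (intro exI[of _ "n0 + 1"] allI impI)
    fix x assume x: "x \<ge> n0 + 1"
    have x0: "real x > 0" using x by simp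
    have "\<bar>\<Sum>m\<in>{1..x div Y}. \<psi> m * of_int (moebius m) * log_sum (x div m)\<bar> \<le> (\<Sum>m\<in>{1..x div Y}. C * sqrt (real x / real m))"
    proof (rule order_trans[OF sum_abs], rule sum_mono)
      fix m assume m: "m \<in> {1..x div Y}"
      have "\<bar>\<psi> m\<bar> * \<bar>of_int (moebius m)\<bar> \<le> 1" by (rule abs_mult_moebius_le[OF abs_le])
      moreover have "\<bar>log_sum (x div m)\<bar> \<le> C * sqrt (real x / real m)"
      proof (rule order_trans[OF C(2)])
        have "real (x div m) \<le> real x / real m" by (rule of_nat_div_le_of_nat)
        then show "C * sqrt (real (x div m)) \<le> C * sqrt (real x / real m)" using C(1) by (intro mult_left_mono) auto
      qed
      ultimately have "(\<bar>\<psi> m\<bar> * \<bar>of_int (moebius m)\<bar>) * \<bar>log_sum (x div m)\<bar> \<le> 1 * (C * sqrt (real x / real m))"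
        by (rule mult_mono) auto
      then show "\<bar>\<psi> m * of_int (moebius m) * log_sum (x div m)\<bar> \<le> C * sqrt (real x / real m)"
        by (simp add: abs_mult)
    qed
    also have "\<dots> = C * (\<Sum>m\<in>{1..x div Y}. sqrt (real x / real m))" by (rule sum_distrib_left[symmetric])
    also have "\<dots> \<le> C * (3 * sqrt (real x * real (x div Y)))"
      by (rule mult_left_mono[OF sum_inverse_sqrt_le C(1)])
    also have "\<dots> \<le> C * (3 * sqrt (real x * (real x / real Y)))"
      using C(1) by (intro mult_left_mono real_sqrt_le_mono of_nat_div_le_of_nat) auto
    also have "sqrt (real x * (real x / real Y)) = real x / sqrt Y"
      by (simp add: real_sqrt_divide real_sqrt_mult)
    finally have 1: "\<bar>\<Sum>m\<in>{1..x div Y}. \<psi> m * of_int (moebius m) * log_sum (x div m)\<bar> \<le> real x * (3 * C / sqrt Y)"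
      by (simp add: mult_ac)
    have "(\<Sum>b\<in>{1..Y}. \<psi> b * ln b * (moebius_sum (x div b) - moebius_sum (x div Y)))
      = real x * (\<Sum>b\<in>{1..Y}. \<psi> b * ln b * (moebius_sum (x div b) / real x - moebius_sum (x div Y) / real x))"
      unfolding sum_distrib_left using x0 by (intro sum.cong refl) (simp add: field_simps)
    then have "\<bar>\<Sum>b\<in>{1..Y}. \<psi> b * ln b * (moebius_sum (x div b) - moebius_sum (x div Y))\<bar> \<le> real x * (r / 2)"
      using n0[of x] x x0 by (simp only: abs_mult) (auto intro!: mult_left_mono less_imp_le)
    moreover have "real x * (3 * C / sqrt Y) < real x * (r / 2)" using CY x0 by (intro mult_strict_left_mono)
    ultimately have "\<bar>mangoldt_sum_upto x\<bar> < real x * (r / 2) + real x * (r / 2)"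
      using 1 unfolding mangoldt_sum_split[OF Y0, of x] by linarith
    then show "norm (mangoldt_sum_upto x / real x - 0) < r" using x0 by (simp add: field_simps)
  qed
qed

end

section \<open>Chebyshev estimates and prime sums\<close>

definition chebyshev_psi :: "nat \<Rightarrow> real" where
  "chebyshev_psi n = (\<Sum>k\<in>{1..n}. mangoldt k)"

definition primes_upto :: "nat \<Rightarrow> nat set" where
  "primes_upto n = {p. prime p \<and> p \<le> n}"

abbreviation (input) prime_count :: "nat \<Rightarrow> real" where
  "prime_count x \<equiv> real (card (primes_upto x))"

lemma finite_primes_upto [simp]: "finite (primes_upto n)"
  by (rule finite_subset[of _ "{..n}"]) (auto simp: primes_upto_def)

lemma ln_fact_eq_mangoldt_sum: "ln (fact n) = (\<Sum>d\<in>{1..n}. mangoldt d * real (n div d))"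
proof -
  have "ln (fact n :: real) = (\<Sum>k\<in>{1..n}. ln (real k))"
    unfolding fact_prod of_nat_prod by (subst ln_prod) auto
  also have "\<dots> = (\<Sum>k\<in>{1..n}. \<Sum>d | d dvd k. mangoldt d)"
    by (intro sum.cong refl) (use mangoldt_sum[where ?'a = real] in auto)
  also have "\<dots> = (\<Sum>d\<in>{1..n}. \<Sum>k\<in>{1..n div d}. mangoldt d)"
    by (rule sum_pairs_divisors[symmetric])
  finally show ?thesis by (simp add: mult.commute)
qed

text \<open>The logarithm of the central binomial coefficient weights \<open>mangoldt d\<close> by
  (2n div d) - 2 (n div d), which is 0 or 1 for every d and equals 1 for n < d <= 2n.\<close>

lemma chebyshev_binomial:
  "chebyshev_psi (2 * n) - chebyshev_psi n \<le> ln (real ((2 * n) choose n))"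
  "ln (real ((2 * n) choose n)) \<le> chebyshev_psi (2 * n)"
proof -
  define c where "c = (\<lambda>d. real ((2 * n) div d) - 2 * real (n div d))"
  have c: "0 \<le> c d" "c d \<le> 1" for d
  proof -
    have "2 * (n div d) \<le> (2 * n) div d \<and> (2 * n) div d \<le> 2 * (n div d) + 1"
    proof (cases "d = 0")
      case False
      have e: "n = n div d * d + n mod d" by simp
      have "2 * (n div d) * d \<le> 2 * n" using e by linarith
      then have "2 * (n div d) \<le> (2 * n) div d" using False by (simp add: less_eq_div_iff_mult_less_eq)
      moreover have "2 * n < (2 * (n div d) + 2) * d"
      proof -
        have "(2 * (n div d) + 2) * d = 2 * (n div d * d) + 2 * d" by (simp add: algebra_simps)
        then show ?thesis using e mod_less_divisor[of d n] False by linarith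
      qed
      then have "(2 * n) div d < 2 * (n div d) + 2" using False by (simp add: div_less_iff_less_mult)
      ultimately show ?thesis by linarith
    qed simp
    then have "2 * (n div d) \<le> (2 * n) div d" "(2 * n) div d \<le> 2 * (n div d) + 1" by auto
    then show "0 \<le> c d" "c d \<le> 1" unfolding c_def by linarith+
  qed
  have "ln (real ((2 * n) choose n)) = ln (fact (2 * n)) - 2 * ln (fact n)"
  proof -
    have b: "real ((2 * n) choose n) = fact (2 * n) / (fact n * fact n)"
      using binomial_fact[of n "2 * n", where ?'a = real] by simp
    show ?thesis unfolding b by (simp add: ln_divide_pos ln_mult_pos)
  qed
  also have "ln (fact n) = (\<Sum>d\<in>{1..2*n}. mangoldt d * real (n div d))"
    unfolding ln_fact_eq_mangoldt_sum by (rule sum.mono_neutral_left) auto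
  finally have L: "ln (real ((2 * n) choose n)) = (\<Sum>d\<in>{1..2*n}. mangoldt d * c d)"
    by (simp add: ln_fact_eq_mangoldt_sum c_def sum_subtractf algebra_simps sum_distrib_left)
  have "chebyshev_psi (2 * n) - chebyshev_psi n = (\<Sum>d\<in>{n+1..2*n}. mangoldt d)"
    unfolding chebyshev_psi_def mult_2 by (subst sum.ub_add_nat) auto
  also have "\<dots> \<le> (\<Sum>d\<in>{n+1..2*n}. mangoldt d * c d)"
  proof (intro sum_mono)
    fix d assume d: "d \<in> {n+1..2*n}"
    then have "(2 * n) div d \<ge> 1" "n div d = 0" by (auto simp: less_eq_div_iff_mult_less_eq)
    then have "1 \<le> c d" unfolding c_def by simp
    then show "mangoldt d \<le> mangoldt d * c d" using mangoldt_nonneg[of d] by (metis mult.right_neutral mult_left_mono)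
  qed
  also have "\<dots> \<le> (\<Sum>d\<in>{1..2*n}. mangoldt d * c d)"
    by (intro sum_mono2) (auto intro!: mult_nonneg_nonneg mangoldt_nonneg c)
  finally show "chebyshev_psi (2 * n) - chebyshev_psi n \<le> ln (real ((2 * n) choose n))" unfolding L .
  show "ln (real ((2 * n) choose n)) \<le> chebyshev_psi (2 * n)"
    unfolding L chebyshev_psi_def using c mangoldt_nonneg by (intro sum_mono) (simp add: mult_left_le)
qed

lemma chebyshev_psi_mono: "m \<le> n \<Longrightarrow> chebyshev_psi m \<le> chebyshev_psi n"
  unfolding chebyshev_psi_def by (intro sum_mono2) (auto intro: mangoldt_nonneg)

text \<open>Chebyshev's halving: the step from m to 2m costs at most 2m * ln 2 < 2m, as the central
  binomial coefficient is at most 4^m.\<close>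

lemma chebyshev_psi_le: "chebyshev_psi n \<le> 4 * real n"
proof (induction n rule: less_induct)
  case (less n)
  have up: "chebyshev_psi (2 * m) \<le> chebyshev_psi m + 2 * real m" for m
  proof -
    have "(2 * m) choose m \<le> 2 ^ (2 * m)" by (rule binomial_le_pow2)
    then have "real ((2 * m) choose m) \<le> 2 ^ (2 * m)" by (metis of_nat_le_iff of_nat_numeral of_nat_power)
    then have "ln (real ((2 * m) choose m)) \<le> ln (2 ^ (2 * m))"
      by (subst ln_le_cancel_iff) auto
    also have "\<dots> = real (2 * m) * ln 2" by (simp add: ln_realpow)
    also have "\<dots> \<le> real (2 * m) * 1" using ln_2_less_1 by (intro mult_left_mono) auto
    finally show ?thesis using chebyshev_binomial(1)[of m] by simp
  qed
  \<comment> \<open>An odd n is rounded up to 2(m+1). The side condition means m >= 1, which is what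
    6(m+1) <= 4(2m+1) requires.\<close>
  consider "n \<le> 1" | m where "n = 2 * m" "m < n" | m where "n = 2 * m + 1" "m + 1 < n"
  proof (cases "n \<le> 1")
    case False
    show ?thesis
    proof (cases "even n")
      case True
      then obtain m where "n = 2 * m" by (elim evenE)
      then show ?thesis using that(2)[of m] False by auto
    next
      case odd: False
      then obtain m where "n = 2 * m + 1" by (elim oddE)
      then show ?thesis using that(3)[of m] False by auto
    qed
  qed (use that in blast)
  then show ?case
  proof cases
    case 1 then have "n = 0 \<or> n = 1" by linarith
    then show ?thesis by (auto simp: chebyshev_psi_def)
  next
    case 2 then show ?thesis using less.IH[of m] up[of m] by simp
  next
    case 3
    then have "chebyshev_psi n \<le> chebyshev_psi (2 * (m + 1))" by (intro chebyshev_psi_mono) auto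
    then show ?thesis using less.IH[of "m+1"] up[of "m+1"] 3 by simp
  qed
qed

text \<open>The central binomial coefficient is at least 2^m with m = n div 2. The 6 comes from ln 2
  >= 1/2 and n <= 3m.\<close>

lemma chebyshev_psi_ge: "real n / 6 \<le> chebyshev_psi n" if "n \<ge> 2"
proof -
  define m where "m = n div 2"
  have m: "m \<ge> 1" "2 * m \<le> n" "n \<le> 2 * m + 1" using that by (auto simp: m_def)
  have "(real (2 * m) / real m) ^ m \<le> real ((2 * m) choose m)"
    by (rule binomial_ge_n_over_k_pow_k) auto
  then have "2 ^ m \<le> real ((2 * m) choose m)" using m by simp
  then have "ln (2 ^ m) \<le> ln (real ((2 * m) choose m))" by (subst ln_le_cancel_iff) (auto simp: zero_less_binomial)
  also have "\<dots> \<le> chebyshev_psi (2 * m)" by (rule chebyshev_binomial(2))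
  also have "\<dots> \<le> chebyshev_psi n" by (rule chebyshev_psi_mono[OF m(2)])
  finally have "real m * ln 2 \<le> chebyshev_psi n" by (simp add: ln_realpow)
  moreover have "real m * (1/2) \<le> real m * ln 2" using ln2_ge_two_thirds by (intro mult_left_mono) auto
  moreover have "real n \<le> 3 * real m" using m by linarith
  ultimately show ?thesis by linarith
qed

text \<open>Counting: p^e <= x with e >= 2 forces p <= sqrt x and e <= 2 * ln x (from ln 2 >= 1/2),
  and each such power weighs at most ln x.\<close>

lemma proper_prime_powers_sum_le:
  assumes x: "x \<ge> 1"
  shows "(\<Sum>k\<in>{1..x} - primes_upto x. mangoldt k) \<le> (sqrt x + 1) * (2 * ln x + 1) * ln x"
proof -
  define A where "A = {k \<in> {1..x} - primes_upto x. primepow k}"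
  define a where "a = nat \<lfloor>sqrt x\<rfloor>"
  define b where "b = nat \<lfloor>2 * ln x\<rfloor>"
  have sub: "A \<subseteq> (\<lambda>(p,e). p ^ e) ` ({..a} \<times> {..b})"
  proof
    fix k assume k: "k \<in> A"
    then obtain p e where pe: "prime p" "e > 0" "k = p ^ e" by (auto simp: A_def primepow_def)
    have "e \<noteq> 1" using k pe by (auto simp: A_def primes_upto_def)
    then have e: "e \<ge> 2" using pe by simp
    have kx: "k \<le> x" using k by (auto simp: A_def)
    have "p ^ 2 \<le> p ^ e" using e pe(1) prime_ge_1_nat by (intro power_increasing) auto
    then have "real (p ^ 2) \<le> real x" using kx pe(3) by linarith
    then have "(real p)\<^sup>2 \<le> real x" by simp
    then have "real p \<le> sqrt x" by (rule real_le_rsqrt)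
    then have "p \<le> a" unfolding a_def by (simp add: le_nat_floor)
    have "2 ^ e \<le> p ^ e" using prime_ge_2_nat[OF pe(1)] by (intro power_mono) auto
    then have "real (2 ^ e) \<le> real x" using kx pe(3) by linarith
    then have "ln (2 ^ e) \<le> ln (real x)" using x by (subst ln_le_cancel_iff) auto
    then have "real e * ln 2 \<le> ln x" by (simp add: ln_realpow)
    moreover have "real e * (1/2) \<le> real e * ln 2" using ln2_ge_two_thirds by (intro mult_left_mono) auto
    ultimately have "real e \<le> 2 * ln x" by linarith
    then have "e \<le> b" unfolding b_def by (simp add: le_nat_floor)
    then show "k \<in> (\<lambda>(p,e). p ^ e) ` ({..a} \<times> {..b})" using \<open>p \<le> a\<close> pe(3) by auto
  qed
  have "card A \<le> card ((\<lambda>(p::nat,e). p ^ e) ` ({..a} \<times> {..b}))" using sub by (intro card_mono) auto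
  also have "\<dots> \<le> card ({..a} \<times> {..b})" by (intro card_image_le) auto
  also have "\<dots> = (a + 1) * (b + 1)" by simp
  finally have "real (card A) \<le> real ((a + 1) * (b + 1))" by (simp only: of_nat_le_iff)
  also have "\<dots> = (real a + 1) * (real b + 1)" by (simp add: algebra_simps)
  also have "\<dots> \<le> (sqrt x + 1) * (2 * ln x + 1)"
    using x by (intro mult_mono add_mono) (auto simp: a_def b_def)
  finally have cA: "real (card A) \<le> (sqrt x + 1) * (2 * ln x + 1)" .
  have "(\<Sum>k\<in>{1..x} - primes_upto x. mangoldt k) = (\<Sum>k\<in>A. mangoldt k :: real)"
    unfolding A_def by (rule sum.mono_neutral_right) (auto simp: mangoldt_def)
  also have "\<dots> \<le> (\<Sum>k\<in>A. ln x)"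
  proof (rule sum_mono)
    fix k assume "k \<in> A"
    then have k: "1 \<le> k" "k \<le> x" by (auto simp: A_def)
    have "mangoldt k \<le> ln (real k)" using k by (intro mangoldt_le) auto
    also have "\<dots> \<le> ln x" using k by simp
    finally show "mangoldt k \<le> ln x" .
  qed
  also have "\<dots> = real (card A) * ln x" by simp
  also have "\<dots> \<le> (sqrt x + 1) * (2 * ln x + 1) * ln x" using cA x by (intro mult_right_mono) auto
  finally show ?thesis .
qed

lemma proper_prime_powers_negligible:
  "(\<lambda>x. (sqrt (real x) + 1) * (2 * ln (real x) + 1) * ln (real x) / real x) \<longlonglongrightarrow> 0"
proof -
  have "((\<lambda>x::real. (sqrt x + 1) * (2 * ln x + 1) * ln x / x) \<longlongrightarrow> 0) at_top" by real_asymp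
  then show ?thesis by (rule filterlim_compose[OF _ filterlim_real_sequentially])
qed

text \<open>Half of the lower bound x / 6 for \<open>chebyshev_psi\<close> is given up to cover the
  proper prime powers.\<close>

lemma prime_counting_lower:
  "\<forall>\<^sub>F x in sequentially. real x / 12 \<le> prime_count x * ln (real x)"
proof -
  have "\<forall>\<^sub>F x in sequentially. (sqrt (real x) + 1) * (2 * ln (real x) + 1) * ln (real x) / real x < 1 / 12"
    using proper_prime_powers_negligible by (rule order_tendstoD) auto
  then show ?thesis
    using eventually_ge_at_top[of 2]
  proof eventually_elim
    case (elim x)
    have "real x / 6 \<le> chebyshev_psi x" by (rule chebyshev_psi_ge[OF elim(2)])
    also have "{1..x} = primes_upto x \<union> ({1..x} - primes_upto x)"
      by (auto simp: primes_upto_def Suc_le_eq prime_gt_0_nat)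
    then have "chebyshev_psi x = (\<Sum>k\<in>primes_upto x. mangoldt k) + (\<Sum>k\<in>{1..x} - primes_upto x. mangoldt k)"
      unfolding chebyshev_psi_def by (subst sum.union_disjoint[symmetric]) auto
    also have "(\<Sum>k\<in>primes_upto x. mangoldt k :: real) \<le> (\<Sum>k\<in>primes_upto x. ln x)"
    proof (rule sum_mono)
      fix k assume "k \<in> primes_upto x"
      then have "prime k" "real k \<le> real x" "real k > 0" by (auto simp: primes_upto_def prime_gt_0_nat)
      then show "mangoldt k \<le> ln (real x)" by simp
    qed
    also have "\<dots> = prime_count x * ln x" by simp
    also have "(\<Sum>k\<in>{1..x} - primes_upto x. mangoldt k) \<le> (sqrt x + 1) * (2 * ln x + 1) * ln x"
      using elim(2) by (intro proper_prime_powers_sum_le) auto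
    also have "\<dots> \<le> real x / 12" using elim by (simp add: field_simps)
    finally show ?case by simp
  qed
qed

text \<open>Every prime above sqrt x contributes at least ln x / 2 to \<open>chebyshev_psi x\<close>
  <= 4x, so there are at most 8x / ln x of them.\<close>

lemma prime_density_zero: "(\<lambda>x. prime_count x / real x) \<longlonglongrightarrow> 0"
proof (rule Lim_null_comparison)
  have "((\<lambda>x::real. (sqrt x + 8 * x / ln x) / x) \<longlongrightarrow> 0) at_top" by real_asymp
  then show "(\<lambda>x. (sqrt (real x) + 8 * real x / ln (real x)) / real x) \<longlonglongrightarrow> 0"
    by (rule filterlim_compose[OF _ filterlim_real_sequentially])
  show "\<forall>\<^sub>F x in sequentially. norm (prime_count x / real x) \<le> (sqrt (real x) + 8 * real x / ln (real x)) / real x"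
    using eventually_ge_at_top[of 2]
  proof eventually_elim
    case (elim x)
    define a where "a = nat \<lfloor>sqrt x\<rfloor>"
    define P where "P = {p \<in> primes_upto x. p > a}"
    have lx: "ln (real x) > 0" using elim by simp
    have "primes_upto x \<subseteq> {1..a} \<union> P" by (auto simp: primes_upto_def P_def Suc_le_eq prime_gt_0_nat)
    then have "card (primes_upto x) \<le> card ({1..a} \<union> P)" by (intro card_mono) (auto simp: P_def)
    also have "\<dots> \<le> card {1..a} + card P" by (rule card_Un_le)
    finally have c: "prime_count x \<le> real a + real (card P)" by simp
    have "real (card P) * (ln x / 2) = (\<Sum>p\<in>P. ln x / 2)" by simp
    also have "\<dots> \<le> (\<Sum>p\<in>P. mangoldt p)"
    proof (rule sum_mono)
      fix p assume p: "p \<in> P"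
      then have "sqrt x < real p" unfolding P_def a_def by (auto simp: nat_less_real_le floor_less_iff) linarith
      moreover from this have "0 < real p" by (rule le_less_trans[OF real_sqrt_ge_zero[OF of_nat_0_le_iff]])
      ultimately have "ln (sqrt x) \<le> ln (real p)" using elim by (subst ln_le_cancel_iff) auto
      then show "ln x / 2 \<le> mangoldt p" using p elim by (simp add: P_def primes_upto_def ln_sqrt mangoldt_prime)
    qed
    also have "\<dots> \<le> chebyshev_psi x" unfolding chebyshev_psi_def
      by (intro sum_mono2) (auto simp: P_def primes_upto_def mangoldt_nonneg)
    also have "\<dots> \<le> 4 * real x" by (rule chebyshev_psi_le)
    finally have "real (card P) \<le> 8 * real x / ln x" using lx by (simp add: field_simps)
    moreover have "real a \<le> sqrt x" by (simp add: a_def)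
    ultimately have "prime_count x \<le> sqrt x + 8 * real x / ln x" using c by linarith
    then show ?case by (simp add: divide_right_mono)
  qed
qed

text \<open>This stands in for partial summation when the weight ln p is replaced by ln x. Up to x
  div Y primality is dropped and ln u <= 2 * sqrt u gives O(x / sqrt Y). Above it each defect is at
  most ln (2Y), and there are only o(x) primes.\<close>

lemma prime_log_defect_negligible:
  "(\<lambda>x. (\<Sum>p\<in>primes_upto x. ln (real x) - ln (real p)) / real x) \<longlonglongrightarrow> 0"
proof (rule LIMSEQ_I)
  fix r :: real assume r: "r > 0"
  obtain Y :: nat where Y: "real Y > max 1 ((12 / r)\<^sup>2)" using reals_Archimedean2 by blast
  have Y0: "Y > 0" using Y by (auto intro: Nat.gr0I)
  have rY: "6 / sqrt Y < r / 2"
  proof -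
    have "sqrt ((12 / r)\<^sup>2) < sqrt Y" using Y by (intro real_sqrt_less_mono) auto
    then have "12 / r < sqrt Y" using r by simp
    then show ?thesis using r Y0 by (simp add: field_simps)
  qed
  have "(\<lambda>x. (prime_count x / real x) * ln (2 * real Y)) \<longlonglongrightarrow> 0 * ln (2 * real Y)"
    by (intro tendsto_intros prime_density_zero)
  then have "(\<lambda>x. (prime_count x / real x) * ln (2 * real Y)) \<longlonglongrightarrow> 0" by simp
  from LIMSEQ_D[OF this, of "r/2"] r
  obtain n0 where n0: "\<And>x. x \<ge> n0 \<Longrightarrow> \<bar>(prime_count x / real x) * ln (2 * real Y)\<bar> < r / 2"
    by auto
  show "\<exists>no. \<forall>x\<ge>no. norm ((\<Sum>p\<in>primes_upto x. ln (real x) - ln (real p)) / real x - 0) < r"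
  proof (intro exI[of _ "n0 + 1"] allI impI)
    fix x assume x: "x \<ge> n0 + 1"
    have x0: "real x > 0" using x by simp
    define D where "D = (\<lambda>p. ln (real x) - ln (real p))"
    have Dnn: "D p \<ge> 0" if "1 \<le> p" "p \<le> x" for p using that by (simp add: D_def)
    have P1: "1 \<le> p" if "p \<in> primes_upto x" for p using that by (auto simp: primes_upto_def Suc_le_eq prime_gt_0_nat)
    have "(\<Sum>p\<in>primes_upto x. D p) = (\<Sum>p\<in>{p \<in> primes_upto x. p \<le> x div Y}. D p) + (\<Sum>p\<in>{p \<in> primes_upto x. \<not> p \<le> x div Y}. D p)"
      by (subst sum.union_disjoint[symmetric]) (auto intro!: sum.cong)
    also have "(\<Sum>p\<in>{p \<in> primes_upto x. p \<le> x div Y}. D p) \<le> (\<Sum>m\<in>{1..x div Y}. D m)"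
    proof (rule sum_mono2)
      fix m assume "m \<in> {1..x div Y} - {p \<in> primes_upto x. p \<le> x div Y}"
      then have "1 \<le> m" "m \<le> x div Y" by auto
      then show "0 \<le> D m" using div_le_dividend[of x Y] by (intro Dnn) linarith+
    qed (use P1 in auto)
    also have "\<dots> \<le> (\<Sum>m\<in>{1..x div Y}. 2 * sqrt (real x / real m))"
    proof (rule sum_mono)
      fix m assume "m \<in> {1..x div Y}"
      then have "1 \<le> m" "m \<le> x div Y" by auto
      then have m: "1 \<le> m" "m \<le> x" using div_le_dividend[of x Y] by linarith+
      have "D m = ln (real x / real m)" using m by (simp add: D_def ln_div)
      also have "\<dots> \<le> (real x / real m) powr (1/2) / (1/2)" using m by (intro ln_powr_bound) auto
      also have "\<dots> = 2 * sqrt (real x / real m)" by (simp add: powr_half_sqrt)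
      finally show "D m \<le> 2 * sqrt (real x / real m)" .
    qed
    also have "\<dots> = 2 * (\<Sum>m\<in>{1..x div Y}. sqrt (real x / real m))" by (rule sum_distrib_left[symmetric])
    also have "\<dots> \<le> 2 * (3 * sqrt (real x * real (x div Y)))"
      by (intro mult_left_mono sum_inverse_sqrt_le) auto
    also have "\<dots> \<le> 2 * (3 * sqrt (real x * (real x / real Y)))"
      by (intro mult_left_mono real_sqrt_le_mono of_nat_div_le_of_nat) auto
    also have "sqrt (real x * (real x / real Y)) = real x / sqrt Y"
      by (simp add: real_sqrt_divide real_sqrt_mult)
    also have "2 * (3 * (real x / sqrt Y)) = real x * (6 / sqrt Y)" by simp
    also have "\<dots> \<le> real x * (r / 2)" using rY x0 by (intro mult_left_mono) auto
    also have "(\<Sum>p\<in>{p \<in> primes_upto x. \<not> p \<le> x div Y}. D p) \<le> (\<Sum>p\<in>{p \<in> primes_upto x. \<not> p \<le> x div Y}. ln (2 * real Y))"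
    proof (rule sum_mono)
      fix p assume p: "p \<in> {p \<in> primes_upto x. \<not> p \<le> x div Y}"
      then have "x div Y < p" by auto
      then have "x < p * Y" using Y0 by (simp add: div_less_iff_less_mult)
      then have "real x \<le> real (p * Y)" by (intro of_nat_mono) simp
      then have "real x \<le> real p * (2 * real Y)" using Y0 by simp
      moreover have "0 < real p * (2 * real Y)" using P1[of p] p Y0 by simp
      ultimately have "ln (real x) \<le> ln (real p * (2 * real Y))" using x0 by (subst ln_le_cancel_iff) auto
      also have "\<dots> = ln (real p) + ln (2 * real Y)" using P1[of p] p Y0 by (subst ln_mult) auto
      finally show "D p \<le> ln (2 * real Y)" by (simp add: D_def)
    qed
    also have "\<dots> = real (card {p \<in> primes_upto x. \<not> p \<le> x div Y}) * ln (2 * real Y)" by simp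
    also have "\<dots> \<le> prime_count x * ln (2 * real Y)"
      using Y by (intro mult_right_mono) (auto intro!: card_mono)
    also have "\<dots> = real x * ((prime_count x / real x) * ln (2 * real Y))" using x0 by simp
    also have "\<dots> < real x * (r / 2)" 
    proof (intro mult_strict_left_mono x0)
      have "n0 \<le> x" using x by simp
      from n0[OF this] show "prime_count x / real x * ln (2 * real Y) < r / 2"
        by linarith
    qed
    finally have "(\<Sum>p\<in>primes_upto x. D p) < real x * r" by (simp add: field_simps)
    moreover have "(\<Sum>p\<in>primes_upto x. D p) \<ge> 0" using P1 by (intro sum_nonneg Dnn) (auto simp: primes_upto_def)
    ultimately show "norm ((\<Sum>p\<in>primes_upto x. ln (real x) - ln (real p)) / real x - 0) < r"
      using x0 by (simp add: D_def field_simps)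
  qed
qed

text \<open>Three errors are divided by x: the sum over \<open>\<psi> k * mangoldt k\<close>, the
  proper prime powers in it, and the defect of replacing ln p by ln x. The factor 12 is that of
  \<open>prime_counting_lower\<close>.\<close>

lemma (in real_character) prime_sum_negligible:
  "(\<lambda>x. (\<Sum>p\<in>primes_upto x. \<psi> p) / prime_count x) \<longlonglongrightarrow> 0"
proof (rule Lim_null_comparison)
  define R where "R = (\<lambda>x::nat. (sqrt (real x) + 1) * (2 * ln (real x) + 1) * ln (real x))"
  define D where "D = (\<lambda>x. \<Sum>p\<in>primes_upto x. ln (real x) - ln (real p))"
  have "(\<lambda>x. 12 * (\<bar>mangoldt_sum_upto x / real x\<bar> + R x / real x + D x / real x)) \<longlonglongrightarrow> 12 * (\<bar>0\<bar> + 0 + 0)"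
    unfolding R_def D_def
    by (intro tendsto_intros mangoldt_mean_zero proper_prime_powers_negligible prime_log_defect_negligible)
  then show "(\<lambda>x. 12 * (\<bar>mangoldt_sum_upto x / real x\<bar> + R x / real x + D x / real x)) \<longlonglongrightarrow> 0" by simp
  show "\<forall>\<^sub>F x in sequentially. norm ((\<Sum>p\<in>primes_upto x. \<psi> p) / prime_count x)
      \<le> 12 * (\<bar>mangoldt_sum_upto x / real x\<bar> + R x / real x + D x / real x)"
    using prime_counting_lower eventually_ge_at_top[of 2]
  proof eventually_elim
    case (elim x)
    have x: "real x > 0" "ln (real x) > 0" using elim by auto
    have P1: "1 \<le> p \<and> p \<le> x" if "p \<in> primes_upto x" for p
      using that by (auto simp: primes_upto_def Suc_le_eq prime_gt_0_nat)
    define S where "S = (\<Sum>p\<in>primes_upto x. \<psi> p)"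
    define T where "T = (\<Sum>p\<in>primes_upto x. \<psi> p * ln (real p))"
    have un: "{1..x} = primes_upto x \<union> ({1..x} - primes_upto x)" using P1 by auto
    have "mangoldt_sum_upto x = (\<Sum>k\<in>primes_upto x. \<psi> k * mangoldt k) + (\<Sum>k\<in>{1..x} - primes_upto x. \<psi> k * mangoldt k)"
      unfolding mangoldt_sum_upto_def by (subst un, subst sum.union_disjoint) auto
    also have "(\<Sum>k\<in>primes_upto x. \<psi> k * mangoldt k) = T"
      unfolding T_def by (intro sum.cong refl) (auto simp: primes_upto_def mangoldt_prime)
    finally have e1: "mangoldt_sum_upto x = T + (\<Sum>k\<in>{1..x} - primes_upto x. \<psi> k * mangoldt k)" .
    have "\<bar>\<Sum>k\<in>{1..x} - primes_upto x. \<psi> k * mangoldt k\<bar> \<le> (\<Sum>k\<in>{1..x} - primes_upto x. mangoldt k)"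
    proof (rule order_trans[OF sum_abs], rule sum_mono)
      fix k show "\<bar>\<psi> k * mangoldt k\<bar> \<le> mangoldt k"
        using mult_right_mono[OF abs_le[of k] mangoldt_nonneg[of k]] by (simp add: abs_mult)
    qed
    also have "\<dots> \<le> R x" unfolding R_def using elim by (intro proper_prime_powers_sum_le) auto
    finally have T: "\<bar>T\<bar> \<le> \<bar>mangoldt_sum_upto x\<bar> + R x" using e1 by linarith
    have "S * ln (real x) - T = (\<Sum>p\<in>primes_upto x. \<psi> p * (ln (real x) - ln (real p)))"
      unfolding S_def T_def by (simp add: sum_distrib_right right_diff_distrib sum_subtractf)
    also have "\<bar>\<dots>\<bar> \<le> D x"
      unfolding D_def
    proof (rule order_trans[OF sum_abs], rule sum_mono)
      fix p assume "p \<in> primes_upto x"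
      then have "0 \<le> ln (real x) - ln (real p)" using P1[of p] by simp
      then show "\<bar>\<psi> p * (ln (real x) - ln (real p))\<bar> \<le> ln (real x) - ln (real p)"
        using mult_right_mono[OF abs_le[of p]] by (fastforce simp: abs_mult)
    qed
    finally have "\<bar>S * ln (real x)\<bar> \<le> \<bar>mangoldt_sum_upto x\<bar> + R x + D x" using T by linarith
    then have S: "\<bar>S\<bar> \<le> (\<bar>mangoldt_sum_upto x\<bar> + R x + D x) / ln (real x)"
      using x by (simp add: abs_mult field_simps)
    have num: "0 \<le> \<bar>mangoldt_sum_upto x\<bar> + R x + D x"
      using \<open>\<bar>S * ln (real x)\<bar> \<le> \<bar>mangoldt_sum_upto x\<bar> + R x + D x\<close> by linarith
    have card_pos: "prime_count x \<ge> real x / (12 * ln (real x))"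
      using elim x by (simp add: field_simps)
    have "\<bar>S\<bar> / prime_count x \<le> ((\<bar>mangoldt_sum_upto x\<bar> + R x + D x) / ln (real x)) / (real x / (12 * ln (real x)))"
      using S card_pos num x by (intro frac_le) auto
    also have "\<dots> = 12 * (\<bar>mangoldt_sum_upto x / real x\<bar> + R x / real x + D x / real x)"
      using x by (simp add: field_simps)
    finally show ?case unfolding S_def by simp
  qed
qed

section \<open>Characters from quadratic reciprocity\<close>

abbreviation (input) legendre :: "nat \<Rightarrow> nat \<Rightarrow> int" where
  "legendre q p \<equiv> Legendre (int q) (int p)"

lemma Legendre_values: "Legendre a p \<in> {-1, 0, 1}"
  by (simp add: Legendre_def)

lemma Legendre_eq_0_iff: "Legendre a p = 0 \<longleftrightarrow> p dvd a"
  by (auto simp: Legendre_def cong_0_iff)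

lemma Legendre_cong:
  assumes "[a = b] (mod p)"
  shows "Legendre a p = Legendre b p"
proof -
  have "[x = a] (mod p) \<longleftrightarrow> [x = b] (mod p)" for x using assms cong_trans cong_sym by blast
  moreover have "[a = 0] (mod p) \<longleftrightarrow> [b = 0] (mod p)" using assms cong_trans cong_sym by blast
  ultimately show ?thesis by (simp add: Legendre_def QuadRes_def)
qed

lemma Legendre_one: "p > 1 \<Longrightarrow> Legendre 1 (int p) = 1"
  by (auto simp: Legendre_def QuadRes_def cong_0_iff intro: exI[of _ 1])

text \<open>Euler's criterion gives the identity modulo p. Both sides lie in {-1, 0, 1}, so they
  differ by at most 2 < p.\<close>

lemma Legendre_mult:
  assumes p: "prime p" "2 < p"
  shows "Legendre (a * b) (int p) = Legendre a p * Legendre b p"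
proof -
  have "[Legendre (a * b) p = (a * b) ^ ((p - 1) div 2)] (mod int p)" by (rule euler_criterion[OF p])
  moreover have "[Legendre a p * Legendre b p = a ^ ((p - 1) div 2) * b ^ ((p - 1) div 2)] (mod int p)"
    by (intro cong_mult euler_criterion[OF p])
  ultimately have "[Legendre (a * b) p = Legendre a p * Legendre b p] (mod int p)"
    unfolding power_mult_distrib using cong_trans cong_sym by blast
  then have d: "int p dvd Legendre (a * b) p - Legendre a p * Legendre b p" by (simp add: cong_iff_dvd_diff)
  have "\<bar>Legendre (a * b) p - Legendre a p * Legendre b p\<bar> \<le> 2"
    using Legendre_values[of "a * b" p] Legendre_values[of a p] Legendre_values[of b p] by auto
  then have "\<bar>Legendre (a * b) p - Legendre a p * Legendre b p\<bar> < int p" using p(2) by linarith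
  then have "Legendre (a * b) p - Legendre a p * Legendre b p = 0"
    using d dvd_imp_le_int[of "Legendre (a * b) p - Legendre a p * Legendre b p" "int p"] by fastforce
  then show ?thesis by simp
qed

text \<open>Gauss's lemma with h = (p - 1) div 2: among the doubles 2, 4, ..., 2h, those exceeding h
  come from x > h div 2. The parity of their number h - h div 2 depends on h mod 4, hence on p mod
  8.\<close>

lemma Legendre_two:
  assumes p: "prime p" "2 < p"
  shows "Legendre 2 (int p) = (if p mod 8 = 1 \<or> p mod 8 = 7 then 1 else -1)"
proof -
  have odd: "odd p" using p prime_odd_nat by auto
  interpret G: GAUSS p 2
    using p by unfold_locales (auto simp: cong_0_iff zdvd_not_zless dest: zdvd_imp_le)
  define h where "h = (p - 1) div 2"
  have ph: "p = 2 * h + 1" using odd p by (auto simp: h_def elim!: oddE)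
  have hi: "(int p - 1) div 2 = int h" using ph by simp
  have "G.E = (\<lambda>x. 2 * x) ` {int (h div 2) <.. int h}"
  proof -
    have C: "G.C = (\<lambda>x. 2 * x) ` {0<..int h}"
      unfolding G.C_def G.B_def G.A_def hi image_image
      by (intro image_cong refl) (use ph in \<open>auto simp: mult.commute intro!: mod_pos_pos_trivial\<close>)
    show ?thesis
      unfolding G.E_def C hi by (auto simp: zdiv_int)
  qed
  then have "card G.E = card {int (h div 2) <.. int h}"
    by (simp add: card_image inj_on_def)
  also have "\<dots> = h - h div 2" by simp
  finally have c: "Legendre 2 (int p) = (-1) ^ (h - h div 2)" using G.gauss_lemma by simp
  define k where "k = h div 4"
  have "h mod 4 < 4" by simp
  then consider "h = 4 * k" | "h = 4 * k + 1" | "h = 4 * k + 2" | "h = 4 * k + 3"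
    unfolding k_def by linarith
  then show ?thesis
  proof cases
    case 1 then have "h - h div 2 = 2 * k" "p mod 8 = 1" using ph by simp_all
    then show ?thesis unfolding c by simp
  next
    case 2
    then have "h - h div 2 = 2 * k + 1" "p = 3 + 8 * k" using ph by simp_all
    moreover from this(2) have "p mod 8 = 3" by (simp only: mod_mult_self2) simp
    ultimately show ?thesis unfolding c by simp
  next
    case 3
    then have "h - h div 2 = 2 * k + 1" "p = 5 + 8 * k" using ph by simp_all
    moreover from this(2) have "p mod 8 = 5" by (simp only: mod_mult_self2) simp
    ultimately show ?thesis unfolding c by simp
  next
    case 4
    then have "h - h div 2 = 2 * (k + 1)" "p = 7 + 8 * k" using ph by simp_all
    moreover from this(2) have "p mod 8 = 7" by (simp only: mod_mult_self2) simp
    ultimately show ?thesis unfolding c by (simp only: power_mult) simp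
  qed
qed

text \<open>Otherwise squaring would map the nonzero residues onto themselves, hence injectively,
  although 1 and q - 1 have the same square.\<close>

lemma exists_nonresidue:
  assumes q: "prime q" "2 < q"
  shows "\<exists>r::nat. legendre r q = -1"
proof (rule ccontr)
  assume "\<not> ?thesis"
  then have all: "legendre r q = 0 \<or> legendre r q = 1" for r :: nat
    using Legendre_values[of "int r" "int q"] by auto
  let ?A = "{1..<q}" and ?f = "\<lambda>x. x\<^sup>2 mod q"
  have sub: "?A \<subseteq> ?f ` ?A"
  proof
    fix r assume r: "r \<in> ?A"
    have "\<not> int q dvd int r" using r by (auto dest: zdvd_imp_le simp flip: int_dvd_int_iff)
    then have "QuadRes (int q) (int r)" using all[of r] Legendre_eq_0_iff[of "int r" "int q"]
      by (auto simp: Legendre_def split: if_splits)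
    then obtain y where y: "[y\<^sup>2 = int r] (mod int q)" by (auto simp: QuadRes_def)
    define x where "x = nat (y mod int q)"
    have xi: "int x = y mod int q" using q by (simp add: x_def)
    have "int (x\<^sup>2 mod q) = (y mod int q)\<^sup>2 mod int q" by (simp add: xi zmod_int)
    also have "\<dots> = y\<^sup>2 mod int q" by (simp add: power_mod)
    also have "\<dots> = int r mod int q" using y by (simp add: cong_def)
    also have "\<dots> = int r" using r by (simp add: zmod_int[symmetric])
    finally have fx: "?f x = r" by simp
    have "x < q" using xi q pos_mod_bound[of "int q" y] by linarith
    moreover have "x \<noteq> 0" using fx r by (auto intro: ccontr)
    ultimately show "r \<in> ?f ` ?A" using fx by (auto simp: image_iff Suc_le_eq intro!: bexI[of _ x])
  qed
  then have "card ?A \<le> card (?f ` ?A)" by (intro card_mono) auto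
  then have "inj_on ?f ?A" using card_image_le[of ?A ?f] by (intro eq_card_imp_inj_on) auto
  moreover have "?f (q - 1) = ?f 1"
  proof -
    have "(q - 1)\<^sup>2 = 1 + q * (q - 2)"
    proof -
      obtain m where "q = m + 2" using q by (metis add.commute le_Suc_ex less_imp_le)
      then show ?thesis by (simp add: power2_eq_square algebra_simps)
    qed
    then have "(q - 1)\<^sup>2 mod q = 1 mod q" by (simp only: mod_mult_self2)
    then show ?thesis by simp
  qed
  ultimately have "q - 1 = 1" using q by (auto simp: inj_on_def)
  then show False using q by simp
qed

text \<open>For odd n this is the Jacobi symbol of q over n, rewritten by reciprocity as a function
  of n mod 8 and n mod q, so that its periodicity in n is visible.\<close>

definition jacobi_factor :: "nat \<Rightarrow> nat \<Rightarrow> int" where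
  "jacobi_factor q n = (if q = 2 then (if n mod 8 = 1 \<or> n mod 8 = 7 then 1 else -1)
     else (if n mod 4 = 3 \<and> q mod 4 = 3 then -1 else 1) * legendre n q)"

lemma odd_mod_8_cases: "odd (n::nat) \<Longrightarrow> n mod 8 = 1 \<or> n mod 8 = 3 \<or> n mod 8 = 5 \<or> n mod 8 = 7"
  by presburger

lemma odd_mod_4_cases: "odd (n::nat) \<Longrightarrow> n mod 4 = 1 \<or> n mod 4 = 3"
  by presburger

lemma jacobi_factor_mult:
  assumes q: "prime q" and mn: "odd m" "odd n"
  shows "jacobi_factor q (m * n) = jacobi_factor q m * jacobi_factor q n"
proof (cases "q = 2")
  case True
  have "(m * n) mod 8 = ((m mod 8) * (n mod 8)) mod 8" by (simp add: mod_mult_eq)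
  then show ?thesis using odd_mod_8_cases[OF mn(1)] odd_mod_8_cases[OF mn(2)] True
    unfolding jacobi_factor_def by (elim disjE) simp_all
next
  case False
  then have q2: "2 < q" using prime_ge_2_nat[OF q] by simp
  have "(m * n) mod 4 = ((m mod 4) * (n mod 4)) mod 4" by (simp add: mod_mult_eq)
  then show ?thesis using odd_mod_4_cases[OF mn(1)] odd_mod_4_cases[OF mn(2)] False Legendre_mult[OF q q2]
    unfolding jacobi_factor_def by (elim disjE) simp_all
qed

lemma jacobi_factor_cong:
  assumes "n mod 8 = m mod 8" "n mod q = m mod q"
  shows "jacobi_factor q n = jacobi_factor q m"
proof -
  have "k mod 8 mod 4 = k mod 4" for k :: nat by (rule mod_mod_cancel) simp
  then have "n mod 4 = m mod 4" using assms(1) by metis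
  moreover have "[int n = int m] (mod int q)" using assms(2) by (simp add: cong_def zmod_int[symmetric])
  ultimately show ?thesis unfolding jacobi_factor_def using assms(1) Legendre_cong by simp
qed

lemma jacobi_factor_values:
  assumes "prime q" "coprime n q"
  shows "jacobi_factor q n = 1 \<or> jacobi_factor q n = -1"
proof -
  have "\<not> q dvd n" using assms by (metis coprime_absorb_right not_prime_unit)
  then have "legendre n q \<noteq> 0" by (simp add: Legendre_eq_0_iff)
  then show ?thesis using Legendre_values[of "int n" "int q"] by (auto simp: jacobi_factor_def)
qed

lemma jacobi_factor_prime:
  assumes p: "prime p" "2 < p" and q: "prime q" "q \<noteq> p"
  shows "jacobi_factor q p = legendre q p"
proof (cases "q = 2")
  case True then show ?thesis using Legendre_two[OF p] by (simp add: jacobi_factor_def)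
next
  case False
  then have q2: "2 < q" using prime_ge_2_nat[OF q(1)] by simp
  have rec: "legendre p q * legendre q p = (-1) ^ ((p - 1) div 2 * ((q - 1) div 2))"
    using Quadratic_Reciprocity[OF p q(1) q2] q(2) by auto
  have odd: "odd p" "odd q" using p q q2 prime_odd_nat by auto
  have par: "even ((n - 1) div 2) \<longleftrightarrow> n mod 4 \<noteq> 3" if "odd n" for n :: nat using that by presburger
  have "(-1 :: int) ^ ((p - 1) div 2 * ((q - 1) div 2)) = (if p mod 4 = 3 \<and> q mod 4 = 3 then -1 else 1)"
    using par[OF odd(1)] par[OF odd(2)] by (auto simp: minus_one_power_iff)
  then have "legendre p q * legendre q p = (if p mod 4 = 3 \<and> q mod 4 = 3 then -1 else 1)"
    using rec by simp
  moreover have "\<not> q dvd p" using primes_dvd_imp_eq[OF q(1) p(1)] q(2) by auto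
  then have "legendre p q = 1 \<or> legendre p q = -1"
    using Legendre_eq_0_iff[of "int p" "int q"] Legendre_values[of "int p" "int q"] by auto
  ultimately show ?thesis unfolding jacobi_factor_def using False by (auto split: if_splits)
qed

text \<open>Cutting off at numbers not prime to 2 * \<open>\<Prod>T\<close> yields complete
  multiplicativity for all arguments, since \<open>jacobi_factor\<close> is multiplicative only for
  odd ones.\<close>

definition quadratic_char :: "nat set \<Rightarrow> nat \<Rightarrow> real" where
  "quadratic_char T n = (if coprime n (2 * \<Prod>T) then of_int (\<Prod>q\<in>T. jacobi_factor q n) else 0)"

lemma quadratic_char_prime:
  assumes T: "finite T" "\<And>q. q \<in> T \<Longrightarrow> prime q" and p: "prime p" "p \<noteq> 2" "p \<notin> T"
  shows "quadratic_char T p = of_int (\<Prod>q\<in>T. legendre q p)"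
proof -
  have p2: "2 < p" using p prime_ge_2_nat[OF p(1)] by simp
  have "coprime p q" if "q \<in> T" for q using T(2)[OF that] p that by (metis primes_coprime)
  then have "coprime p (2 * \<Prod>T)" using p(1,2) primes_coprime[OF p(1) two_is_prime_nat]
    by (auto intro!: prod_coprime_right)
  moreover have "(\<Prod>q\<in>T. jacobi_factor q p) = (\<Prod>q\<in>T. legendre q p)"
    using T p by (intro prod.cong refl jacobi_factor_prime[OF p(1) p2]) auto
  ultimately show ?thesis by (simp add: quadratic_char_def)
qed

text \<open>By the Chinese remainder theorem a can be 1 modulo 8 and modulo all other primes of T,
  and a non-residue modulo one odd q in T. Only the factor at q is then -1. Without an odd prime in
  T the witness is 5, for which 2 has symbol -1.\<close>

lemma quadratic_char_negative_value:
  assumes T: "finite T" "T \<noteq> {}" "\<And>q. q \<in> T \<Longrightarrow> prime q"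
  shows "\<exists>a. coprime a (2 * \<Prod>T) \<and> quadratic_char T a = -1"
proof (cases "T = {2}")
  case True
  then show ?thesis by (intro exI[of _ 5]) (auto simp: quadratic_char_def jacobi_factor_def coprime_iff_gcd_eq_1 gcd_non_0_nat)
next
  case False
  then obtain q where q: "q \<in> T" "q \<noteq> 2" using T(2) by auto
  have qp: "prime q" "2 < q" using q T(3) prime_ge_2_nat[of q] by force+
  obtain r where r: "legendre r q = -1" using exists_nonresidue[OF qp] by blast
  define m where "m = 8 * \<Prod>(T - {q})"
  have cop: "coprime q' q" if "q' \<in> T - {q}" for q' using that q T(3) primes_coprime by blast
  have "coprime m q"
    unfolding m_def using cop qp primes_coprime[OF two_is_prime_nat qp(1)] q(2)
      coprime_power_left_iff[of 2 3 q]
    by (auto intro!: prod_coprime_left)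
  then obtain a where a: "[a = 1] (mod m)" "[a = r] (mod q)"
    using binary_chinese_remainder_nat by blast
  have am: "a mod k = 1 mod k" if "k dvd m" for k
    using cong_dvd_modulus_nat[OF a(1) that] by (simp add: cong_def)
  have a8: "a mod 8 = 1 mod 8" by (rule am) (simp add: m_def)
  have "legendre a q = legendre r q"
    using a(2) by (intro Legendre_cong) (simp add: cong_int_iff)
  then have Jq: "legendre a q = -1" using r by simp
  have "a mod 4 = 1" using am[of 4] by (simp add: m_def)
  then have Jq': "jacobi_factor q a = -1" using Jq q(2) by (simp add: jacobi_factor_def)
  have J1: "jacobi_factor q' a = 1" if q': "q' \<in> T - {q}" for q'
  proof -
    have "q' dvd \<Prod>(T - {q})" using q' T(1) by (intro dvd_prodI) auto
    then have "q' dvd m" by (simp add: m_def)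
    then have "jacobi_factor q' a = jacobi_factor q' 1"
      by (intro jacobi_factor_cong am a8)
    also have "\<dots> = 1" using Legendre_one[of q'] T(3)[of q'] q' prime_gt_1_nat by (auto simp: jacobi_factor_def)
    finally show ?thesis .
  qed
  have ca: "coprime a q'" if q': "q' \<in> T" for q'
  proof (rule ccontr)
    assume "\<not> coprime a q'"
    then have d: "q' dvd a" using T(3)[OF q'] prime_imp_coprime coprime_commute by blast
    show False
    proof (cases "q' = q")
      case True
      then show False using d Jq Legendre_eq_0_iff[of "int a" "int q"] by simp
    next
      case False
      then have "q' dvd \<Prod>(T - {q})" using q' T(1) by (intro dvd_prodI) auto
      then have "a mod q' = 1 mod q'" by (intro am) (simp add: m_def)
      then show False using d T(3)[OF q'] prime_gt_1_nat[of q'] by simp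
    qed
  qed
  have "a mod 2 = 1" using am[of 2] by (simp add: m_def)
  then have "coprime a 2" by (simp add: odd_iff_mod_2_eq_one)
  then have "coprime a (2 * \<Prod>T)" using ca by (auto intro!: prod_coprime_right)
  moreover have "(\<Prod>q\<in>T. jacobi_factor q a) = jacobi_factor q a * (\<Prod>q'\<in>T - {q}. jacobi_factor q' a)"
    using T(1) q(1) by (rule prod.remove)
  then have "(\<Prod>q\<in>T. jacobi_factor q a) = -1" using J1 Jq' by simp
  ultimately show ?thesis by (intro exI[of _ a]) (simp add: quadratic_char_def)
qed

lemma quadratic_char_is_character:
  assumes T: "finite T" "T \<noteq> {}" "\<And>q. q \<in> T \<Longrightarrow> prime q"
  shows "real_character (quadratic_char T) (8 * \<Prod>T)"
proof
  let ?D = "2 * \<Prod>T" and ?N = "8 * \<Prod>T"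
  have D: "?N = ?D * 4" by simp
  have P0: "\<Prod>T > 0" using T by (auto intro!: prod_pos simp: prime_gt_0_nat)
  show N0: "?N > 0" using P0 by simp
  have qN: "q dvd ?N" if "q \<in> T" for q using that T(1) by (intro dvd_mult dvd_prodI) auto
  show per: "quadratic_char T (n + ?N) = quadratic_char T n" for n
  proof -
    have "coprime (n + ?N) ?D \<longleftrightarrow> coprime n ?D"
      unfolding D by (metis add.commute gcd_add_mult coprime_iff_gcd_eq_1 gcd.commute mult.commute)
    moreover have "(\<Prod>q\<in>T. jacobi_factor q (n + ?N)) = (\<Prod>q\<in>T. jacobi_factor q n)"
    proof (intro prod.cong refl jacobi_factor_cong)
      have m: "(n + ?N) mod k = n mod k" if "k dvd ?N" for k
        using that by (metis add_0_right dvd_imp_mod_0 mod_add_right_eq)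
      show "(n + ?N) mod 8 = n mod 8" by (rule m) simp
      show "(n + ?N) mod q = n mod q" if "q \<in> T" for q by (rule m[OF qN[OF that]])
    qed
    ultimately show ?thesis by (simp add: quadratic_char_def)
  qed
  show mul: "quadratic_char T (m * n) = quadratic_char T m * quadratic_char T n" for m n
  proof (cases "coprime m ?D \<and> coprime n ?D")
    case True
    then have "odd m" "odd n" by (auto simp: coprime_commute)
    then have "(\<Prod>q\<in>T. jacobi_factor q (m * n)) = (\<Prod>q\<in>T. jacobi_factor q m * jacobi_factor q n)"
      using T(3) by (intro prod.cong refl jacobi_factor_mult) auto
    then show ?thesis using True by (simp add: quadratic_char_def prod.distrib)
  qed (auto simp: quadratic_char_def)
  show "quadratic_char T n \<in> {-1, 0, 1}" for n
  proof (cases "coprime n ?D")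
    case True
    have "\<bar>jacobi_factor q n\<bar> = 1" if "q \<in> T" for q
    proof -
      have "q dvd ?D" using that T(1) by (intro dvd_mult dvd_prodI) auto
      then have "coprime n q" by (rule coprime_divisors[OF dvd_refl _ True])
      then show ?thesis using jacobi_factor_values[OF T(3)[OF that]] by fastforce
    qed
    then have "\<bar>\<Prod>q\<in>T. jacobi_factor q n\<bar> = 1" by (simp add: abs_prod)
    then have "(\<Prod>q\<in>T. jacobi_factor q n) = 1 \<or> (\<Prod>q\<in>T. jacobi_factor q n) = -1" by linarith
    moreover have "quadratic_char T n = of_int (\<Prod>q\<in>T. jacobi_factor q n)"
      using True unfolding quadratic_char_def by (rule if_P)
    ultimately show ?thesis by (elim disjE) simp_all
  next
    case False
    then have "quadratic_char T n = 0" unfolding quadratic_char_def by (rule if_not_P)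
    then show ?thesis by simp
  qed
  show "quadratic_char T 1 = 1"
  proof -
    have "jacobi_factor q 1 = 1" if "q \<in> T" for q
      using Legendre_one[of q] T(3)[OF that] prime_gt_1_nat by (auto simp: jacobi_factor_def)
    then show ?thesis by (simp add: quadratic_char_def)
  qed
  \<comment> \<open>Multiplication by a permutes the residues modulo the period and flips the sign
    of every value, so the sum over a period equals its negative.\<close>
  obtain a where a: "coprime a ?D" "quadratic_char T a = -1" using quadratic_char_negative_value[OF T] by blast
  have aN: "coprime a ?N" using a(1) coprime_power_right_iff[of a 2 3] by simp
  have perk: "quadratic_char T (n + k * ?N) = quadratic_char T n" for n k
    by (induction k) (simp_all only: mult_Suc mult_0 add_0_right add.assoc[symmetric] add.commute[of ?N] per)
  have pm: "quadratic_char T (n mod ?N) = quadratic_char T n" for n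
    using perk[of "n mod ?N" "n div ?N"] by (simp only: mod_div_mult_eq)
  have inj: "inj_on (\<lambda>n. (a * n) mod ?N) {..<?N}"
  proof (rule inj_onI)
    fix x y assume xy: "x \<in> {..<?N}" "y \<in> {..<?N}" "(a * x) mod ?N = (a * y) mod ?N"
    then have "[x = y] (mod ?N)" using cong_mult_lcancel_nat[OF aN] by (simp add: cong_def)
    then show "x = y" using xy(1,2) by (simp add: cong_def)
  qed
  have im: "(\<lambda>n. (a * n) mod ?N) ` {..<?N} = {..<?N}"
    by (rule endo_inj_surj[OF _ _ inj]) (use N0 in auto)
  have "(\<Sum>n<?N. quadratic_char T n) = (\<Sum>n<?N. quadratic_char T ((a * n) mod ?N))"
    using sum.reindex[OF inj, of "quadratic_char T"] unfolding im by simp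
  also have "\<dots> = (\<Sum>n<?N. - quadratic_char T n)" unfolding pm mul a(2) by simp
  finally show "(\<Sum>n<?N. quadratic_char T n) = 0" by (simp add: sum_negf)
qed

section \<open>Densities of residue patterns\<close>

lemma prime_count_at_top: "filterlim (\<lambda>x. prime_count x) at_top sequentially"
proof (rule filterlim_at_top_mono)
  have "filterlim (\<lambda>x::real. x / (12 * ln x)) at_top at_top" by real_asymp
  then show "filterlim (\<lambda>x. real x / (12 * ln (real x))) at_top sequentially"
    by (rule filterlim_compose[OF _ filterlim_real_sequentially])
  show "\<forall>\<^sub>F x in sequentially. real x / (12 * ln (real x)) \<le> prime_count x"
    using prime_counting_lower eventually_ge_at_top[of 2]
  proof eventually_elim
    case (elim x)
    then have "ln (real x) > 0" by simp
    then show ?case using elim(1) by (simp add: field_simps)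
  qed
qed

lemma const_over_prime_count: "(\<lambda>x. c / prime_count x) \<longlonglongrightarrow> 0"
  by (rule real_tendsto_divide_at_top[OF tendsto_const prime_count_at_top])

lemma Legendre_prod_abs_le: "\<bar>\<Prod>q\<in>T. legendre q p\<bar> \<le> 1"
  unfolding abs_prod
proof (rule prod_le_1)
  show "0 \<le> \<bar>legendre q p\<bar> \<and> \<bar>legendre q p\<bar> \<le> 1" for q
    using Legendre_values[of "int q" "int p"] by auto
qed

text \<open>By reciprocity the product of symbols agrees with the character at all primes outside
  \<open>insert 2 T\<close>, and each exceptional prime costs at most 2.\<close>

lemma Legendre_prime_sum_negligible:
  assumes T: "finite T" "T \<noteq> {}" "\<And>q. q \<in> T \<Longrightarrow> prime q"
  shows "(\<lambda>x. (\<Sum>p\<in>primes_upto x. of_int (\<Prod>q\<in>T. legendre q p)) / prime_count x) \<longlonglongrightarrow> 0"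
proof -
  interpret real_character "quadratic_char T" "8 * \<Prod>T" by (rule quadratic_char_is_character[OF T])
  define d where "d = (\<lambda>p. of_int (\<Prod>q\<in>T. legendre q p) - quadratic_char T p)"
  have d0: "d p = 0" if "prime p" "p \<notin> insert 2 T" for p
    unfolding d_def using quadratic_char_prime[OF T(1,3), of p] that by auto
  have d2: "\<bar>d p\<bar> \<le> 2" for p
  proof -
    have "\<bar>real_of_int (\<Prod>q\<in>T. legendre q p)\<bar> \<le> 1"
      using Legendre_prod_abs_le[where T = T and p = p] by linarith
    then show ?thesis unfolding d_def using abs_le[of p] by linarith
  qed
  have bound: "\<bar>\<Sum>p\<in>primes_upto x. d p\<bar> \<le> 2 * real (card (insert 2 T))" for x
  proof -
    have "(\<Sum>p\<in>primes_upto x. d p) = (\<Sum>p\<in>primes_upto x \<inter> insert 2 T. d p)"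
      by (rule sum.mono_neutral_right) (auto intro!: d0 simp: primes_upto_def)
    also have "\<bar>\<dots>\<bar> \<le> (\<Sum>p\<in>primes_upto x \<inter> insert 2 T. \<bar>d p\<bar>)" by (rule sum_abs)
    also have "\<dots> \<le> (\<Sum>p\<in>primes_upto x \<inter> insert 2 T. 2)" by (intro sum_mono d2)
    also have "\<dots> \<le> 2 * real (card (insert 2 T))"
      using card_mono[of "insert 2 T" "primes_upto x \<inter> insert 2 T"] T(1) by simp
    finally show ?thesis .
  qed
  have "(\<lambda>x. (\<Sum>p\<in>primes_upto x. d p) / prime_count x) \<longlonglongrightarrow> 0"
  proof (rule Lim_null_comparison[OF always_eventually const_over_prime_count], rule allI)
    fix x
    show "norm ((\<Sum>p\<in>primes_upto x. d p) / prime_count x) \<le> 2 * real (card (insert 2 T)) / prime_count x"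
      using bound[of x] by (simp add: divide_right_mono)
  qed
  from tendsto_add[OF this prime_sum_negligible] show ?thesis
    by (simp add: d_def sum_subtractf add_divide_distrib[symmetric])
qed

text \<open>For p outside Q the product of the factors (1 + e q * (q over p)) / 2 is the indicator
  of the pattern. Expanding over subsets T of Q, every nonempty T averages to 0 and the empty one to
  1. For p in Q a symbol vanishes, but the product stays in [0,1], so the error is at most
  \<open>card Q\<close>.\<close>

theorem Legendre_pattern_density:
  assumes Q: "finite Q" "\<And>q. q \<in> Q \<Longrightarrow> prime q" and e: "\<And>q. q \<in> Q \<Longrightarrow> e q = 1 \<or> e q = -1"
  shows "(\<lambda>x. real (card {p \<in> primes_upto x. \<forall>q\<in>Q. legendre q p = e q}) / prime_count x)
    \<longlonglongrightarrow> (1/2) ^ card Q"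
proof -
  define S where "S = (\<lambda>T x. \<Sum>p\<in>primes_upto x. real_of_int (\<Prod>q\<in>T. legendre q p))"
  define \<pi> where "\<pi> = (\<lambda>x. prime_count x)"
  define F where "F = (\<lambda>p. (\<Prod>q\<in>Q. of_int (e q * legendre q p) + 1 :: real) / 2 ^ card Q)"
  define A where "A = (\<lambda>x. {p \<in> primes_upto x. \<forall>q\<in>Q. legendre q p = e q})"
  have lim: "(\<lambda>x. (\<Sum>T\<in>Pow Q. of_int (\<Prod>q\<in>T. e q) * (S T x / \<pi> x)) / 2 ^ card Q)
      \<longlonglongrightarrow> (\<Sum>T\<in>Pow Q. of_int (\<Prod>q\<in>T. e q) * (if T = {} then 1 else 0)) / 2 ^ card Q"
  proof (intro tendsto_divide tendsto_sum tendsto_mult tendsto_const)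
    fix T assume T: "T \<in> Pow Q"
    show "(\<lambda>x. S T x / \<pi> x) \<longlonglongrightarrow> (if T = {} then 1 else 0)"
    proof (cases "T = {}")
      case True
      have "\<forall>\<^sub>F x in sequentially. \<pi> x > 0"
        unfolding \<pi>_def using prime_count_at_top[unfolded filterlim_at_top_dense] by blast
      then have "\<forall>\<^sub>F x in sequentially. 1 = S T x / \<pi> x"
        by eventually_elim (simp add: S_def True \<pi>_def card_gt_0_iff)
      then have "(\<lambda>x. S T x / \<pi> x) \<longlonglongrightarrow> 1" by (rule Lim_transform_eventually[OF tendsto_const])
      then show ?thesis using True by simp
    next
      case False
      have "(\<lambda>x. S T x / \<pi> x) \<longlonglongrightarrow> 0"
        unfolding S_def \<pi>_def using T Q False by (intro Legendre_prime_sum_negligible) (auto intro: finite_subset)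
      then show ?thesis using False by simp
    qed
  qed auto
  have "(\<Sum>T\<in>Pow Q. of_int (\<Prod>q\<in>T. e q) * (if T = {} then 1 else 0)) = (\<Sum>T\<in>Pow Q. if T = {} then 1 else 0 :: real)"
    by (intro sum.cong) auto
  also have "\<dots> = 1" using Q(1) by simp
  finally have l0: "(\<Sum>T\<in>Pow Q. of_int (\<Prod>q\<in>T. e q) * (if T = {} then 1 else 0)) = (1::real)" .
  have l: "(\<Sum>T\<in>Pow Q. of_int (\<Prod>q\<in>T. e q) * (if T = {} then 1 else 0)) / 2 ^ card Q = (1/2::real) ^ card Q"
    unfolding l0 by (simp add: power_one_over)
  have Fsum: "(\<Sum>p\<in>primes_upto x. F p) / \<pi> x = (\<Sum>T\<in>Pow Q. of_int (\<Prod>q\<in>T. e q) * (S T x / \<pi> x)) / 2 ^ card Q" for x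
  proof -
    have "(\<Prod>q\<in>Q. of_int (e q * legendre q p) + 1 :: real) = (\<Sum>T\<in>Pow Q. of_int (\<Prod>q\<in>T. e q) * of_int (\<Prod>q\<in>T. legendre q p))" for p
      unfolding prod_add[OF Q(1)] by (intro sum.cong refl) (simp add: prod.distrib)
    then have "(\<Sum>p\<in>primes_upto x. F p) = (\<Sum>p\<in>primes_upto x. \<Sum>T\<in>Pow Q. of_int (\<Prod>q\<in>T. e q) * of_int (\<Prod>q\<in>T. legendre q p)) / 2 ^ card Q"
      unfolding F_def sum_divide_distrib[symmetric] by (simp only:)
    also have "\<dots> = (\<Sum>T\<in>Pow Q. \<Sum>p\<in>primes_upto x. of_int (\<Prod>q\<in>T. e q) * of_int (\<Prod>q\<in>T. legendre q p)) / 2 ^ card Q"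
      by (subst sum.swap) (rule refl)
    also have "\<dots> = (\<Sum>T\<in>Pow Q. of_int (\<Prod>q\<in>T. e q) * S T x) / 2 ^ card Q"
      unfolding S_def sum_distrib_left ..
    finally show ?thesis by (simp only: sum_divide_distrib times_divide_eq_right divide_divide_eq_left mult.commute[of "2 ^ card Q"])
  qed
  have limF: "(\<lambda>x. (\<Sum>p\<in>primes_upto x. F p) / \<pi> x) \<longlonglongrightarrow> (1/2) ^ card Q"
    using lim unfolding l Fsum .
  have F01: "0 \<le> F p \<and> F p \<le> 1" for p
  proof -
    have b: "0 \<le> real_of_int (e q * legendre q p) + 1 \<and> real_of_int (e q * legendre q p) + 1 \<le> 2" if "q \<in> Q" for q
      using e[OF that] Legendre_values[of "int q" "int p"] by auto
    have "(\<Prod>q\<in>Q. of_int (e q * legendre q p) + 1 :: real) \<le> (\<Prod>q\<in>Q. 2)"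
      using b by (intro prod_mono) auto
    moreover have "0 \<le> (\<Prod>q\<in>Q. of_int (e q * legendre q p) + 1 :: real)"
      using b by (intro prod_nonneg) auto
    ultimately show ?thesis unfolding F_def by simp
  qed
  have Fi: "F p = (if \<forall>q\<in>Q. legendre q p = e q then 1 else 0)" if p: "prime p" "p \<notin> Q" for p
  proof -
    have L: "legendre q p = 1 \<or> legendre q p = -1" if "q \<in> Q" for q
    proof -
      have "\<not> p dvd q" using primes_dvd_imp_eq[OF p(1) Q(2)[OF that]] that p(2) by auto
      then show ?thesis using Legendre_values[of "int q" "int p"] Legendre_eq_0_iff[of "int q" "int p"] by auto
    qed
    show ?thesis
    proof (cases "\<forall>q\<in>Q. legendre q p = e q")
      case True
      have "(\<Prod>q\<in>Q. of_int (e q * legendre q p) + 1 :: real) = (\<Prod>q\<in>Q. 2)"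
        using True e by (intro prod.cong refl) fastforce
      then show ?thesis using True by (simp add: F_def)
    next
      case False
      then obtain q where q: "q \<in> Q" "legendre q p \<noteq> e q" by blast
      then have "real_of_int (e q * legendre q p) + 1 = 0" using L[OF q(1)] e[OF q(1)] by auto
      then have "(\<Prod>q\<in>Q. of_int (e q * legendre q p) + 1 :: real) = 0"
        using prod_zero[OF Q(1)] q(1) by metis
      then show ?thesis using False by (simp add: F_def)
    qed
  qed
  have bound: "\<bar>real (card (A x)) - (\<Sum>p\<in>primes_upto x. F p)\<bar> \<le> real (card Q)" for x
  proof -
    define I where "I = (\<lambda>p. if \<forall>q\<in>Q. legendre q p = e q then 1 else 0 :: real)"
    have "real (card (A x)) = (\<Sum>p\<in>primes_upto x. I p)"
      unfolding A_def I_def by (simp add: sum.If_cases Int_def)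
    then have "real (card (A x)) - (\<Sum>p\<in>primes_upto x. F p) = (\<Sum>p\<in>primes_upto x. I p - F p)"
      by (simp add: sum_subtractf)
    also have "\<dots> = (\<Sum>p\<in>primes_upto x \<inter> Q. I p - F p)"
    proof (rule sum.mono_neutral_right)
      show "\<forall>p\<in>primes_upto x - primes_upto x \<inter> Q. I p - F p = 0"
        using Fi by (auto simp: primes_upto_def I_def)
    qed auto
    also have "\<bar>\<dots>\<bar> \<le> (\<Sum>p\<in>primes_upto x \<inter> Q. \<bar>I p - F p\<bar>)" by (rule sum_abs)
    also have "\<dots> \<le> (\<Sum>p\<in>primes_upto x \<inter> Q. 1)"
    proof (rule sum_mono)
      fix p show "\<bar>I p - F p\<bar> \<le> 1" using F01[of p] by (simp add: I_def abs_if)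
    qed
    also have "\<dots> \<le> real (card Q)" using card_mono[of Q "primes_upto x \<inter> Q"] Q(1) by simp
    finally show ?thesis .
  qed
  have "(\<lambda>x. (real (card (A x)) - (\<Sum>p\<in>primes_upto x. F p)) / \<pi> x) \<longlonglongrightarrow> 0"
  proof (rule Lim_null_comparison[OF always_eventually const_over_prime_count], rule allI)
    fix x
    show "norm ((real (card (A x)) - (\<Sum>p\<in>primes_upto x. F p)) / \<pi> x) \<le> real (card Q) / prime_count x"
      using bound[of x] by (simp add: divide_right_mono \<pi>_def)
  qed
  from tendsto_add[OF this limF] show ?thesis
    by (simp add: A_def \<pi>_def add_divide_distrib[symmetric])
qed

section \<open>The two least prime non-residues\<close>

lemma Legendre_neg_prime_factor:
  assumes p: "prime p" "2 < p"
  shows "legendre n p = -1 \<Longrightarrow> \<exists>q. prime q \<and> q dvd n \<and> legendre q p = -1"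
proof (induction n rule: less_induct)
  case (less n)
  have n0: "n \<noteq> 0"
  proof
    assume "n = 0"
    then have "legendre n p = 0" by (simp add: Legendre_eq_0_iff)
    then show False using less.prems by simp
  qed
  have n1: "n \<noteq> 1" using less.prems Legendre_one[of p] p by auto
  then obtain q where q: "prime q" "q dvd n" using prime_factor_nat by blast
  then obtain k where k: "n = q * k" by auto
  show ?case
  proof (cases "legendre q p = -1")
    case False
    have "legendre q p * legendre k p = -1"
      using less.prems Legendre_mult[OF p, of "int q" "int k"] by (simp add: k)
    then have "legendre k p = -1"
      using False Legendre_values[of "int q" "int p"] by auto
    moreover have "k < n" using n0 k prime_gt_1_nat[OF q(1)] by simp
    ultimately obtain r where "prime r" "r dvd k" "legendre r p = -1" using less.IH by blast
    then show ?thesis using k by (intro exI[of _ r]) auto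
  qed (use q in blast)
qed

text \<open>Euclid's argument: if there were finitely many, some n would be 1 modulo their product
  and a non-residue modulo p. A prime factor of n that is a non-residue would then divide 1.
  Infinity is what makes \<open>enumerate\<close>, and so \<open>nres\<close>, meaningful.\<close>

lemma infinite_nonres_primes:
  assumes p: "prime p" "2 < p"
  shows "infinite (nonres_primes p)"
proof
  assume fin: "finite (nonres_primes p)"
  obtain r where r: "legendre r p = -1" using exists_nonresidue[OF p] by blast
  have "coprime q p" if "q \<in> nonres_primes p" for q
  proof -
    have "q \<noteq> p" using that Legendre_eq_0_iff[of "int p" "int p"] by (auto simp: nonres_primes_def)
    then show ?thesis using that p(1) primes_coprime by (auto simp: nonres_primes_def)
  qed
  then have "coprime (\<Prod>(nonres_primes p)) p" by (rule prod_coprime_left)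
  then obtain n where n: "[n = 1] (mod \<Prod>(nonres_primes p))" "[n = r] (mod p)"
    using binary_chinese_remainder_nat by blast
  have "legendre n p = -1"
    using Legendre_cong[of "int n" "int r" "int p"] n(2) r by (simp add: cong_int_iff)
  then obtain q where q: "prime q" "q dvd n" "legendre q p = -1"
    using Legendre_neg_prime_factor[OF p] by blast
  then have "q \<in> nonres_primes p" by (simp add: nonres_primes_def)
  then have "q dvd \<Prod>(nonres_primes p)" using fin by (intro dvd_prodI) auto
  then have "[n = 1] (mod q)" using n(1) cong_dvd_modulus_nat by blast
  then have "q dvd 1" using q(2) cong_dvd_iff by blast
  then show False using q(1) by simp
qed

lemma nres_properties:
  assumes "infinite (nonres_primes p)"
  shows "nres 1 p \<in> nonres_primes p" "nres 2 p \<in> nonres_primes p" "nres 1 p < nres 2 p"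
    "\<And>q. q \<in> nonres_primes p \<Longrightarrow> q = nres 1 p \<or> nres 2 p \<le> q"
proof -
  show "nres 1 p \<in> nonres_primes p" "nres 2 p \<in> nonres_primes p"
    unfolding nres_def using assms by (auto intro: enumerate_in_set)
  show "nres 1 p < nres 2 p" unfolding nres_def using enumerate_mono[of 0 1, OF _ assms] by simp
  fix q assume "q \<in> nonres_primes p"
  then obtain n where n: "enumerate (nonres_primes p) n = q" using enumerate_Ex[OF assms] by blast
  show "q = nres 1 p \<or> nres 2 p \<le> q"
  proof (cases "n = 0")
    case False
    then have "n = 1 \<or> 1 < n" by linarith
    then have "enumerate (nonres_primes p) 1 \<le> enumerate (nonres_primes p) n"
      using enumerate_mono[of 1 n, OF _ assms] by auto
    then show ?thesis using n by (simp add: nres_def)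
  qed (use n in \<open>simp add: nres_def\<close>)
qed

lemma nth_prime_strict_mono: "1 \<le> m \<Longrightarrow> m < n \<Longrightarrow> nth_prime m < nth_prime n"
  unfolding nth_prime_def using enumerate_mono[of "m - 1" "n - 1", OF _ primes_infinite] by auto

lemma nth_prime_less_iff: "1 \<le> m \<Longrightarrow> 1 \<le> n \<Longrightarrow> nth_prime m < nth_prime n \<longleftrightarrow> m < n"
  by (metis nth_prime_strict_mono linorder_neqE_nat less_asym)

lemma prime_nth_prime: "prime (nth_prime m)"
  unfolding nth_prime_def using enumerate_in_set[OF primes_infinite] by blast

lemma prime_eq_nth_prime: "prime q \<Longrightarrow> \<exists>m\<ge>1. q = nth_prime m"
proof -
  assume "prime q"
  then obtain n where "enumerate {p. prime p} n = q" using enumerate_Ex[OF primes_infinite] by blast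
  then show ?thesis by (intro exI[of _ "Suc n"]) (simp add: nth_prime_def)
qed

definition primes_le :: "real \<Rightarrow> nat set" where
  "primes_le y = {q. prime q \<and> real q \<le> y}"

lemma finite_primes_le [simp]: "finite (primes_le y)"
  by (rule finite_subset[of _ "{..nat \<lfloor>y\<rfloor>}"]) (auto simp: primes_le_def le_nat_floor)

text \<open>The indices counted form an initial segment {1..K}, so their maximum is their number.
  The second claim supplies the geometric majorant for the series over m.\<close>

lemma nmz_properties:
  assumes z: "z > 1" and m: "m \<ge> 1"
  shows "card (primes_le (z * real (nth_prime m))) = nmz m z" "m \<le> nmz m z"
proof -
  let ?y = "z * real (nth_prime m)"
  define K where "K = {n. n \<ge> 1 \<and> real (nth_prime n) \<le> ?y}"
  have im: "nth_prime ` K = primes_le ?y"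
    using prime_eq_nth_prime by (auto simp: K_def primes_le_def prime_nth_prime)
  have inj: "inj_on nth_prime K"
    unfolding K_def inj_on_def using nth_prime_less_iff by (metis (mono_tags, lifting) linorder_neqE_nat mem_Collect_eq nat_less_le)
  have fin: "finite K" using finite_imageD[OF _ inj] im by simp
  have "real (nth_prime m) \<le> ?y" using z by (simp add: mult_le_cancel_right1)
  then have mK: "m \<in> K" using m by (simp add: K_def)
  have nmz: "nmz m z = Max K" by (simp add: nmz_def K_def)
  show "m \<le> nmz m z" unfolding nmz using fin mK by simp
  have "K = {1..Max K}"
  proof
    show "K \<subseteq> {1..Max K}" using fin by (auto simp: K_def)
    show "{1..Max K} \<subseteq> K"
    proof
      fix n assume n: "n \<in> {1..Max K}"
      have "Max K \<in> K" using fin mK by (intro Max_in) auto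
      then have M: "real (nth_prime (Max K)) \<le> ?y" by (simp add: K_def)
      have "nth_prime n \<le> nth_prime (Max K)"
        using n nth_prime_strict_mono[of n "Max K"] by (cases "n = Max K") auto
      then show "n \<in> K" using n M by (auto simp: K_def)
    qed
  qed
  then have "card K = Max K" by (metis card_atLeastAtMost diff_Suc_1)
  then show "card (primes_le ?y) = nmz m z" unfolding im[symmetric] nmz using card_image[OF inj] by simp
qed

text \<open>The event n_1(p) = p_m, n_2(p) > z * p_m in terms of Legendre symbols. The two agree for
  odd p except possibly when p itself is at most z * p_m.\<close>

definition pattern_primes :: "real \<Rightarrow> nat \<Rightarrow> nat set" where
  "pattern_primes z m = {p. prime p \<and> (\<forall>q\<in>primes_le (z * real (nth_prime m)).
      legendre q p = (if q = nth_prime m then -1 else 1))}"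

text \<open>Keeps p = 2 out of \<open>pattern_primes\<close>. It has no prime non-residues, so its
  \<open>nres\<close> values are defaults.\<close>

lemma Legendre_two_right: "Legendre a 2 \<noteq> -1"
proof -
  have "QuadRes 2 a"
  proof -
    have "even (a\<^sup>2 - a)" by simp
    then have "[a\<^sup>2 = a] (mod 2)" by (simp add: cong_iff_dvd_diff)
    then show ?thesis by (auto simp: QuadRes_def)
  qed
  then show ?thesis by (simp add: Legendre_def)
qed

lemma pattern_primes_properties:
  assumes z: "z > 1" and p: "p \<in> pattern_primes z m"
  shows "2 < p" "nres 1 p = nth_prime m" "real (nres 2 p) > z * real (nres 1 p)"
proof -
  have "real (nth_prime m) \<le> z * real (nth_prime m)" using z by (simp add: mult_le_cancel_right1)
  then have mQ: "nth_prime m \<in> primes_le (z * real (nth_prime m))"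
    by (simp add: primes_le_def prime_nth_prime)
  have pp: "prime p" using p by (simp add: pattern_primes_def)
  have L: "Legendre (int (nth_prime m)) (int p) = -1" using p mQ by (auto simp: pattern_primes_def)
  then have "p \<noteq> 2" using Legendre_two_right[of "int (nth_prime m)"] by auto
  then show p2: "2 < p" using prime_ge_2_nat[OF pp] by simp
  note N = nres_properties[OF infinite_nonres_primes[OF pp p2]]
  have mN: "nth_prime m \<in> nonres_primes p" using L by (simp add: nonres_primes_def prime_nth_prime)
  have out: "q \<notin> primes_le (z * real (nth_prime m))" if "q \<in> nonres_primes p" "q \<noteq> nth_prime m" for q
    using that p by (auto simp: nonres_primes_def pattern_primes_def)
  have big: "real q > z * real (nth_prime m)" if "q \<in> nonres_primes p" "q \<noteq> nth_prime m" for q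
    using out[OF that] that by (auto simp: primes_le_def nonres_primes_def)
  have zp: "z * real (nth_prime m) \<ge> real (nth_prime m)" by fact
  show n1: "nres 1 p = nth_prime m"
  proof (rule ccontr)
    assume ne: "nres 1 p \<noteq> nth_prime m"
    then have "nres 2 p \<le> nth_prime m" using N(4)[OF mN] by auto
    moreover have "real (nres 1 p) > real (nth_prime m)" using big[OF N(1) ne] zp by linarith
    ultimately show False using N(3) by simp
  qed
  show "real (nres 2 p) > z * real (nres 1 p)"
    unfolding n1 using N(2,3) n1 by (intro big) auto
qed

text \<open>The assumption \<open>out\<close> excludes q = p, where the symbol would be 0 instead of
  1.\<close>

lemma pattern_primes_complete:
  assumes z: "z > 1" and p: "prime p" "2 < p" "nres 1 p = nth_prime m"
    and gap: "real (nres 2 p) > z * real (nres 1 p)" and out: "p \<notin> primes_le (z * real (nth_prime m))"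
  shows "p \<in> pattern_primes z m"
proof -
  note N = nres_properties[OF infinite_nonres_primes[OF p(1,2)]]
  have "legendre q p = (if q = nth_prime m then -1 else 1)"
    if q: "q \<in> primes_le (z * real (nth_prime m))" for q
  proof (cases "q = nth_prime m")
    case True
    then show ?thesis using N(1) p(3) by (simp add: nonres_primes_def)
  next
    case False
    have qp: "prime q" "q \<noteq> p" using q out by (auto simp: primes_le_def)
    have "q \<notin> nonres_primes p"
    proof
      assume "q \<in> nonres_primes p"
      then have "nres 2 p \<le> q" using N(4) False p(3) by auto
      then show False using gap q p(3) by (auto simp: primes_le_def)
    qed
    then have "legendre q p \<noteq> -1" using qp by (simp add: nonres_primes_def)
    moreover have "\<not> p dvd q" using primes_dvd_imp_eq[OF p(1) qp(1)] qp(2) by auto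
    then have "legendre q p \<noteq> 0" by (simp add: Legendre_eq_0_iff)
    ultimately show ?thesis using Legendre_values[of "int q" "int p"] False by auto
  qed
  then show ?thesis using p(1) by (simp add: pattern_primes_def)
qed

definition gap_primes :: "real \<Rightarrow> nat set" where
  "gap_primes z = {p. prime p \<and> real (nres 2 p) > z * real (nres 1 p)}"

text \<open>Absorbs the tail: a prime whose least prime non-residue lies beyond the first M primes
  belongs here, unless it is 2 or one of those M primes.\<close>

definition residue_primes :: "nat \<Rightarrow> nat set" where
  "residue_primes M = {p. prime p \<and> (\<forall>q\<in>nth_prime ` {1..M}. legendre q p = 1)}"

text \<open>The patterns for different m are disjoint because \<open>nres 1 p\<close> determines m,
  and their union lies in \<open>gap_primes z\<close>. Whatever else \<open>gap_primes z\<close>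
  contains is in a finite set or in \<open>residue_primes M\<close>.\<close>

lemma gap_primes_sandwich:
  assumes z: "z > 1"
  shows "\<exists>C. \<forall>x. \<bar>real (card (gap_primes z \<inter> primes_upto x)) - (\<Sum>m\<in>{1..M}. real (card (pattern_primes z m \<inter> primes_upto x)))\<bar>
     \<le> C + real (card (residue_primes M \<inter> primes_upto x))"
proof -
  \<comment> \<open>The exceptions: 2, where \<open>nres\<close> is a default, and the primes p
    small enough to make one of the symbols involved vanish.\<close>
  define X where "X = insert 2 (nth_prime ` {1..M} \<union> (\<Union>m\<in>{1..M}. primes_le (z * real (nth_prime m))))"
  have finX: "finite X" by (simp add: X_def)
  have "\<bar>real (card (gap_primes z \<inter> primes_upto x)) - (\<Sum>m\<in>{1..M}. real (card (pattern_primes z m \<inter> primes_upto x)))\<bar>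
     \<le> real (card X) + real (card (residue_primes M \<inter> primes_upto x))" for x
  proof -
    let ?U = "\<Union>m\<in>{1..M}. pattern_primes z m \<inter> primes_upto x"
    have "disjoint_family_on (\<lambda>m. pattern_primes z m \<inter> primes_upto x) {1..M}"
      unfolding disjoint_family_on_def
    proof (intro ballI impI)
      fix m n assume mn: "m \<in> {1..M}" "n \<in> {1..M}" "m \<noteq> n"
      then have "nth_prime m \<noteq> nth_prime n" using nth_prime_less_iff[of m n] nth_prime_less_iff[of n m] by auto
      then show "pattern_primes z m \<inter> primes_upto x \<inter> (pattern_primes z n \<inter> primes_upto x) = {}"
      proof (intro equals0I)
        fix p assume "p \<in> pattern_primes z m \<inter> primes_upto x \<inter> (pattern_primes z n \<inter> primes_upto x)"
        then have "nres 1 p = nth_prime m" "nres 1 p = nth_prime n"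
          using pattern_primes_properties(2)[OF z] by blast+
        then show False using \<open>nth_prime m \<noteq> nth_prime n\<close> by simp
      qed
    qed
    then have cU: "card ?U = (\<Sum>m\<in>{1..M}. card (pattern_primes z m \<inter> primes_upto x))"
      by (intro card_UN_disjoint') auto
    have sub1: "?U \<subseteq> gap_primes z \<inter> primes_upto x"
    proof
      fix p assume "p \<in> ?U"
      then obtain m where m: "p \<in> pattern_primes z m" "p \<in> primes_upto x" by blast
      then have "prime p" by (simp add: primes_upto_def)
      then show "p \<in> gap_primes z \<inter> primes_upto x"
        using pattern_primes_properties(3)[OF z m(1)] m(2) unfolding gap_primes_def by blast
    qed
    have sub2: "gap_primes z \<inter> primes_upto x \<subseteq> ?U \<union> (X \<union> (residue_primes M \<inter> primes_upto x))"
    proof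
      fix p assume p: "p \<in> gap_primes z \<inter> primes_upto x"
      show "p \<in> ?U \<union> (X \<union> (residue_primes M \<inter> primes_upto x))"
      proof (cases "p \<in> X")
        case False
        have pp: "prime p" "real (nres 2 p) > z * real (nres 1 p)" using p by (auto simp: gap_primes_def)
        have p2: "2 < p" using False prime_ge_2_nat[OF pp(1)] by (cases "p = 2") (auto simp: X_def)
        note N = nres_properties[OF infinite_nonres_primes[OF pp(1) p2]]
        obtain m where m: "m \<ge> 1" "nres 1 p = nth_prime m"
          using N(1) prime_eq_nth_prime by (auto simp: nonres_primes_def)
        show ?thesis
        proof (cases "m \<le> M")
          case True
          then have "p \<notin> primes_le (z * real (nth_prime m))" using False m by (auto simp: X_def)
          then have "p \<in> pattern_primes z m" using pattern_primes_complete[OF z pp(1) p2 m(2) pp(2)] by blast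
          then show ?thesis using p m True by auto
        next
          case mM: False
          have "Legendre (int (nth_prime i)) (int p) = 1" if i: "i \<in> {1..M}" for i
          proof -
            have "nth_prime i < nres 1 p" unfolding m(2) using i mM by (intro nth_prime_strict_mono) auto
            then have "nth_prime i \<notin> nonres_primes p" using N(3) N(4)[of "nth_prime i"] by auto
            then have "Legendre (int (nth_prime i)) (int p) \<noteq> -1" by (simp add: nonres_primes_def prime_nth_prime)
            moreover have "nth_prime i \<noteq> p" using False i by (auto simp: X_def)
            then have "\<not> p dvd nth_prime i" using primes_dvd_imp_eq[OF pp(1) prime_nth_prime] by blast
            then have "Legendre (int (nth_prime i)) (int p) \<noteq> 0" by (simp add: Legendre_eq_0_iff)
            ultimately show ?thesis using Legendre_values[of "int (nth_prime i)" "int p"] by auto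
          qed
          then show ?thesis using p pp by (auto simp: residue_primes_def)
        qed
      qed auto
    qed
    have "card ?U \<le> card (gap_primes z \<inter> primes_upto x)" using sub1 by (intro card_mono) auto
    moreover have "card (gap_primes z \<inter> primes_upto x) \<le> card (?U \<union> (X \<union> (residue_primes M \<inter> primes_upto x)))"
      using sub2 finX by (intro card_mono) auto
    moreover have "\<dots> \<le> card ?U + (card X + card (residue_primes M \<inter> primes_upto x))"
      using card_Un_le[of ?U "X \<union> (residue_primes M \<inter> primes_upto x)"] card_Un_le[of X "residue_primes M \<inter> primes_upto x"] by linarith
    ultimately show ?thesis unfolding of_nat_sum[symmetric] cU[symmetric] by linarith
  qed
  then show ?thesis by blast
qed

lemma pattern_primes_density:
  assumes z: "z > 1" and m: "m \<ge> 1"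
  shows "(\<lambda>x. real (card (pattern_primes z m \<inter> primes_upto x)) / prime_count x) \<longlonglongrightarrow> (1/2) ^ nmz m z"
proof -
  have eq: "pattern_primes z m \<inter> primes_upto x = {p \<in> primes_upto x. \<forall>q\<in>primes_le (z * real (nth_prime m)).
      legendre q p = (if q = nth_prime m then -1 else 1)}" for x
    by (auto simp: pattern_primes_def primes_upto_def)
  show ?thesis unfolding eq nmz_properties(1)[OF assms, symmetric]
    by (rule Legendre_pattern_density) (auto simp: primes_le_def[of "z * real (nth_prime m)"] intro: finite_primes_le[unfolded primes_le_def])
qed

lemma residue_primes_density:
  "(\<lambda>x. real (card (residue_primes M \<inter> primes_upto x)) / prime_count x) \<longlonglongrightarrow> (1/2) ^ M"
proof -
  have "inj_on nth_prime {1..M}"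
    by (rule linorder_inj_onI) (use nth_prime_strict_mono in \<open>force+\<close>)
  then have c: "card (nth_prime ` {1..M}) = M" by (simp add: card_image)
  have eq: "residue_primes M \<inter> primes_upto x = {p \<in> primes_upto x. \<forall>q\<in>nth_prime ` {1..M}. legendre q p = (\<lambda>_. 1) q}" for x
    by (auto simp: residue_primes_def primes_upto_def)
  show ?thesis unfolding eq using Legendre_pattern_density[of "nth_prime ` {1..M}" "\<lambda>_. 1"] prime_nth_prime
    unfolding c by blast
qed

text \<open>Exchange of limit and sum: M is fixed first, so large that the tail of the series and
  the density 2^(-M) of \<open>residue_primes M\<close> are both below r/4. Only then does x
  grow.\<close>

lemma gap_primes_density:
  assumes z: "z > 1"
  shows "(\<lambda>x. real (card (gap_primes z \<inter> primes_upto x)) / prime_count x) \<longlonglongrightarrow> (\<Sum>m. (1/2) ^ nmz (m + 1) z)"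
proof (rule LIMSEQ_I)
  fix r :: real assume r: "r > 0"
  define \<pi> where "\<pi> = (\<lambda>x. prime_count x)"
  define g where "g = (\<lambda>m. (1/2::real) ^ nmz (m + 1) z)"
  have "summable g"
  proof (rule summable_comparison_test')
    show "summable (\<lambda>m. (1/2::real) ^ m)" by (intro summable_geometric) auto
    show "norm (g m) \<le> (1/2) ^ m" for m
      using nmz_properties(2)[OF z, of "m + 1"] unfolding g_def by (simp add: power_decreasing)
  qed
  then have lg: "(\<lambda>M. \<Sum>m<M. g m) \<longlonglongrightarrow> suminf g" by (rule summable_LIMSEQ)
  have ev1: "\<forall>\<^sub>F M in sequentially. \<bar>(\<Sum>m<M. g m) - suminf g\<bar> < r / 4"
    using tendstoD[OF lg, of "r / 4"] r unfolding dist_real_def by simp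
  have "(\<lambda>M. (1/2::real) ^ M) \<longlonglongrightarrow> 0" by (intro LIMSEQ_power_zero) auto
  then have "\<forall>\<^sub>F M in sequentially. (1/2::real) ^ M < r / 4" using r by (intro order_tendstoD) auto
  with ev1 have "\<forall>\<^sub>F M in sequentially. \<bar>(\<Sum>m<M. g m) - suminf g\<bar> < r / 4 \<and> (1/2::real) ^ M < r / 4"
    by eventually_elim auto
  then obtain M where M: "\<bar>(\<Sum>m<M. g m) - suminf g\<bar> < r / 4" "(1/2::real) ^ M < r / 4"
    using eventually_happens'[OF sequentially_bot] by blast
  obtain C where C: "\<And>x. \<bar>real (card (gap_primes z \<inter> primes_upto x)) - (\<Sum>m\<in>{1..M}. real (card (pattern_primes z m \<inter> primes_upto x)))\<bar>
     \<le> C + real (card (residue_primes M \<inter> primes_upto x))"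
    using gap_primes_sandwich[OF z, of M] by blast
  have "(\<lambda>x. \<Sum>m\<in>{1..M}. real (card (pattern_primes z m \<inter> primes_upto x)) / \<pi> x) \<longlonglongrightarrow> (\<Sum>m\<in>{1..M}. (1/2) ^ nmz m z)"
    unfolding \<pi>_def by (intro tendsto_sum pattern_primes_density[OF z]) auto
  also have "(\<Sum>m\<in>{1..M}. (1/2::real) ^ nmz m z) = (\<Sum>m<M. g m)"
    unfolding g_def by (rule sum.reindex_bij_witness[of _ Suc "\<lambda>m. m - 1"]) auto
  finally have l1: "(\<lambda>x. \<Sum>m\<in>{1..M}. real (card (pattern_primes z m \<inter> primes_upto x)) / \<pi> x) \<longlonglongrightarrow> (\<Sum>m<M. g m)" .
  have "(\<lambda>x. C / \<pi> x + real (card (residue_primes M \<inter> primes_upto x)) / \<pi> x) \<longlonglongrightarrow> 0 + (1/2) ^ M"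
    unfolding \<pi>_def by (intro tendsto_add const_over_prime_count residue_primes_density)
  then have l2: "(\<lambda>x. C / \<pi> x + real (card (residue_primes M \<inter> primes_upto x)) / \<pi> x) \<longlonglongrightarrow> (1/2) ^ M" by simp
  have ev2: "\<forall>\<^sub>F x in sequentially. \<bar>(\<Sum>m\<in>{1..M}. real (card (pattern_primes z m \<inter> primes_upto x)) / \<pi> x) - (\<Sum>m<M. g m)\<bar> < r / 4"
    using tendstoD[OF l1, of "r / 4"] r unfolding dist_real_def by simp
  have ev3: "\<forall>\<^sub>F x in sequentially. C / \<pi> x + real (card (residue_primes M \<inter> primes_upto x)) / \<pi> x < r / 4"
    using order_tendstoD(2)[OF l2 M(2)] .
  have "\<forall>\<^sub>F x in sequentially. norm (real (card (gap_primes z \<inter> primes_upto x)) / \<pi> x - suminf g) < r"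
    using ev2 ev3
  proof eventually_elim
    case (elim x)
    have "\<bar>real (card (gap_primes z \<inter> primes_upto x)) / \<pi> x - (\<Sum>m\<in>{1..M}. real (card (pattern_primes z m \<inter> primes_upto x)) / \<pi> x)\<bar>
      = \<bar>real (card (gap_primes z \<inter> primes_upto x)) - (\<Sum>m\<in>{1..M}. real (card (pattern_primes z m \<inter> primes_upto x)))\<bar> / \<pi> x"
      by (simp add: sum_divide_distrib[symmetric] diff_divide_distrib[symmetric] abs_divide \<pi>_def)
    also have "\<dots> \<le> (C + real (card (residue_primes M \<inter> primes_upto x))) / \<pi> x"
      using C[of x] by (intro divide_right_mono) (auto simp: \<pi>_def)
    also have "\<dots> = C / \<pi> x + real (card (residue_primes M \<inter> primes_upto x)) / \<pi> x" by (rule add_divide_distrib)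
    finally have d: "\<bar>real (card (gap_primes z \<inter> primes_upto x)) / \<pi> x - (\<Sum>m\<in>{1..M}. real (card (pattern_primes z m \<inter> primes_upto x)) / \<pi> x)\<bar> < r / 4"
      using elim(2) by linarith
    show ?case unfolding real_norm_def using d elim(1) M(1) r by linarith
  qed
  then show "\<exists>no. \<forall>x\<ge>no. norm (real (card (gap_primes z \<inter> primes_upto x)) / prime_count x - (\<Sum>m. (1/2) ^ nmz (m + 1) z)) < r"
    unfolding g_def \<pi>_def eventually_sequentially .
qed

theorem theorem1p2:
  fixes z :: real
  assumes "z > 1"
  shows "((\<lambda>x::real. real (card {p::nat. prime p \<and> real p \<le> x \<and>
              real (nres 2 p) > z * real (nres 1 p)}) / real (prime_pi x))
          \<longlongrightarrow> (\<Sum>m. (1/2::real) ^ nmz (m + 1) z)) at_top"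
proof -
  \<comment> \<open>Both counts depend only on the integer part of x once x >= 0, so the limit along
    the integers suffices.\<close>
  have "filterlim (\<lambda>x::real. nat \<lfloor>x\<rfloor>) at_top at_top"
    by (rule filterlim_compose[OF filterlim_nat_sequentially filterlim_floor_sequentially])
  then have "((\<lambda>x::real. real (card (gap_primes z \<inter> primes_upto (nat \<lfloor>x\<rfloor>))) / real (card (primes_upto (nat \<lfloor>x\<rfloor>))))
      \<longlongrightarrow> (\<Sum>m. (1/2::real) ^ nmz (m + 1) z)) at_top"
    by (rule filterlim_compose[OF gap_primes_density[OF assms]])
  moreover have "\<forall>\<^sub>F x in at_top. real (card (gap_primes z \<inter> primes_upto (nat \<lfloor>x\<rfloor>))) / real (card (primes_upto (nat \<lfloor>x\<rfloor>)))
      = real (card {p::nat. prime p \<and> real p \<le> x \<and> real (nres 2 p) > z * real (nres 1 p)}) / real (prime_pi x)"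
    using eventually_ge_at_top[of 0]
  proof eventually_elim
    case (elim x)
    have le: "p \<le> nat \<lfloor>x\<rfloor> \<longleftrightarrow> real p \<le> x" for p using elim by (auto simp: le_nat_iff le_floor_iff)
    have "gap_primes z \<inter> primes_upto (nat \<lfloor>x\<rfloor>) = {p::nat. prime p \<and> real p \<le> x \<and> real (nres 2 p) > z * real (nres 1 p)}"
      "primes_upto (nat \<lfloor>x\<rfloor>) = {p. prime p \<and> real p \<le> x}"
      unfolding gap_primes_def primes_upto_def le by auto
    then show ?case by (simp add: prime_pi_def)
  qed
  ultimately show ?thesis by (rule Lim_transform_eventually)
qed

end
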